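(* Let $\mathcal Z_{gen}$ be the generalized Zorich map described in the context, built from $\mathfrak h_{gen}$ with bi-Lipschitz constant $L$, angle constant $\theta_{\mathcal S}$ and scale factor $\lambda$. If $$\lambda>C_{h_{gen}}:=\frac{\max\{L^5,2L\}}{\min_{x\in Q}|\mathfrak h_{gen}(x)|\,\sin\theta_{\mathcal S}},$$ then $\mathcal J(\mathcal Z_{gen})=\mathbb R^3$.
   Context: Generalized Zorich maps. Let $Q=[-1,1]^2$ and let $\mathfrak h_{gen}=(\mathfrak h_{gen,1},\mathfrak h_{gen,2},\mathfrak h_{gen,3}):Q\to\mathbb R^3$ be a sense-preserving $L$-bi-Lipschitz map ($|a-b|/L\le|\mathfrak h_{gen}(a)-\mathfrak h_{gen}(b)|\le L|a-b|$) onto a surface $\mathcal S=\mathfrak h_{gen}(Q)$ such that: (1) $\mathcal S\subset\{x_3\ge0\}$; (2) the boundary $\mathfrak h_{gen}(\partial Q)$ of $\mathcal S$ lies in the plane $x_3=0$; (3) for each $x\in Q$ the ray from $0$ through $\mathfrak h_{gen}(x)$ meets $\mathcal S$ only at $\mathfrak h_{gen}(x)$; (4) (non-tangential position vector property) there are $\theta_{\mathcal S}\in(0,\pi/2)$ and $\varepsilon>0$ such that for all distinct $w,z\in\mathcal S$ with $|w-z|\le\varepsilon$ the acute angle between the line through $0$ and $z$ and the line through $w$ and $z$ is greater than $\theta_{\mathcal S}$; (5) $\min_{x\in Q}|\mathfrak h_{gen}(x)|>0$. Assume also $\mathfrak h_{gen,1}(t,t)=\mathfrak h_{gen,2}(t,t)$,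 $\mathfrak h_{gen,1}(t,-t)=-\mathfrak h_{gen,2}(t,-t)$ for $t\in[-1,1]$, $\mathfrak h_{gen}(0,0)=(0,0,1)$ and $\sup_{x\in Q}|\mathfrak h_{gen}(x)|=1$. For $\lambda\ge1$ let $h_{gen}(x_1,x_2)=\lambda\mathfrak h_{gen}(x_1/\lambda,x_2/\lambda)$ on $[-\lambda,\lambda]^2$, define $\mathcal Z_{gen}(x_1,x_2,x_3)=e^{x_3}h_{gen}(x_1,x_2)$ on $[-\lambda,\lambda]^2\times\mathbb R$, and extend to $\mathbb R^3$ by repeated reflection across the faces $x_1=(2k+1)\lambda$, $x_2=(2k+1)\lambda$ in the domain and across the plane $x_3=0$ in the range; this gives a quasiregular map with an essential singularity at infinity. Julia set. For a quasiregular map $f:\mathbb R^3\to\mathbb R^3$ with essential singularity at infinity, $\mathcal J(f)$ is the set of $x$ such that $\operatorname{cap}\big(\mathbb R^3\setminus\bigcup_{k\ge1}f^k(U)\big)=0$ for every neighbourhood $U$ of $x$, where for open $A$ and compact $C\subset A$, $\operatorname{cap}(A,C)=\inf_u\int_A|\nabla u|^3dm$ over nonnegative $u\in C_0^\infty(A)$ with $u\ge1$ on $C$; a compact set has zero capacity if $\operatorname{cap}(A,C)=0$ for some bounded open $A\supset C$, and an arbitrary set has zero capacity if all its compact subsets do. *)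

theory Defs
  imports "HOL-Analysis.Analysis"
begin

definition sqQ :: "(real^2) set" where
  "sqQ = cbox (- 1) 1"

text \<open>Acute angle between the line with direction u and the line with direction v
  (both assumed nonzero).\<close>
definition line_angle :: "real^3 \<Rightarrow> real^3 \<Rightarrow> real" where
  "line_angle u v = arccos (\<bar>u \<bullet> v\<bar> / (norm u * norm v))"

definition bi_lipschitz_on :: "real \<Rightarrow> (real^2) set \<Rightarrow> (real^2 \<Rightarrow> real^3) \<Rightarrow> bool" where
  "bi_lipschitz_on L S h \<longleftrightarrow>
     (\<forall>a\<in>S. \<forall>b\<in>S. dist a b / L \<le> dist (h a) (h b) \<and> dist (h a) (h b) \<le> L * dist a b)"

text \<open>Sense-preserving: the map (x1,x2,x3) to e^x3 h(x1,x2) has positive Jacobian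
  almost everywhere, i.e. det[d1 h, d2 h, h] > 0 at almost every point of Q.\<close>
definition sense_preserving_surf :: "(real^2 \<Rightarrow> real^3) \<Rightarrow> bool" where
  "sense_preserving_surf h \<longleftrightarrow>
     (AE x in lebesgue. x \<in> box (- 1) 1 \<longrightarrow>
        (\<exists>D. (h has_derivative D) (at x) \<and>
             det (vector [D (axis 1 1), D (axis 2 1), h x] :: real^3^3) > 0))"

text \<open>Index k of the interval [(2k-1)lam, (2k+1)lam] containing t, and the folding of t
  into [-lam, lam] by repeated reflection across the points (2k+1)lam.\<close>
definition fold_idx :: "real \<Rightarrow> real \<Rightarrow> int" where
  "fold_idx lam t = \<lfloor>(t / lam + 1) / 2\<rfloor>"

definition fold_pt :: "real \<Rightarrow> real \<Rightarrow> real" where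
  "fold_pt lam t = (if even (fold_idx lam t) then 1 else -1) * (t - 2 * real_of_int (fold_idx lam t) * lam)"

definition refl3 :: "real^3 \<Rightarrow> real^3" where
  "refl3 y = vector [y$1, y$2, - y$3]"

definition h_scaled :: "(real^2 \<Rightarrow> real^3) \<Rightarrow> real \<Rightarrow> real \<Rightarrow> real \<Rightarrow> real^3" where
  "h_scaled h lam x1 x2 = lam *\<^sub>R h (vector [x1 / lam, x2 / lam])"

text \<open>Z_gen(x) = e^x3 h_gen(x1,x2) on [-lam,lam]^2 x R, extended by reflections: each
  reflection in the domain across a face x_i=(2k+1)lam is accompanied by the
  reflection across x3=0 in the range.\<close>
definition zorich_gen :: "(real^2 \<Rightarrow> real^3) \<Rightarrow> real \<Rightarrow> real^3 \<Rightarrow> real^3" where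
  "zorich_gen h lam x =
     (let k = fold_idx lam (x$1) + fold_idx lam (x$2);
          y = exp (x$3) *\<^sub>R h_scaled h lam (fold_pt lam (x$1)) (fold_pt lam (x$2))
      in if even k then y else refl3 y)"

fun smooth_n :: "nat \<Rightarrow> (real^3 \<Rightarrow> real) \<Rightarrow> bool" where
  "smooth_n 0 u = continuous_on UNIV u"
| "smooth_n (Suc n) u = ((\<forall>x. u differentiable (at x)) \<and>
      (\<forall>i. smooth_n n (\<lambda>x. frechet_derivative u (at x) (axis i 1))))"

definition smooth_inf :: "(real^3 \<Rightarrow> real) \<Rightarrow> bool" where
  "smooth_inf u \<longleftrightarrow> (\<forall>n. smooth_n n u)"

definition grad3 :: "(real^3 \<Rightarrow> real) \<Rightarrow> real^3 \<Rightarrow> real^3" where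
  "grad3 u x = (\<chi> i. frechet_derivative u (at x) (axis i 1))"

definition fsupport :: "(real^3 \<Rightarrow> real) \<Rightarrow> (real^3) set" where
  "fsupport u = closure {x. u x \<noteq> 0}"

definition cap_admissible :: "(real^3) set \<Rightarrow> (real^3) set \<Rightarrow> (real^3 \<Rightarrow> real) set" where
  "cap_admissible A C = {u. smooth_inf u \<and> compact (fsupport u) \<and> fsupport u \<subseteq> A \<and>
        (\<forall>x. 0 \<le> u x) \<and> (\<forall>x\<in>C. 1 \<le> u x)}"

definition capacity :: "(real^3) set \<Rightarrow> (real^3) set \<Rightarrow> ennreal" where
  "capacity A C = (INF u\<in>cap_admissible A C.
       (\<integral>\<^sup>+ x. ennreal ((norm (grad3 u x)) ^ 3) * indicator A x \<partial>lborel))"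

definition compact_zero_cap :: "(real^3) set \<Rightarrow> bool" where
  "compact_zero_cap C \<longleftrightarrow> (\<exists>A. open A \<and> bounded A \<and> C \<subseteq> A \<and> capacity A C = 0)"

definition zero_capacity :: "(real^3) set \<Rightarrow> bool" where
  "zero_capacity E \<longleftrightarrow> (\<forall>C. compact C \<and> C \<subseteq> E \<longrightarrow> compact_zero_cap C)"

definition julia_set :: "(real^3 \<Rightarrow> real^3) \<Rightarrow> (real^3) set" where
  "julia_set f = {x. \<forall>U. open U \<and> x \<in> U \<longrightarrow>
      zero_capacity (UNIV - (\<Union>k\<in>{1..}. (f ^^ k) ` U))}"

end

theory Submission
  imports Defs
begin

text \<open>Call a point axial if it lies on one of the vertical lines that are mapped into the \<open>x\<^sub>3\<close>-axis.
  On that axis heights grow like iterated exponentials, so the images of a neighbourhood of an axial point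
  contain balls of radius proportional to their height and eventually cover every \<open>w \<noteq> 0\<close>; and \<open>{0}\<close> has
  zero capacity. It remains to see that every nonempty open set \<open>U\<close> has an image containing an axial point.

  If it had none, \<open>f\<close> would enlarge balls by a factor comparable to \<open>exp (x $ 3)\<close> as long as their radius is
  below the distance to the axial lines, so the heights along every orbit in \<open>U\<close> would have bounded sums.
  This is impossible for an orbit that is eventually always either high or extremely close to the axial
  lines. Such an orbit is found by a Borel-Cantelli argument. As long as the images of \<open>U\<close> avoid the planes
  over the diagonals, they stay in a prism on which \<open>f\<close> is essentially injective, and \<open>f\<close> expands the measure with
  density \<open>axdist x powr (- 3)\<close> by the factor \<open>lam * m * sin \<theta> / L ^ 5 > 1\<close>. Once an image meets such a plane,
  the next one meets \<open>x\<^sub>2 = \<plusminus> x\<^sub>1\<close>, which \<open>f\<close> maps into itself with area expanded by \<open>lam * m * sin \<theta> / (4 * L) > 1\<close>.\<close>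

section \<open>The surface and its cone\<close>

text \<open>The obstacle is the exponential factor: the Jacobian of \<open>f\<close> carries
  \<open>exp (x $ 3) ^ 3\<close>, which is tiny at low points, so Lebesgue measure is not expanded.
  But \<open>axdist\<close> grows at most by the factor \<open>L * exp (x $ 3)\<close>, so dividing
  by its cube cancels the exponential and turns a bound with L ^ 2 into one with L ^ 5. The price is
  infinite weight near the axial lines. Borel-Cantelli therefore only excludes times at which a
  point is low but not near such a line, a set of finite weight in each beam. A low point near a
  line is no loss in the end: it is thrown next to the axis and climbs to a height that pays for the
  descent. Expansion of measure also needs essentially one preimage per step. Two neighbouring beams
  provide that, but a set that crosses diagonal planes may spread over many beams; hence the
  separate planar argument. There heights are nonnegative after one step and plain area suffices.
  One factor 2 is lost to a local comparison and one to two-to-one folding. Both are recovered from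
  L ^ 4 >= 4, which holds because the corners of the square are 2 * sqrt 2 apart and the surface
  lies in the unit ball.\<close>

lemma norm_real2: "norm (x :: real^2) = sqrt ((x $ 1)\<^sup>2 + (x $ 2)\<^sup>2)"
  by (simp add: norm_vec_def L2_set_def sum_2)

lemma norm_real3: "norm (x :: real^3) = sqrt ((x $ 1)\<^sup>2 + (x $ 2)\<^sup>2 + (x $ 3)\<^sup>2)"
  by (simp add: norm_vec_def L2_set_def sum_3)

lemma inner_real3: "(x :: real^3) \<bullet> y = x $ 1 * y $ 1 + x $ 2 * y $ 2 + x $ 3 * y $ 3"
  by (simp add: inner_vec_def sum_3)

lemma norm_le_abs_sum_real2: "norm (x :: real^2) \<le> \<bar>x $ 1\<bar> + \<bar>x $ 2\<bar>"
  using norm_le_l1_cart[of x] by (simp add: sum_2)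

lemma norm_le_abs_sum_real3: "norm (x :: real^3) \<le> \<bar>x $ 1\<bar> + \<bar>x $ 2\<bar> + \<bar>x $ 3\<bar>"
  using norm_le_l1_cart[of x] by (simp add: sum_3)

lemma in_sqQ: "x \<in> sqQ \<longleftrightarrow> \<bar>x $ 1\<bar> \<le> 1 \<and> \<bar>x $ 2\<bar> \<le> 1"
  by (auto simp: sqQ_def mem_box_cart forall_2 abs_le_iff)

lemma in_box2: "x \<in> box (- 1) (1 :: real^2) \<longleftrightarrow> \<bar>x $ 1\<bar> < 1 \<and> \<bar>x $ 2\<bar> < 1"
  by (auto simp: mem_box_cart forall_2 abs_less_iff)

lemma frontier_sqQ: "frontier sqQ = sqQ - box (- 1) 1"
  by (simp add: sqQ_def frontier_def)

lemma compact_sqQ: "compact sqQ"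
  by (simp add: sqQ_def)

lemma box_subset_sqQ: "box (- 1) (1 :: real^2) \<subseteq> sqQ"
  by (simp add: sqQ_def box_subset_cbox)

lemma line_angle_gt_imp_inner_lt:
  assumes "line_angle u v > \<theta>" "0 < \<theta>" "\<theta> < pi / 2" "u \<noteq> 0" "v \<noteq> 0"
  shows "\<bar>u \<bullet> v\<bar> \<le> cos \<theta> * (norm u * norm v)"
proof -
  let ?c = "\<bar>u \<bullet> v\<bar> / (norm u * norm v)"
  have c: "0 \<le> ?c" "?c \<le> 1"
    using assms Cauchy_Schwarz_ineq2[of u v] by (auto simp: divide_le_eq_1)
  have "cos (arccos ?c) \<le> cos \<theta>"
  proof (rule cos_monotone_0_pi_le)
    show "arccos ?c \<le> pi" using arccos_bounded[of ?c] c by linarith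
  qed (use assms in \<open>auto simp: line_angle_def\<close>)
  then have "?c \<le> cos \<theta>" using c by simp
  then show ?thesis using assms by (simp add: divide_le_eq)
qed

text \<open>The distance of \<open>u\<close> from the line spanned by \<open>v\<close> is
  \<open>norm u\<close> times the sine of their angle, and the hypothesis says that this angle is at
  least \<open>\<theta>\<close>. The square added in the proof completes the square.\<close>

lemma norm_add_ge_sin:
  fixes u v :: "'a::real_inner"
  assumes "\<bar>u \<bullet> v\<bar> \<le> cos \<theta> * (norm u * norm v)" "0 < \<theta>" "\<theta> < pi / 2"
  shows "norm (u + v) \<ge> sin \<theta> * norm u" "norm (u + v) \<ge> sin \<theta> * norm v"
proof -
  have *: "norm (u + v) \<ge> sin \<theta> * norm u" if "\<bar>u \<bullet> v\<bar> \<le> cos \<theta> * (norm u * norm v)" for u v :: 'a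
  proof (rule power2_le_imp_le)
    have "(sin \<theta> * norm u)\<^sup>2 = (norm u)\<^sup>2 - (cos \<theta> * norm u)\<^sup>2"
      by (simp add: power_mult_distrib sin_squared_eq algebra_simps)
    also have "\<dots> \<le> (norm u)\<^sup>2 - (cos \<theta> * norm u)\<^sup>2 + (norm v - cos \<theta> * norm u)\<^sup>2" by simp
    also have "\<dots> = (norm u)\<^sup>2 - 2 * (cos \<theta> * (norm u * norm v)) + (norm v)\<^sup>2"
      by (simp add: power2_eq_square algebra_simps)
    also have "\<dots> \<le> (norm u)\<^sup>2 + 2 * (u \<bullet> v) + (norm v)\<^sup>2" using that by linarith
    also have "\<dots> = (norm (u + v))\<^sup>2" by (simp add: power2_norm_eq_inner inner_simps inner_commute)
    finally show "(sin \<theta> * norm u)\<^sup>2 \<le> (norm (u + v))\<^sup>2" .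
  qed simp
  show "norm (u + v) \<ge> sin \<theta> * norm u" using *[of u v] assms(1) .
  show "norm (u + v) \<ge> sin \<theta> * norm v" using *[of v u] assms(1) by (simp add: inner_commute mult.commute add.commute)
qed

lemma continuous_on_vector2:
  fixes f g :: "'a::topological_space \<Rightarrow> real"
  assumes "continuous_on S f" "continuous_on S g"
  shows "continuous_on S (\<lambda>x. vector [f x, g x] :: real^2)"
proof -
  have "(\<lambda>x. vector [f x, g x] :: real^2) = (\<lambda>x. f x *\<^sub>R axis 1 1 + g x *\<^sub>R axis 2 1)"
    by (auto simp: vec_eq_iff forall_2 axis_def)
  moreover have "continuous_on S (\<lambda>x. f x *\<^sub>R (axis 1 1 :: real^2) + g x *\<^sub>R axis 2 1)"
    by (intro continuous_intros assms)
  ultimately show ?thesis by metis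
qed

text \<open>\<open>m\<close> stands for the minimum of \<open>norm (h x)\<close>. Hypothesis
  \<open>ray\<close> makes the central projection from 0 injective on the surface; its case t = 0
  keeps 0 off the surface.\<close>

locale zorich_surface =
  fixes h :: "real^2 \<Rightarrow> real^3" and L \<theta> \<epsilon> lam m :: real
  assumes L_pos: "L > 0" and bilip: "bi_lipschitz_on L sqQ h"
    and sense: "sense_preserving_surf h"
    and upper: "\<forall>x\<in>sqQ. h x $ 3 \<ge> 0"
    and bdry: "\<forall>x\<in>frontier sqQ. h x $ 3 = 0"
    and ray: "\<forall>x\<in>sqQ. \<forall>t::real. t \<ge> 0 \<and> t *\<^sub>R h x \<in> h ` sqQ \<longrightarrow> t = 1"
    and theta: "0 < \<theta>" "\<theta> < pi / 2" "\<epsilon> > 0"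
    and nontang: "\<forall>w\<in>h ` sqQ. \<forall>z\<in>h ` sqQ. w \<noteq> z \<and> dist w z \<le> \<epsilon> \<longrightarrow> line_angle z (w - z) > \<theta>"
    and m_pos: "m > 0" and m_le: "\<And>x. x \<in> sqQ \<Longrightarrow> m \<le> norm (h x)"
    and diag1: "\<forall>t\<in>{-1..1}. h (vector [t, t]) $ 1 = h (vector [t, t]) $ 2"
    and diag2: "\<forall>t\<in>{-1..1}. h (vector [t, - t]) $ 1 = - (h (vector [t, - t]) $ 2)"
    and center: "h (vector [0, 0]) = vector [0, 0, 1]"
    and norm_le_1: "\<And>x. x \<in> sqQ \<Longrightarrow> norm (h x) \<le> 1"
    and lamC: "lam * m * sin \<theta> > L ^ 5" and lam_ge_1: "lam \<ge> 1"
begin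

lemma lip: "a \<in> sqQ \<Longrightarrow> b \<in> sqQ \<Longrightarrow> norm (h a - h b) \<le> L * norm (a - b)"
  using bilip unfolding bi_lipschitz_on_def dist_norm by blast

lemma lip_lower: "a \<in> sqQ \<Longrightarrow> b \<in> sqQ \<Longrightarrow> norm (a - b) / L \<le> norm (h a - h b)"
  using bilip unfolding bi_lipschitz_on_def dist_norm by blast

lemma h_inj: "a \<in> sqQ \<Longrightarrow> b \<in> sqQ \<Longrightarrow> h a = h b \<Longrightarrow> a = b"
  using lip_lower[of a b] L_pos by (simp add: divide_le_0_iff)

lemma h_nonzero: "a \<in> sqQ \<Longrightarrow> h a \<noteq> 0"
  using m_le[of a] m_pos by auto

lemma h_continuous: "continuous_on sqQ h"
  unfolding continuous_on_iff
proof (intro ballI allI impI)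
  fix x e assume x: "x \<in> sqQ" and e: "(0::real) < e"
  have "dist (h y) (h x) < e" if "y \<in> sqQ" "dist y x < e / L" for y
    using lip[OF that(1) x] that(2) L_pos by (simp add: dist_norm field_simps)
  then show "\<exists>d>0. \<forall>y\<in>sqQ. dist y x < d \<longrightarrow> dist (h y) (h x) < e"
    using e L_pos by (intro exI[of _ "e / L"]) auto
qed

lemma ray_inj:
  assumes "a \<in> sqQ" "b \<in> sqQ" "h a = k *\<^sub>R h b" "k \<ge> 0"
  shows "a = b"
proof -
  have "k = 1" using ray assms by (metis imageI)
  then show ?thesis using h_inj assms by simp
qed

lemma center_in: "(0 :: real^2) \<in> sqQ"
  by (simp add: in_sqQ)

lemma h_0: "h 0 = vector [0, 0, 1]"
proof -
  have "(vector [0, 0] :: real^2) = 0" by (simp add: vec_eq_iff forall_2)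
  then show ?thesis using center by simp
qed

text \<open>Opposite corners of the square have distance sqrt 8, while their images lie in the unit
  ball and so have distance at most 2.\<close>

lemma L_square: "L\<^sup>2 \<ge> 2"
proof -
  have in1: "(1 :: real^2) \<in> sqQ" "(- 1 :: real^2) \<in> sqQ" by (auto simp: in_sqQ)
  have "norm ((1 :: real^2) - (- 1)) \<le> L * norm (h 1 - h (- 1))"
    using lip_lower[OF in1] L_pos by (simp add: field_simps)
  also have "\<dots> \<le> L * (1 + 1)"
    using L_pos norm_le_1[OF in1(1)] norm_le_1[OF in1(2)] norm_triangle_ineq4[of "h 1" "h (- 1)"]
    by (intro mult_left_mono) linarith+
  finally have "sqrt 8 \<le> 2 * L" by (simp add: norm_real2)
  then have "(sqrt 8)\<^sup>2 \<le> (2 * L)\<^sup>2" by (intro power_mono) auto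
  then show ?thesis by (simp add: power_mult_distrib)
qed

lemma L_ge_1: "L \<ge> 1"
proof (rule ccontr)
  assume "\<not> L \<ge> 1"
  then have "L\<^sup>2 \<le> 1" using L_pos by (intro power_le_one) auto
  then show False using L_square by simp
qed

lemma sin_pos: "sin \<theta> > 0"
  using theta by (intro sin_gt_zero) auto

lemma m_le_1: "m \<le> 1"
  using m_le[OF center_in] norm_le_1[OF center_in] by linarith

lemma L4: "L ^ 4 \<ge> 4"
proof -
  have "(L\<^sup>2)\<^sup>2 \<ge> 2\<^sup>2" using L_square by (intro power_mono) auto
  then show ?thesis by (simp flip: power_mult)
qed

lemma lam_pos: "lam > 0"
  using lam_ge_1 by simp

text \<open>This makes the climb along the axis work: at distance p < 1 from the axis,
  \<open>lam - L * p\<close> is still at least 3.\<close>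

lemma lam_ge: "lam \<ge> 4 * L"
proof -
  have "L ^ 5 = L ^ 4 * L" by (simp add: power_numeral_reduce)
  also have "\<dots> \<ge> 4 * L" using L4 L_pos by (intro mult_right_mono) auto
  finally have "4 * L \<le> L ^ 5" .
  moreover have "lam * m * sin \<theta> \<le> lam * 1 * 1"
    using lam_pos m_le_1 m_pos sin_pos by (intro mult_mono) auto
  ultimately show ?thesis using lamC by simp
qed

lemma nontang_inner:
  assumes "a \<in> sqQ" "b \<in> sqQ" "norm (h a - h b) \<le> \<epsilon>"
  shows "\<bar>(s *\<^sub>R h b) \<bullet> (t *\<^sub>R (h a - h b))\<bar> \<le> cos \<theta> * (norm (s *\<^sub>R h b) * norm (t *\<^sub>R (h a - h b)))"
proof (cases "h a = h b")
  case False
  have "line_angle (h b) (h a - h b) > \<theta>"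
    using nontang assms False by (auto simp: dist_norm)
  then have "\<bar>h b \<bullet> (h a - h b)\<bar> \<le> cos \<theta> * (norm (h b) * norm (h a - h b))"
    using theta h_nonzero[OF assms(2)] False by (intro line_angle_gt_imp_inner_lt) auto
  from mult_left_mono[OF this, of "\<bar>s * t\<bar>"] show ?thesis
    by (simp add: abs_mult mult_ac)
qed simp

text \<open>Split h a - k h b into the radial vector (1 - k) h b and the chord h a - h b. By the
  non-tangential property their lines meet at an angle of more than \<open>\<theta>\<close>, so
  neither can cancel much of the other.\<close>

lemma cone_lower_local:
  assumes "a \<in> sqQ" "b \<in> sqQ" "norm (h a - h b) \<le> \<epsilon>"
  shows "norm (h a - k *\<^sub>R h b) \<ge> sin \<theta> * (m * \<bar>1 - k\<bar>)"
    and "norm (h a - k *\<^sub>R h b) \<ge> sin \<theta> * (norm (a - b) / L)"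
proof -
  have eq: "h a - k *\<^sub>R h b = (1 - k) *\<^sub>R h b + 1 *\<^sub>R (h a - h b)"
    by (simp add: algebra_simps)
  note ge = norm_add_ge_sin[OF nontang_inner[OF assms, of "1 - k" 1] theta(1,2), folded eq]
  have "sin \<theta> * (m * \<bar>1 - k\<bar>) \<le> sin \<theta> * norm ((1 - k) *\<^sub>R h b)"
    using sin_pos mult_right_mono[OF m_le[OF assms(2)], of "\<bar>1 - k\<bar>"]
    by (intro mult_left_mono) (auto simp: mult.commute)
  with ge(1) show "norm (h a - k *\<^sub>R h b) \<ge> sin \<theta> * (m * \<bar>1 - k\<bar>)" by linarith
  have "sin \<theta> * (norm (a - b) / L) \<le> sin \<theta> * norm (1 *\<^sub>R (h a - h b))"
    using sin_pos lip_lower[OF assms(1,2)] by (intro mult_left_mono) auto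
  with ge(2) show "norm (h a - k *\<^sub>R h b) \<ge> sin \<theta> * (norm (a - b) / L)" by linarith
qed

lemma norm_diff_sqQ: "a \<in> sqQ \<Longrightarrow> b \<in> sqQ \<Longrightarrow> norm (a - b) \<le> 4"
  using norm_le_abs_sum_real2[of "a - b"] by (auto simp: in_sqQ abs_le_iff)

text \<open>This is a quantitative form of \<open>ray_inj\<close>. For short chords it is the
  non-tangential bound; for long chords and bounded k it follows from compactness and injectivity;
  for large k the two vectors have different lengths.\<close>

lemma cone_lower:
  obtains c where "c > 0" "\<And>a b k. a \<in> sqQ \<Longrightarrow> b \<in> sqQ \<Longrightarrow> k \<ge> 0 \<Longrightarrow>
     norm (h a - k *\<^sub>R h b) \<ge> c * (\<bar>1 - k\<bar> + norm (a - b))"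
proof -
  \<comment> \<open>Beyond this value k * m exceeds 2, so the length of k h b dominates
    \<open>norm (h a) \<le> 1\<close>.\<close>
  define K where "K = 2 / m"
  define D where "D = {z \<in> sqQ \<times> (sqQ \<times> {0..K}). \<epsilon> \<le> norm (h (fst z) - h (fst (snd z)))}"
  define g where "g z = norm (h (fst z) - snd (snd z) *\<^sub>R h (fst (snd z)))" for z :: "(real^2) \<times> (real^2) \<times> real"
  have hc: "continuous_on (sqQ \<times> (sqQ \<times> {0..K})) (\<lambda>z. h (fst z))"
    "continuous_on (sqQ \<times> (sqQ \<times> {0..K})) (\<lambda>z. h (fst (snd z)))"
    by (rule continuous_on_compose2[OF h_continuous]; auto intro!: continuous_intros)+
  have comp: "compact (sqQ \<times> (sqQ \<times> {0..K}))"
    by (intro compact_Times compact_sqQ compact_Icc)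
  have "compact D"
  proof -
    let ?f = "\<lambda>z. norm (h (fst z) - h (fst (snd z)))"
    have "closedin (top_of_set (sqQ \<times> (sqQ \<times> {0..K}))) ((sqQ \<times> (sqQ \<times> {0..K})) \<inter> ?f -` {\<epsilon>..})"
      by (intro continuous_closedin_preimage continuous_intros hc closed_atLeast)
    moreover have "D = (sqQ \<times> (sqQ \<times> {0..K})) \<inter> ?f -` {\<epsilon>..}" by (auto simp: D_def)
    ultimately show ?thesis using closedin_compact[OF comp] by simp
  qed
  have gc: "continuous_on D g"
    unfolding g_def D_def by (intro continuous_intros continuous_on_subset[OF hc(1)] continuous_on_subset[OF hc(2)]) auto
  obtain c0 where c0: "c0 > 0" "\<And>z. z \<in> D \<Longrightarrow> g z \<ge> c0"
  proof (cases "D = {}")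
    case True then show ?thesis using that[of 1] by auto
  next
    case False
    then obtain z where z: "z \<in> D" "\<And>y. y \<in> D \<Longrightarrow> g z \<le> g y"
      using continuous_attains_inf[OF \<open>compact D\<close> False gc] by blast
    have "g z \<noteq> 0"
    proof
      assume "g z = 0"
      then have "h (fst z) = snd (snd z) *\<^sub>R h (fst (snd z))" by (simp add: g_def)
      then have "fst z = fst (snd z)" using ray_inj z(1) by (auto simp: D_def)
      then show False using z(1) theta(3) by (auto simp: D_def)
    qed
    then have "g z > 0" by (simp add: g_def)
    then show ?thesis using that z(2) by blast
  qed
  \<comment> \<open>One entry for each case. The 2 averages the two local bounds, K + 5 bounds
    \<open>\<bar>1 - k\<bar> + 4\<close> for k up to K, and 12 is small enough for k > 2.\<close>
  define c where "c = min (sin \<theta> * min m (1 / L) / 2) (min (c0 / (K + 5)) (m / 12))"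
  have K: "K \<ge> 2" using m_pos m_le_1 by (simp add: K_def le_divide_eq)
  have cs: "c \<le> sin \<theta> * min m (1 / L) / 2" "c \<le> c0 / (K + 5)" "c \<le> m / 12"
    unfolding c_def
    by (rule min.cobounded1, rule min.coboundedI2[OF min.cobounded1], rule min.coboundedI2[OF min.cobounded2])
  have c: "c > 0" using c0 K m_pos sin_pos L_pos by (simp add: c_def)
  show ?thesis
  proof (rule that[OF c])
    fix a b k assume ab: "a \<in> sqQ" "b \<in> sqQ" and k: "k \<ge> (0::real)"
    have nab: "norm (a - b) \<le> 4" using ab by (rule norm_diff_sqQ)
    let ?S = "\<bar>1 - k\<bar> + norm (a - b)"
    consider "norm (h a - h b) \<le> \<epsilon>" | "\<epsilon> \<le> norm (h a - h b)" "k \<le> K" | "k > K" by linarith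
    then show "norm (h a - k *\<^sub>R h b) \<ge> c * ?S"
    proof cases
      case 1
      have "c * ?S \<le> (sin \<theta> * min m (1 / L) / 2) * ?S"
        by (intro mult_right_mono cs) auto
      also have "\<dots> = (sin \<theta> * (min m (1 / L) * \<bar>1 - k\<bar>) + sin \<theta> * (min m (1 / L) * norm (a - b))) / 2"
        by (simp add: algebra_simps)
      also have "\<dots> \<le> (sin \<theta> * (m * \<bar>1 - k\<bar>) + sin \<theta> * ((1 / L) * norm (a - b))) / 2"
        using sin_pos by (intro divide_right_mono add_mono mult_left_mono mult_right_mono) auto
      also have "\<dots> \<le> norm (h a - k *\<^sub>R h b)"
        using cone_lower_local[OF ab 1, of k] by simp
      finally show ?thesis .
    next
      case 2
      then have "(a, b, k) \<in> D" using ab k by (auto simp: D_def)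
      then have "c0 \<le> norm (h a - k *\<^sub>R h b)" using c0(2)[of "(a, b, k)"] by (simp add: g_def)
      moreover have "c * ?S \<le> (c0 / (K + 5)) * (K + 5)"
        using 2 k K nab c0 by (intro mult_mono cs) auto
      ultimately show ?thesis using K by simp
    next
      case 3
      have km: "k * m > 2" using 3 m_pos by (simp add: K_def field_simps)
      have "k > 2" using 3 K by linarith
      have "c * ?S \<le> (m / 12) * (k + 4)"
        using nab m_pos \<open>k > 2\<close> by (intro mult_mono cs) auto
      also have "\<dots> \<le> k * m / 2" using \<open>k > 2\<close> m_pos by (simp add: field_simps)
      also have "\<dots> \<le> k * m - 1" using km by simp
      also have "\<dots> \<le> norm (k *\<^sub>R h b) - norm (h a)"
        using k m_le[OF ab(2)] norm_le_1[OF ab(1)] by (simp add: mult_left_mono diff_mono)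
      also have "\<dots> \<le> norm (h a - k *\<^sub>R h b)"
        by (metis norm_minus_commute norm_triangle_ineq2)
      finally show ?thesis .
    qed
  qed
qed

text \<open>If the surface touched the plane x3 = 0 at an interior point, central projection near
  that point would be an injective continuous planar map. By invariance of domain its image would be
  open and contain points of negative height.\<close>

lemma interior_pos:
  assumes x0: "x0 \<in> box (- 1) 1"
  shows "h x0 $ 3 > 0"
proof (rule ccontr)
  assume "\<not> ?thesis"
  then have z: "h x0 $ 3 = 0" using upper x0 box_subset_sqQ by force
  define v where "v = h x0"
  have v: "(v $ 1)\<^sup>2 + (v $ 2)\<^sup>2 > 0"
  proof -
    have "norm v > 0" using h_nonzero x0 box_subset_sqQ by (auto simp: v_def)
    then show ?thesis using z by (simp add: norm_real3 v_def)
  qed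
  \<comment> \<open>\<open>A\<close> and \<open>B\<close> are, up to the factor
    \<open>norm v\<close>, the horizontal components along v and along v turned by a right angle.
    Where \<open>A\<close> is positive, the quotients B / A and x3 / A determine a point up to
    positive scaling.\<close>
  define A where "A p = v $ 1 * p $ 1 + v $ 2 * p $ 2" for p :: "real^3"
  define B where "B p = v $ 1 * p $ 2 - v $ 2 * p $ 1" for p :: "real^3"
  define \<phi> where "\<phi> p = (vector [B p / A p, p $ 3 / A p] :: real^2)" for p
  define U where "U = {x \<in> box (- 1) 1. 0 < A (h x)}"
  have hc: "continuous_on (box (- 1) 1) h"
    using h_continuous box_subset_sqQ continuous_on_subset by blast
  have Ac: "continuous_on (box (- 1) 1) (\<lambda>x. A (h x))" "continuous_on (box (- 1) 1) (\<lambda>x. B (h x))"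
    unfolding A_def B_def by (intro continuous_intros hc)+
  have U: "open U"
    unfolding U_def using continuous_open_preimage[OF Ac(1) open_box, of "{0<..}"]
    by (simp add: Int_def vimage_def)
  have "continuous_on U (\<lambda>x. \<phi> (h x))"
  proof -
    have sub: "U \<subseteq> box (- 1) 1" by (auto simp: U_def)
    have "continuous_on U (\<lambda>x. B (h x) / A (h x))" "continuous_on U (\<lambda>x. h x $ 3 / A (h x))"
      by (intro continuous_intros continuous_on_subset[OF Ac(1) sub] continuous_on_subset[OF Ac(2) sub]
          continuous_on_subset[OF hc sub]; auto simp: U_def)+
    then show ?thesis unfolding \<phi>_def by (rule continuous_on_vector2)
  qed
  moreover have "inj_on (\<lambda>x. \<phi> (h x)) U"
  proof (rule inj_onI)
    fix a b assume ab: "a \<in> U" "b \<in> U" "\<phi> (h a) = \<phi> (h b)"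
    define k where "k = A (h a) / A (h b)"
    have k: "k > 0" "A (h a) = k * A (h b)" using ab by (auto simp: k_def U_def)
    have "B (h a) / A (h a) = B (h b) / A (h b)" "h a $ 3 / A (h a) = h b $ 3 / A (h b)"
      using ab(3) by (auto simp: \<phi>_def vec_eq_iff forall_2)
    then have Bk: "B (h a) = k * B (h b)" "h a $ 3 = k * h b $ 3"
      using ab by (auto simp: k_def U_def field_simps)
    have s: "((v $ 1)\<^sup>2 + (v $ 2)\<^sup>2) * p $ 1 = v $ 1 * A p - v $ 2 * B p"
      "((v $ 1)\<^sup>2 + (v $ 2)\<^sup>2) * p $ 2 = v $ 2 * A p + v $ 1 * B p" for p
      by (simp_all add: A_def B_def power2_eq_square algebra_simps)
    have "((v $ 1)\<^sup>2 + (v $ 2)\<^sup>2) * h a $ 1 = ((v $ 1)\<^sup>2 + (v $ 2)\<^sup>2) * (k * h b $ 1)"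
      unfolding mult.left_commute[of _ k] s k(2) Bk by (simp add: algebra_simps)
    moreover have "((v $ 1)\<^sup>2 + (v $ 2)\<^sup>2) * h a $ 2 = ((v $ 1)\<^sup>2 + (v $ 2)\<^sup>2) * (k * h b $ 2)"
      unfolding mult.left_commute[of _ k] s k(2) Bk by (simp add: algebra_simps)
    ultimately have "h a = k *\<^sub>R h b" using v Bk by (auto simp: vec_eq_iff forall_3)
    moreover have "a \<in> sqQ" "b \<in> sqQ" using ab box_subset_sqQ by (auto simp: U_def)
    ultimately show "a = b" using ray_inj k(1) by (meson less_imp_le)
  qed
  ultimately have op: "open ((\<lambda>x. \<phi> (h x)) ` U)"
    using U invariance_of_domain by blast
  have "x0 \<in> U" using x0 v by (simp add: U_def A_def v_def power2_eq_square)
  then have "\<phi> (h x0) \<in> (\<lambda>x. \<phi> (h x)) ` U" by blast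
  moreover have "\<phi> (h x0) = 0" using z by (simp add: \<phi>_def B_def v_def vec_eq_iff forall_2)
  ultimately obtain e where e: "e > 0" "ball 0 e \<subseteq> (\<lambda>x. \<phi> (h x)) ` U"
    using op by (metis openE)
  have "vector [0, - (e / 2)] \<in> ball (0 :: real^2) e" using e by (simp add: norm_real2)
  then obtain x where x: "x \<in> U" "\<phi> (h x) = vector [0, - (e / 2)]" using e(2) by force
  then have "h x $ 3 / A (h x) = - (e / 2)" by (simp add: \<phi>_def vec_eq_iff forall_2)
  then have "h x $ 3 / A (h x) < 0" using e by simp
  moreover have "h x $ 3 \<ge> 0" "A (h x) > 0" using x upper box_subset_sqQ by (auto simp: U_def)
  ultimately show False by (simp add: divide_less_0_iff)
qed

lemma third_zero_iff: "x \<in> sqQ \<Longrightarrow> h x $ 3 = 0 \<longleftrightarrow> \<bar>x $ 1\<bar> = 1 \<or> \<bar>x $ 2\<bar> = 1"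
  using interior_pos[of x] bdry by (force simp: frontier_sqQ in_sqQ in_box2)

text \<open>Central projection of the open surface to the plane x3 = 1 has an image that is open by
  invariance of domain, closed by compactness of \<open>sqQ\<close>, and nonempty. Connectedness of
  the plane makes it everything.\<close>

lemma surj_upper:
  assumes w: "w $ 3 > 0"
  shows "\<exists>a\<in>sqQ. \<exists>k>0. w = k *\<^sub>R h a"
proof -
  define \<phi> where "\<phi> p = (vector [p $ 1 / p $ 3, p $ 2 / p $ 3] :: real^2)" for p :: "real^3"
  let ?O = "box (- 1) (1 :: real^2)"
  define G where "G = (\<lambda>x. \<phi> (h x)) ` ?O"
  have hc: "continuous_on ?O h"
    using h_continuous box_subset_sqQ continuous_on_subset by blast
  have "continuous_on ?O (\<lambda>x. \<phi> (h x))"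
  proof -
    have "h x $ 3 \<noteq> 0" if "x \<in> ?O" for x using interior_pos[OF that] by simp
    then have "continuous_on ?O (\<lambda>x. h x $ 1 / h x $ 3)" "continuous_on ?O (\<lambda>x. h x $ 2 / h x $ 3)"
      by (intro continuous_intros hc; auto)+
    then show ?thesis unfolding \<phi>_def by (rule continuous_on_vector2)
  qed
  moreover have "inj_on (\<lambda>x. \<phi> (h x)) ?O"
  proof (rule inj_onI)
    fix a b assume ab: "a \<in> ?O" "b \<in> ?O" "\<phi> (h a) = \<phi> (h b)"
    define k where "k = h a $ 3 / h b $ 3"
    have pos: "h a $ 3 > 0" "h b $ 3 > 0" using interior_pos ab by auto
    have "h a $ 1 / h a $ 3 = h b $ 1 / h b $ 3" "h a $ 2 / h a $ 3 = h b $ 2 / h b $ 3"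
      using ab(3) by (auto simp: \<phi>_def vec_eq_iff forall_2)
    then have "h a = k *\<^sub>R h b" using pos by (simp add: vec_eq_iff forall_3 k_def field_simps)
    moreover have "k \<ge> 0" using pos by (simp add: k_def)
    ultimately show "a = b" using ray_inj ab box_subset_sqQ by blast
  qed
  ultimately have op: "open G"
    unfolding G_def using invariance_of_domain open_box by blast
  have "closed G"
    unfolding closed_sequential_limits
  proof (intro allI impI, elim conjE)
    fix y l assume y: "\<forall>n. y n \<in> G" "y \<longlonglongrightarrow> l"
    then have "\<forall>n. \<exists>x\<in>?O. y n = \<phi> (h x)" by (auto simp: G_def)
    then obtain x where x: "\<And>n. x n \<in> ?O" "\<And>n. y n = \<phi> (h (x n))" by metis
    then have "\<forall>n. x n \<in> sqQ" using box_subset_sqQ by blast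
    then obtain r x0 where r: "x0 \<in> sqQ" "strict_mono r" "(x \<circ> r) \<longlonglongrightarrow> x0"
      using compact_sqQ unfolding compact_def by meson
    have hl: "(\<lambda>n. h (x (r n))) \<longlonglongrightarrow> h x0"
      using continuous_on_tendsto_compose[OF h_continuous r(3) r(1)] \<open>\<forall>n. x n \<in> sqQ\<close> by (simp add: o_def)
    have yl: "(\<lambda>n. y (r n)) \<longlonglongrightarrow> l"
      using LIMSEQ_subseq_LIMSEQ[OF y(2) r(2)] by (simp add: o_def)
    have eq: "h (x n) $ 1 = y n $ 1 * h (x n) $ 3" "h (x n) $ 2 = y n $ 2 * h (x n) $ 3" for n
      using interior_pos[OF x(1)[of n]] by (auto simp: x(2) \<phi>_def)
    have lim: "(\<lambda>n. h (x (r n)) $ i) \<longlonglongrightarrow> h x0 $ i" for i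
      using tendsto_vec_nth[OF hl] .
    have "(\<lambda>n. y (r n) $ 1 * h (x (r n)) $ 3) \<longlonglongrightarrow> l $ 1 * h x0 $ 3"
      "(\<lambda>n. y (r n) $ 2 * h (x (r n)) $ 3) \<longlonglongrightarrow> l $ 2 * h x0 $ 3"
      by (intro tendsto_mult lim tendsto_vec_nth yl)+
    then have e1: "h x0 $ 1 = l $ 1 * h x0 $ 3" "h x0 $ 2 = l $ 2 * h x0 $ 3"
      using lim[of 1] lim[of 2] LIMSEQ_unique by (auto simp flip: eq)
    \<comment> \<open>A limit on the boundary would have height 0; with bounded quotients all its
      coordinates would vanish, but the surface misses 0.\<close>
    have "h x0 $ 3 \<noteq> 0"
    proof
      assume "h x0 $ 3 = 0"
      with e1 have "h x0 = 0" by (simp add: vec_eq_iff forall_3)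
      then show False using h_nonzero[OF r(1)] by blast
    qed
    then have "x0 \<in> ?O" using bdry r(1) by (auto simp: frontier_sqQ)
    moreover have "l = \<phi> (h x0)"
      using e1 \<open>h x0 $ 3 \<noteq> 0\<close> by (simp add: \<phi>_def vec_eq_iff forall_2)
    ultimately show "l \<in> G" by (auto simp: G_def)
  qed
  moreover have "G \<noteq> {}"
  proof -
    have "(0 :: real^2) \<in> ?O" by (simp add: in_box2)
    then show ?thesis unfolding G_def by blast
  qed
  ultimately have "G = UNIV" using op clopen by blast
  then have "\<phi> w \<in> G" by simp
  then obtain a where a: "a \<in> ?O" "\<phi> w = \<phi> (h a)" by (auto simp: G_def)
  have pos: "h a $ 3 > 0" using interior_pos a by auto
  have "w $ 1 / w $ 3 = h a $ 1 / h a $ 3" "w $ 2 / w $ 3 = h a $ 2 / h a $ 3"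
    using a(2) by (auto simp: \<phi>_def vec_eq_iff forall_2)
  then have "w = (w $ 3 / h a $ 3) *\<^sub>R h a"
    using pos w by (simp add: vec_eq_iff forall_3 field_simps)
  then show ?thesis using a(1) box_subset_sqQ pos w by (meson divide_pos_pos subsetD)
qed

text \<open>Points with x3 = 0 are limits of slightly raised points, and the directions of surface
  points form a compact set.\<close>

lemma surj_closed_upper:
  assumes w: "w $ 3 \<ge> 0" "w \<noteq> 0"
  shows "\<exists>a\<in>sqQ. \<exists>k>0. w = k *\<^sub>R h a"
proof -
  define S where "S = (\<lambda>a. h a /\<^sub>R norm (h a)) ` sqQ"
  have "compact S"
    unfolding S_def using h_nonzero
    by (intro compact_continuous_image compact_sqQ continuous_intros h_continuous) auto
  then have "closed S" by (rule compact_imp_closed)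
  define v where "v n = w + (1 / real (Suc n)) *\<^sub>R axis 3 1" for n
  have v: "v \<longlonglongrightarrow> w + 0 *\<^sub>R axis 3 1"
    unfolding v_def by (intro tendsto_intros LIMSEQ_Suc lim_1_over_n)
  then have vw: "v \<longlonglongrightarrow> w" by simp
  have lim: "(\<lambda>n. v n /\<^sub>R norm (v n)) \<longlonglongrightarrow> w /\<^sub>R norm w"
    by (intro tendsto_intros vw) (use w(2) in simp)
  have inS: "v n /\<^sub>R norm (v n) \<in> S" for n
  proof -
    have "v n $ 3 > 0" using w(1) by (simp add: v_def axis_def add_nonneg_pos)
    then obtain a k where "a \<in> sqQ" "k > 0" "v n = k *\<^sub>R h a" using surj_upper by blast
    then have "v n /\<^sub>R norm (v n) = h a /\<^sub>R norm (h a)" by simp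
    then show ?thesis using \<open>a \<in> sqQ\<close> by (auto simp: S_def)
  qed
  have "w /\<^sub>R norm w \<in> S"
    by (rule closed_sequentially[OF \<open>closed S\<close> _ lim]) (rule inS)
  then obtain a where a: "a \<in> sqQ" "w /\<^sub>R norm w = h a /\<^sub>R norm (h a)" by (auto simp: S_def)
  have "w = norm w *\<^sub>R (w /\<^sub>R norm w)" using w by simp
  also have "\<dots> = (norm w / norm (h a)) *\<^sub>R h a" unfolding a(2) by (simp add: divide_inverse)
  finally show ?thesis using a(1) w h_nonzero[OF a(1)] by (intro bexI[of _ a] exI[of _ "norm w / norm (h a)"]) auto
qed

end

section \<open>The Zorich map\<close>

definition parity :: "int \<Rightarrow> real" where
  "parity k = (if even k then 1 else -1)"

definition reflect_if_odd :: "int \<Rightarrow> real^3 \<Rightarrow> real^3" where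
  "reflect_if_odd k y = vector [y $ 1, y $ 2, parity k * y $ 3]"

text \<open>Distance from the vertical axis itself, in contrast to \<open>axdist\<close> below,
  which takes all preimages of the axis into account.\<close>

definition pdist :: "real^3 \<Rightarrow> real" where
  "pdist x = norm (vector [x $ 1, x $ 2] :: real^2)"

lemma parity_simps [simp]: "\<bar>parity k\<bar> = 1" "parity k * parity k = 1" "(parity k)\<^sup>2 = 1" "parity k \<noteq> 0"
  by (auto simp: parity_def)

lemma parity_add: "parity (j + k) = parity j * parity k"
  by (simp add: parity_def)

lemma parity_mult_self_left [simp]: "parity k * (parity k * x) = x"
  by (simp flip: mult.assoc)

lemma reflect_if_odd_nth [simp]:
  "reflect_if_odd k y $ 1 = y $ 1" "reflect_if_odd k y $ 2 = y $ 2" "reflect_if_odd k y $ 3 = parity k * y $ 3"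
  by (simp_all add: reflect_if_odd_def)

lemma reflect_if_odd_involution [simp]: "reflect_if_odd k (reflect_if_odd k y) = y"
  by (simp add: vec_eq_iff forall_3)

lemma norm_reflect_if_odd [simp]: "norm (reflect_if_odd k y) = norm y"
  by (simp add: norm_real3 power_mult_distrib)

lemma reflect_if_odd_diff: "reflect_if_odd k x - reflect_if_odd k y = reflect_if_odd k (x - y)"
  by (simp add: vec_eq_iff forall_3 algebra_simps)

lemma pdist_nonneg [simp]: "pdist x \<ge> 0"
  by (simp add: pdist_def)

lemma pdist_le: "\<bar>x $ 1\<bar> \<le> pdist x" "\<bar>x $ 2\<bar> \<le> pdist x"
  using component_le_norm_cart[of "vector [x $ 1, x $ 2] :: real^2" 1]
    component_le_norm_cart[of "vector [x $ 1, x $ 2] :: real^2" 2]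
  by (simp_all add: pdist_def)

lemma pdist_le_norm: "pdist x \<le> norm x"
  by (simp add: pdist_def norm_real2 norm_real3)

lemma norm_le_pdist: "norm x \<le> pdist x + \<bar>x $ 3\<bar>"
proof -
  have "(norm x)\<^sup>2 = (pdist x)\<^sup>2 + (x $ 3)\<^sup>2"
    by (simp add: pdist_def norm_real2 norm_real3)
  also have "\<dots> \<le> (pdist x + \<bar>x $ 3\<bar>)\<^sup>2"
    by (simp add: power2_sum)
  finally show ?thesis by (rule power2_le_imp_le) simp
qed

text \<open>Turns closeness of two radial scales, whose ratio is exp u, into closeness of the
  heights.\<close>

lemma abs_le_two_exp_minus_1:
  fixes u :: real
  assumes "\<bar>1 - exp u\<bar> \<le> 1 / 2"
  shows "\<bar>u\<bar> \<le> 2 * \<bar>1 - exp u\<bar>"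
proof -
  define v where "v = exp u"
  have "1 - v \<le> 1 / 2" using assms abs_ge_self[of "1 - v"] by (simp add: v_def)
  then have v: "1 + u \<le> v" "1 / 2 \<le> v" by (auto simp: v_def)
  have "v * (1 - u) \<le> v * exp (- u)"
    using exp_ge_add_one_self[of "- u"] by (intro mult_left_mono) (auto simp: v_def)
  then have v2: "v - v * u \<le> 1" by (simp add: v_def exp_minus algebra_simps)
  show ?thesis unfolding v_def[symmetric]
  proof (cases "u \<ge> 0")
    case True
    then show "\<bar>u\<bar> \<le> 2 * \<bar>1 - v\<bar>" using v(1) by simp
  next
    case False
    then have "v * u \<le> (1 / 2) * u" using v(2) by (intro mult_right_mono_neg) auto
    then have "- u \<le> 2 * (1 - v)" using v2 by simp
    then show "\<bar>u\<bar> \<le> 2 * \<bar>1 - v\<bar>" using False by simp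
  qed
qed

context zorich_surface
begin

section \<open>Folding, beams and the formula for \<open>f\<close> on a beam\<close>

abbreviation "T \<equiv> fold_pt lam"
abbreviation "f \<equiv> zorich_gen h lam"

definition foot :: "real^3 \<Rightarrow> real^2" where
  "foot x = vector [T (x $ 1) / lam, T (x $ 2) / lam]"

text \<open>Distance from \<open>x\<close> to the nearest of the vertical lines that are mapped into the \<open>x\<^sub>3\<close>-axis.\<close>
definition axdist :: "real^3 \<Rightarrow> real" where
  "axdist x = norm (vector [T (x $ 1), T (x $ 2)] :: real^2)"

text \<open>Beams are closed, so neighbours share a face. This lets a preimage be followed across a
  face in \<open>ball_covering\<close>.\<close>

definition beam :: "int \<Rightarrow> int \<Rightarrow> (real^3) set" where
  "beam k l = {x. \<bar>x $ 1 - 2 * k * lam\<bar> \<le> lam \<and> \<bar>x $ 2 - 2 * l * lam\<bar> \<le> lam}"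

lemma fold_idx_eq:
  assumes "(2 * real_of_int k - 1) * lam \<le> s" "s < (2 * real_of_int k + 1) * lam"
  shows "fold_idx lam s = k"
  unfolding fold_idx_def
proof (rule floor_unique)
  have "2 * real_of_int k - 1 \<le> s / lam" "s / lam < 2 * real_of_int k + 1"
    using assms lam_pos by (simp_all add: le_divide_eq divide_less_eq)
  then show "real_of_int k \<le> (s / lam + 1) / 2" "(s / lam + 1) / 2 < real_of_int k + 1"
    by simp_all
qed

lemma fold_idx_bounds:
  "(2 * real_of_int (fold_idx lam s) - 1) * lam \<le> s" "s < (2 * real_of_int (fold_idx lam s) + 1) * lam"
proof -
  have "real_of_int (fold_idx lam s) \<le> (s / lam + 1) / 2" "(s / lam + 1) / 2 < real_of_int (fold_idx lam s) + 1"
    unfolding fold_idx_def by linarith+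
  then have "2 * real_of_int (fold_idx lam s) - 1 \<le> s / lam" "s / lam < 2 * real_of_int (fold_idx lam s) + 1"
    by simp_all
  then show "(2 * real_of_int (fold_idx lam s) - 1) * lam \<le> s" "s < (2 * real_of_int (fold_idx lam s) + 1) * lam"
    using lam_pos by (simp_all add: le_divide_eq divide_less_eq)
qed

text \<open>\<open>fold_idx\<close> already counts the right end point to the next interval, but the
  two branches of the folding agree there, so the formula holds on the closed interval.\<close>

lemma T_eq:
  assumes "\<bar>s - 2 * real_of_int k * lam\<bar> \<le> lam"
  shows "T s = parity k * (s - 2 * real_of_int k * lam)"
proof (cases "s < (2 * real_of_int k + 1) * lam")
  case True
  have "(2 * real_of_int k - 1) * lam \<le> s" using assms by (simp add: algebra_simps)
  then show ?thesis using fold_idx_eq[OF _ True] by (simp add: fold_pt_def parity_def)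
next
  case False
  then have s: "s = (2 * real_of_int k + 1) * lam" using assms by (simp add: algebra_simps)
  have "fold_idx lam s = k + 1"
    by (rule fold_idx_eq) (use lam_pos in \<open>auto simp: s\<close>)
  then show ?thesis by (simp add: fold_pt_def parity_def s algebra_simps)
qed

lemma near_even: "\<bar>s - 2 * real_of_int (fold_idx lam s) * lam\<bar> \<le> lam"
  using fold_idx_bounds[of s] by (simp add: algebra_simps abs_le_iff)

lemma T_abs: "\<bar>s - 2 * real_of_int k * lam\<bar> \<le> lam \<Longrightarrow> \<bar>T s\<bar> = \<bar>s - 2 * real_of_int k * lam\<bar>"
  by (simp add: T_eq abs_mult)

lemma T_bound: "\<bar>T s\<bar> \<le> lam"
  using T_abs[OF near_even] near_even by simp

lemma T_id: "\<bar>s\<bar> \<le> lam \<Longrightarrow> T s = s"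
  using T_eq[of s 0] by (simp add: parity_def)

lemma T_le: "\<bar>T s\<bar> \<le> \<bar>s\<bar>"
proof (cases "\<bar>s\<bar> \<le> lam")
  case True
  then show ?thesis by (simp add: T_id)
next
  case False
  then show ?thesis using T_bound[of s] by linarith
qed

lemma T_minus: "T (- s) = - T s"
proof -
  let ?k = "fold_idx lam s"
  have "\<bar>- s - 2 * real_of_int (- ?k) * lam\<bar> \<le> lam" using near_even[of s] by (simp add: abs_le_iff)
  from T_eq[OF this] T_eq[OF near_even[of s]] show ?thesis
    by (simp add: parity_def algebra_simps)
qed

lemma T_lattice: "T (2 * real_of_int k * lam) = 0"
  using T_eq[of "2 * real_of_int k * lam" k] lam_pos by simp

lemma T_zero_nearest: "\<exists>k::int. \<bar>s - 2 * real_of_int k * lam\<bar> = \<bar>T s\<bar>"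
  using T_abs[OF near_even] by metis

text \<open>On one interval \<open>T\<close> is an isometry. For adjacent intervals the two branches
  are mirror images at the common end point. With a whole interval between them the points are at
  least 2 * lam apart, which is the length of the range of \<open>T\<close>.\<close>

lemma T_lipschitz: "\<bar>T s - T t\<bar> \<le> \<bar>s - t\<bar>"
proof -
  have main: "\<bar>T s - T t\<bar> \<le> \<bar>s - t\<bar>" if le: "fold_idx lam s \<le> fold_idx lam t" for s t
  proof -
    let ?k = "fold_idx lam s" and ?l = "fold_idx lam t"
    consider "?l = ?k" | "?l = ?k + 1" | "?l \<ge> ?k + 2" using le by linarith
    then show ?thesis
    proof cases
      case 1
      have "T s - T t = parity ?k * (s - t)"
        using T_eq[OF near_even[of s]] T_eq[OF near_even[of t]] 1 by (simp add: algebra_simps)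
      then show ?thesis by (simp add: abs_mult)
    next
      case 2
      have eq: "parity ?l = - parity ?k" using 2 by (simp add: parity_def)
      have "T s = parity ?k * (s - 2 * real_of_int ?k * lam)"
        "T t = - parity ?k * (t - 2 * (real_of_int ?k + 1) * lam)"
        using T_eq[OF near_even[of s]] T_eq[OF near_even[of t]] 2 eq by simp_all
      then have "T s - T t = parity ?k * (s + t - 2 * (2 * real_of_int ?k + 1) * lam)"
        by (simp add: algebra_simps)
      then have "\<bar>T s - T t\<bar> = \<bar>s + t - 2 * (2 * real_of_int ?k + 1) * lam\<bar>"
        by (simp only: abs_mult) simp
      also have "s + t - 2 * (2 * real_of_int ?k + 1) * lam =
          (s - (2 * real_of_int ?k + 1) * lam) + (t - (2 * real_of_int ?k + 1) * lam)"
        by (simp add: algebra_simps)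
      finally have "\<bar>T s - T t\<bar> = \<bar>(s - (2 * real_of_int ?k + 1) * lam) + (t - (2 * real_of_int ?k + 1) * lam)\<bar>" .
      moreover have "s \<le> (2 * real_of_int ?k + 1) * lam" using fold_idx_bounds(2)[of s] by simp
      moreover have "(2 * real_of_int ?k + 1) * lam \<le> t"
        using fold_idx_bounds(1)[of t] 2 by (simp add: algebra_simps)
      ultimately show ?thesis by linarith
    next
      case 3
      have "(2 * real_of_int ?k + 3) * lam \<le> (2 * real_of_int ?l - 1) * lam"
        using 3 lam_pos by (intro mult_right_mono) auto
      then have "s + 2 * lam \<le> t"
        using fold_idx_bounds(2)[of s] fold_idx_bounds(1)[of t] by (simp add: algebra_simps)
      then show ?thesis using T_bound[of s] T_bound[of t] by linarith
    qed
  qed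
  show ?thesis
    using main[of s t] main[of t s] by (cases "fold_idx lam s \<le> fold_idx lam t") (auto simp: abs_minus_commute)
qed

lemma T_continuous: "continuous_on S T"
proof (rule continuous_on_subset[OF _ subset_UNIV])
  show "continuous_on UNIV T"
    unfolding continuous_on_iff dist_real_def using T_lipschitz by (meson le_less_trans)
qed

lemma foot_in: "foot x \<in> sqQ"
  using T_bound[of "x $ 1"] T_bound[of "x $ 2"] lam_pos by (simp add: in_sqQ foot_def)

lemma axdist_eq: "axdist x = lam * norm (foot x)"
proof -
  have "(vector [T (x $ 1), T (x $ 2)] :: real^2) = lam *\<^sub>R foot x"
    using lam_pos by (simp add: vec_eq_iff forall_2 foot_def)
  then show ?thesis using lam_pos by (simp add: axdist_def)
qed

lemma axdist_nonneg [simp]: "axdist x \<ge> 0"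
  by (simp add: axdist_def)

lemma axdist_le_pdist: "axdist x \<le> pdist x"
  unfolding axdist_def pdist_def norm_real2
  using T_le[of "x $ 1"] T_le[of "x $ 2"] by (auto intro!: real_sqrt_le_mono add_mono simp: abs_le_square_iff)

lemma axdist_le: "axdist x \<le> 2 * lam"
  using norm_le_abs_sum_real2[of "vector [T (x $ 1), T (x $ 2)]"] T_bound[of "x $ 1"] T_bound[of "x $ 2"]
  by (simp add: axdist_def)

lemma axdist_eq_0_iff: "axdist x = 0 \<longleftrightarrow> T (x $ 1) = 0 \<and> T (x $ 2) = 0"
  by (auto simp: axdist_def vec_eq_iff forall_2)

text \<open>Folding preserves the distance to the nearest even multiple of \<open>lam\<close>, so
  \<open>axdist\<close> is an attained distance. Any ball of larger radius therefore contains an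
  axial point.\<close>

lemma axdist_nearest: "\<exists>y. axdist y = 0 \<and> dist x y = axdist x"
proof -
  obtain k l :: int where kl: "\<bar>x $ 1 - 2 * real_of_int k * lam\<bar> = \<bar>T (x $ 1)\<bar>"
    "\<bar>x $ 2 - 2 * real_of_int l * lam\<bar> = \<bar>T (x $ 2)\<bar>"
    using T_zero_nearest by metis
  define y :: "real^3" where "y = vector [2 * real_of_int k * lam, 2 * real_of_int l * lam, x $ 3]"
  have "(x $ 1 - y $ 1)\<^sup>2 = (T (x $ 1))\<^sup>2" "(x $ 2 - y $ 2)\<^sup>2 = (T (x $ 2))\<^sup>2"
    using kl unfolding y_def by (simp_all, metis power2_abs, metis power2_abs)
  moreover have "axdist y = 0" by (simp add: axdist_eq_0_iff y_def T_lattice)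
  ultimately show ?thesis
    by (intro exI[of _ y]) (simp add: dist_norm norm_real3 axdist_def norm_real2, simp add: y_def)
qed

lemma in_some_beam: "x \<in> beam (fold_idx lam (x $ 1)) (fold_idx lam (x $ 2))"
  using near_even by (simp add: beam_def)

lemma f_eq_idx:
  "f x = reflect_if_odd (fold_idx lam (x $ 1) + fold_idx lam (x $ 2)) ((exp (x $ 3) * lam) *\<^sub>R h (foot x))"
  by (simp add: zorich_gen_def h_scaled_def foot_def refl3_def Let_def vec_eq_iff forall_3 parity_def)

lemma foot_boundary:
  assumes "\<bar>T (x $ 1)\<bar> = lam \<or> \<bar>T (x $ 2)\<bar> = lam"
  shows "h (foot x) $ 3 = 0"
  using assms lam_pos third_zero_iff[OF foot_in[of x]] by (auto simp: foot_def abs_divide)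

lemma idx_or_boundary:
  assumes "\<bar>s - 2 * real_of_int k * lam\<bar> \<le> lam"
  shows "fold_idx lam s = k \<or> \<bar>T s\<bar> = lam"
proof (cases "s < (2 * real_of_int k + 1) * lam")
  case True
  moreover have "(2 * real_of_int k - 1) * lam \<le> s" using assms by (simp add: algebra_simps)
  ultimately show ?thesis using fold_idx_eq by blast
next
  case False
  then have "s - 2 * real_of_int k * lam = lam" using assms by (simp add: algebra_simps)
  then show ?thesis using T_abs[OF assms] lam_pos by simp
qed

text \<open>On a shared face the beam index is ambiguous, but there the surface has height 0 and the
  reflection does nothing.\<close>

lemma f_beam:
  assumes "x \<in> beam k l"
  shows "f x = reflect_if_odd (k + l) ((exp (x $ 3) * lam) *\<^sub>R h (foot x))"
proof -
  have b: "\<bar>x $ 1 - 2 * real_of_int k * lam\<bar> \<le> lam" "\<bar>x $ 2 - 2 * real_of_int l * lam\<bar> \<le> lam"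
    using assms by (auto simp: beam_def)
  show ?thesis
  proof (cases "h (foot x) $ 3 = 0")
    case True
    then show ?thesis by (simp add: f_eq_idx vec_eq_iff forall_3)
  next
    case False
    then have "fold_idx lam (x $ 1) = k" "fold_idx lam (x $ 2) = l"
      using foot_boundary idx_or_boundary[OF b(1)] idx_or_boundary[OF b(2)] by blast+
    then show ?thesis by (simp add: f_eq_idx)
  qed
qed

lemma norm_f: "norm (f x) = exp (x $ 3) * lam * norm (h (foot x))"
  using lam_pos by (simp add: f_eq_idx)

lemma norm_f_le: "norm (f x) \<le> exp (x $ 3) * lam"
  using norm_f[of x] norm_le_1[OF foot_in[of x]] lam_pos by (simp add: mult_left_le)

lemma norm_f_ge: "norm (f x) \<ge> exp (x $ 3) * lam * m"
  using norm_f[of x] m_le[OF foot_in[of x]] lam_pos by simp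

lemma f_sign: "x \<in> beam k l \<Longrightarrow> parity (k + l) * f x $ 3 \<ge> 0"
  using upper foot_in[of x] lam_pos by (simp add: f_beam)

text \<open>The centre of the square is mapped onto the axis, so the Lipschitz distance to
  \<open>h 0\<close> bounds the horizontal part.\<close>

lemma pdist_f: "pdist (f x) \<le> L * exp (x $ 3) * axdist x"
proof -
  have "pdist (f x) = exp (x $ 3) * lam * pdist (h (foot x))"
    using lam_pos by (simp add: pdist_def f_eq_idx norm_real2 power_mult_distrib real_sqrt_mult flip: distrib_left)
  also have "pdist (h (foot x)) = pdist (h (foot x) - h 0)"
    by (simp add: pdist_def h_0)
  also have "\<dots> \<le> norm (h (foot x) - h 0)" by (rule pdist_le_norm)
  also have "\<dots> \<le> L * norm (foot x - 0)" by (rule lip[OF foot_in center_in])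
  finally show ?thesis
    using lam_pos by (simp add: axdist_eq mult_ac)
qed

lemma axdist_f: "axdist (f x) \<le> L * exp (x $ 3) * axdist x"
  using pdist_f axdist_le_pdist order_trans by blast

lemma central_beam: "\<bar>x $ 1\<bar> \<le> lam \<Longrightarrow> \<bar>x $ 2\<bar> \<le> lam \<Longrightarrow> x \<in> beam 0 0"
  by (simp add: beam_def)

text \<open>Near the axis \<open>h (foot x)\<close> differs from the vertical unit vector by at most
  \<open>L * norm (foot x)\<close>.\<close>

lemma f_climb:
  assumes "pdist x \<le> lam"
  shows "f x $ 3 \<ge> exp (x $ 3) * (lam - L * pdist x)"
proof -
  have b: "\<bar>x $ 1\<bar> \<le> lam" "\<bar>x $ 2\<bar> \<le> lam" using assms pdist_le[of x] by linarith+
  have "axdist x = pdist x" using b by (simp add: axdist_def pdist_def T_id)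
  then have eq: "lam * norm (foot x) = pdist x" by (simp add: axdist_eq)
  have "1 - L * norm (foot x) \<le> h (foot x) $ 3"
    using lip[OF foot_in[of x] center_in] component_le_norm_cart[of "h (foot x) - h 0" 3] by (simp add: h_0)
  then have "lam * (1 - L * norm (foot x)) \<le> lam * h (foot x) $ 3" using lam_pos by (intro mult_left_mono) auto
  then have "lam - L * pdist x \<le> lam * h (foot x) $ 3" by (simp add: algebra_simps flip: eq)
  then have "exp (x $ 3) * (lam - L * pdist x) \<le> exp (x $ 3) * (lam * h (foot x) $ 3)"
    by (intro mult_left_mono) auto
  then show ?thesis using f_beam[OF central_beam[OF b]] by (simp add: parity_def mult.assoc)
qed

lemma f_axis:
  assumes "axdist x = 0"
  shows "pdist (f x) = 0" "\<bar>f x $ 3\<bar> = lam * exp (x $ 3)"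
proof -
  have "foot x = 0" using assms by (simp add: axdist_eq_0_iff foot_def vec_eq_iff forall_2)
  then show "pdist (f x) = 0" "\<bar>f x $ 3\<bar> = lam * exp (x $ 3)"
    using lam_pos by (simp_all add: f_eq_idx h_0 pdist_def norm_real2 abs_mult)
qed

lemma f_central_axis:
  assumes "pdist x = 0"
  shows "f x = vector [0, 0, lam * exp (x $ 3)]"
proof -
  have x: "x $ 1 = 0" "x $ 2 = 0" using assms pdist_le[of x] by auto
  then have "foot x = 0" by (simp add: foot_def vec_eq_iff forall_2 T_id lam_pos less_imp_le)
  then have "h (foot x) = vector [0, 0, 1]" by (simp add: h_0)
  then show ?thesis using f_beam[OF central_beam] x lam_pos
    by (simp add: vec_eq_iff forall_3 parity_def)
qed

section \<open>Lower distortion bounds and images of balls\<close>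

lemma foot_diff:
  assumes "x \<in> beam k l" "y \<in> beam k l"
  shows "lam * norm (foot x - foot y) = pdist (x - y)"
proof -
  have "\<bar>x $ 1 - 2 * real_of_int k * lam\<bar> \<le> lam" "\<bar>x $ 2 - 2 * real_of_int l * lam\<bar> \<le> lam"
    "\<bar>y $ 1 - 2 * real_of_int k * lam\<bar> \<le> lam" "\<bar>y $ 2 - 2 * real_of_int l * lam\<bar> \<le> lam"
    using assms by (auto simp: beam_def)
  note * = this[THEN T_eq]
  have "lam *\<^sub>R (foot x - foot y) = (vector [parity k * (x $ 1 - y $ 1), parity l * (x $ 2 - y $ 2)] :: real^2)"
  proof -
    have "T (x $ 1) - T (y $ 1) = parity k * (x $ 1 - y $ 1)" "T (x $ 2) - T (y $ 2) = parity l * (x $ 2 - y $ 2)"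
      by (simp_all add: * algebra_simps)
    then show ?thesis
      using lam_pos by (simp add: foot_def vec_eq_iff forall_2 flip: diff_divide_distrib)
  qed
  then have "norm (lam *\<^sub>R (foot x - foot y)) = pdist (x - y)"
    by (simp add: pdist_def norm_real2 power_mult_distrib)
  then show ?thesis using lam_pos by simp
qed

text \<open>\<open>cone_lower\<close> in logarithmic coordinates: the ratio of the two radial scales
  is exp (y3 - x3), and folding is an isometry on a beam.\<close>

lemma f_diff_lower:
  obtains c where "c > 0" "\<And>k l x y. x \<in> beam k l \<Longrightarrow> y \<in> beam k l \<Longrightarrow>
    norm (f x - f y) \<ge> c * exp (x $ 3) * (\<bar>1 - exp (y $ 3 - x $ 3)\<bar> + pdist (x - y))"
proof -
  obtain c where c: "c > 0" "\<And>a b k. a \<in> sqQ \<Longrightarrow> b \<in> sqQ \<Longrightarrow> k \<ge> 0 \<Longrightarrow>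
     norm (h a - k *\<^sub>R h b) \<ge> c * (\<bar>1 - k\<bar> + norm (a - b))"
    using cone_lower by blast
  show ?thesis
  proof (rule that[OF c(1)])
    fix k l x y assume xy: "x \<in> beam k l" "y \<in> beam k l"
    let ?t = "exp (y $ 3 - x $ 3)"
    have "f x - f y = reflect_if_odd (k + l) ((exp (x $ 3) * lam) *\<^sub>R (h (foot x) - ?t *\<^sub>R h (foot y)))"
      by (simp add: f_beam[OF xy(1)] f_beam[OF xy(2)] reflect_if_odd_diff exp_diff algebra_simps)
    then have "norm (f x - f y) = (exp (x $ 3) * lam) * norm (h (foot x) - ?t *\<^sub>R h (foot y))"
      using lam_pos by simp
    also have "\<dots> \<ge> (exp (x $ 3) * lam) * (c * (\<bar>1 - ?t\<bar> + norm (foot x - foot y)))"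
      using lam_pos by (intro mult_left_mono c(2) foot_in) auto
    also have "(exp (x $ 3) * lam) * (c * (\<bar>1 - ?t\<bar> + norm (foot x - foot y))) =
        c * exp (x $ 3) * (lam * \<bar>1 - ?t\<bar> + pdist (x - y))"
      by (simp add: algebra_simps flip: foot_diff[OF xy])
    also have "c * exp (x $ 3) * (lam * \<bar>1 - ?t\<bar> + pdist (x - y)) \<ge> c * exp (x $ 3) * (1 * \<bar>1 - ?t\<bar> + pdist (x - y))"
      using c(1) lam_ge_1 by (intro mult_left_mono add_right_mono mult_right_mono) auto
    finally show "norm (f x - f y) \<ge> c * exp (x $ 3) * (\<bar>1 - ?t\<bar> + pdist (x - y))" by simp
  qed
qed

lemma beam_surj:
  assumes "w \<noteq> 0" "parity (k + l) * w $ 3 \<ge> 0"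
  shows "\<exists>y\<in>beam k l. f y = w"
proof -
  let ?w = "reflect_if_odd (k + l) w"
  have "?w \<noteq> 0" using assms(1) by (metis norm_eq_zero norm_reflect_if_odd)
  then obtain a t where a: "a \<in> sqQ" "t > 0" "?w = t *\<^sub>R h a"
    using surj_closed_upper[of ?w] assms(2) by auto
  define y :: "real^3" where
    "y = vector [2 * real_of_int k * lam + parity k * (lam * a $ 1), 2 * real_of_int l * lam + parity l * (lam * a $ 2), ln (t / lam)]"
  have b: "\<bar>y $ 1 - 2 * real_of_int k * lam\<bar> \<le> lam" "\<bar>y $ 2 - 2 * real_of_int l * lam\<bar> \<le> lam"
    using a(1) lam_pos by (auto simp: y_def in_sqQ abs_mult mult_left_le)
  then have yb: "y \<in> beam k l" by (simp add: beam_def)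
  have "foot y = a"
    using T_eq[OF b(1)] T_eq[OF b(2)] lam_pos by (simp add: foot_def vec_eq_iff forall_2, simp add: y_def)
  moreover have "exp (y $ 3) * lam = t" using a(2) lam_pos by (simp add: y_def)
  ultimately have "f y = reflect_if_odd (k + l) ?w" using f_beam[OF yb] a(3) by simp
  then show ?thesis using yb by auto
qed

text \<open>Control of the inverse branch of \<open>f\<close> on one beam. The comparison of the
  exponentials is recorded so that a second lift can start at the point just found.\<close>

lemma beam_lift:
  obtains c where "c > 0" "\<And>k l x w r. x \<in> beam k l \<Longrightarrow> w \<noteq> 0 \<Longrightarrow> parity (k + l) * w $ 3 \<ge> 0 \<Longrightarrow>
      0 < r \<Longrightarrow> r \<le> 2 * lam \<Longrightarrow> norm (w - f x) \<le> c * exp (x $ 3) * r \<Longrightarrow>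
      \<exists>y\<in>beam k l. f y = w \<and> norm (y - x) \<le> r / 4 \<and> exp (x $ 3) \<le> 2 * exp (y $ 3)"
proof -
  obtain c0 where c0: "c0 > 0" "\<And>k l x y. x \<in> beam k l \<Longrightarrow> y \<in> beam k l \<Longrightarrow>
    norm (f x - f y) \<ge> c0 * exp (x $ 3) * (\<bar>1 - exp (y $ 3 - x $ 3)\<bar> + pdist (x - y))"
    using f_diff_lower by blast
  \<comment> \<open>The 12 serves two ends: with r at most 2 * lam it keeps the scale ratio within 1
    / 2 of 1, and twice r / 12 stays below r / 4.\<close>
  define c where "c = c0 / (12 * lam)"
  have c: "c > 0" using c0(1) lam_pos by (simp add: c_def)
  show ?thesis
  proof (rule that[OF c])
    fix k l x w r
    assume x: "x \<in> beam k l" and w: "w \<noteq> 0" "parity (k + l) * w $ 3 \<ge> 0"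
      and r: "0 < r" "r \<le> 2 * lam" and near: "norm (w - f x) \<le> c * exp (x $ 3) * r"
    obtain y where y: "y \<in> beam k l" "f y = w" using beam_surj[OF w] by blast
    let ?u = "y $ 3 - x $ 3"
    have "c0 * exp (x $ 3) * (\<bar>1 - exp ?u\<bar> + pdist (x - y)) \<le> norm (f x - f y)"
      by (rule c0(2)[OF x y(1)])
    also have "\<dots> \<le> c * exp (x $ 3) * r" using near y(2) by (simp add: norm_minus_commute)
    also have "\<dots> = c0 * exp (x $ 3) * (r / (12 * lam))" by (simp add: c_def)
    finally have *: "\<bar>1 - exp ?u\<bar> + pdist (x - y) \<le> r / (12 * lam)"
      using c0(1) by (subst (asm) mult_le_cancel_left_pos) auto
    have r12: "r / (12 * lam) \<le> r / 12" using r lam_ge_1 by (intro divide_left_mono) auto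
    have "r / (12 * lam) \<le> 1 / 6" using r lam_pos by (simp add: divide_le_eq)
    then have half: "\<bar>1 - exp ?u\<bar> \<le> 1 / 2" using * pdist_nonneg[of "x - y"] by linarith
    have "\<bar>?u\<bar> \<le> 2 * \<bar>1 - exp ?u\<bar>" by (rule abs_le_two_exp_minus_1[OF half])
    moreover have "norm (y - x) \<le> pdist (x - y) + \<bar>?u\<bar>"
      using norm_le_pdist[of "x - y"] by (simp add: norm_minus_commute abs_minus_commute)
    ultimately have "norm (y - x) \<le> pdist (x - y) + 2 * \<bar>1 - exp ?u\<bar>" by (meson add_left_mono order_trans)
    also have "\<dots> \<le> 2 * (\<bar>1 - exp ?u\<bar> + pdist (x - y))" using pdist_nonneg[of "x - y"] by simp
    also have "\<dots> \<le> 2 * (r / 12)" using * r12 by simp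
    also have "\<dots> \<le> r / 4" using r(1) by simp
    finally have "norm (y - x) \<le> r / 4" .
    moreover have "exp (x $ 3) \<le> 2 * exp (y $ 3)"
    proof -
      have "1 / 2 \<le> exp ?u" using half by linarith
      then show ?thesis by (simp add: exp_diff field_simps)
    qed
    ultimately show "\<exists>y\<in>beam k l. f y = w \<and> norm (y - x) \<le> r / 4 \<and> exp (x $ 3) \<le> 2 * exp (y $ 3)"
      using y by blast
  qed
qed

lemma adjacent_beam:
  assumes x: "x \<in> beam k l" and z: "f x $ 3 = 0"
  shows "\<exists>k' l'. x \<in> beam k' l' \<and> odd (k + l + (k' + l'))"
proof -
  have b: "\<bar>x $ 1 - 2 * real_of_int k * lam\<bar> \<le> lam" "\<bar>x $ 2 - 2 * real_of_int l * lam\<bar> \<le> lam"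
    using x by (auto simp: beam_def)
  have step: "\<exists>k'. \<bar>s - 2 * real_of_int k' * lam\<bar> \<le> lam \<and> odd (k + k')"
    if "\<bar>s - 2 * real_of_int k * lam\<bar> = lam" for s k
  proof (cases "s - 2 * real_of_int k * lam \<ge> 0")
    case True
    then show ?thesis using that lam_pos by (intro exI[of _ "k + 1"]) (auto simp: algebra_simps)
  next
    case False
    then show ?thesis using that lam_pos by (intro exI[of _ "k - 1"]) (auto simp: algebra_simps)
  qed
  have "h (foot x) $ 3 = 0" using z f_beam[OF x] lam_pos by simp
  then have "\<bar>T (x $ 1)\<bar> = lam \<or> \<bar>T (x $ 2)\<bar> = lam"
    using third_zero_iff[OF foot_in[of x]] lam_pos by (auto simp: foot_def abs_divide)
  then show ?thesis
  proof
    assume "\<bar>T (x $ 1)\<bar> = lam"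
    then obtain k' where "\<bar>x $ 1 - 2 * real_of_int k' * lam\<bar> \<le> lam" "odd (k + k')"
      using step[of "x $ 1" k] T_abs[OF b(1)] by auto
    then show ?thesis using b by (intro exI[of _ k'] exI[of _ l]) (auto simp: beam_def)
  next
    assume "\<bar>T (x $ 2)\<bar> = lam"
    then obtain l' where "\<bar>x $ 2 - 2 * real_of_int l' * lam\<bar> \<le> lam" "odd (l + l')"
      using step[of "x $ 2" l] T_abs[OF b(2)] by auto
    then show ?thesis using b by (intro exI[of _ k] exI[of _ l']) (auto simp: beam_def)
  qed
qed

text \<open>A target on the same side of x3 = 0 is lifted within the beam of x. Otherwise the
  segment from \<open>f x\<close> is followed to the plane and its crossing point is lifted to a
  face; the target is then lifted from there in a neighbouring beam of opposite parity.\<close>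

lemma ball_covering:
  obtains c where "c > 0" "\<And>x r. 0 < r \<Longrightarrow> r \<le> 2 * lam \<Longrightarrow> ball (f x) (c * exp (x $ 3) * r) \<subseteq> f ` ball x r"
proof -
  obtain c0 where c0: "c0 > 0" "\<And>k l x w r. x \<in> beam k l \<Longrightarrow> w \<noteq> 0 \<Longrightarrow> parity (k + l) * w $ 3 \<ge> 0 \<Longrightarrow>
      0 < r \<Longrightarrow> r \<le> 2 * lam \<Longrightarrow> norm (w - f x) \<le> c0 * exp (x $ 3) * r \<Longrightarrow>
      \<exists>y\<in>beam k l. f y = w \<and> norm (y - x) \<le> r / 4 \<and> exp (x $ 3) \<le> 2 * exp (y $ 3)"
    using beam_lift by blast
  \<comment> \<open>The first entry allows for the halved exponential at the start of the second
    lift; the second keeps 0, which has no preimage, out of reach.\<close>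
  define c where "c = min (c0 / 2) (m / 4)"
  have c: "c > 0" "c \<le> c0 / 2" "c \<le> m / 4" using c0(1) m_pos by (auto simp: c_def)
  show ?thesis
  proof (rule that[OF c(1)], rule subsetI)
    fix x r w assume r: "0 < r" "r \<le> 2 * lam" and "w \<in> ball (f x) (c * exp (x $ 3) * r)"
    then have near: "norm (w - f x) < c * exp (x $ 3) * r" by (simp add: dist_norm norm_minus_commute)
    have near0: "norm (v - f x) \<le> c0 * exp (x $ 3) * r" if "norm (v - f x) \<le> norm (w - f x)" for v
    proof -
      have "c * exp (x $ 3) * r \<le> c0 * exp (x $ 3) * r"
        using c c0(1) r by (intro mult_right_mono) auto
      then show ?thesis using near that by linarith
    qed
    have nz: "v \<noteq> 0" if "norm (v - f x) \<le> norm (w - f x)" for v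
    proof
      assume "v = 0"
      then have "norm (f x) < c * exp (x $ 3) * r" using that near by simp
      also have "\<dots> \<le> (m / 4) * exp (x $ 3) * (2 * lam)"
        using c r m_pos by (intro mult_mono) auto
      also have "\<dots> = (exp (x $ 3) * lam * m) / 2" by simp
      also have "\<dots> < exp (x $ 3) * lam * m" using lam_pos m_pos by simp
      finally show False using norm_f_ge[of x] by simp
    qed
    define k l where "k = fold_idx lam (x $ 1)" and "l = fold_idx lam (x $ 2)"
    have x: "x \<in> beam k l" unfolding k_def l_def by (rule in_some_beam)
    show "w \<in> f ` ball x r"
    proof (cases "parity (k + l) * w $ 3 \<ge> 0")
      case True
      obtain y where "f y = w" "norm (y - x) \<le> r / 4"
        using c0(2)[OF x nz[OF order_refl] True r near0[OF order_refl]] by blast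
      then show ?thesis using r by (intro image_eqI[of _ _ y]) (auto simp: dist_norm norm_minus_commute)
    next
      case False
      define a where "a = parity (k + l) * f x $ 3"
      define b where "b = - (parity (k + l) * w $ 3)"
      have ab: "a \<ge> 0" "b > 0" using f_sign[OF x] False by (auto simp: a_def b_def)
      \<comment> \<open>Parameter at which the segment from \<open>f x\<close> to \<open>w\<close>
        crosses the plane x3 = 0.\<close>
      define t where "t = a / (a + b)"
      have t: "0 \<le> t" "t \<le> 1" using ab by (auto simp: t_def)
      define v where "v = f x + t *\<^sub>R (w - f x)"
      have "parity (k + l) * v $ 3 = a - t * (a + b)"
        by (simp add: v_def a_def b_def algebra_simps)
      also have "\<dots> = 0" using ab by (simp add: t_def)
      finally have v3: "v $ 3 = 0" by simp
      have "v - f x = t *\<^sub>R (w - f x)" "w - v = (1 - t) *\<^sub>R (w - f x)"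
        by (simp_all add: v_def algebra_simps)
      then have vn: "norm (v - f x) \<le> norm (w - f x)" "norm (w - v) \<le> norm (w - f x)"
        using t by (auto simp: mult_left_le_one_le)
      obtain y where y: "y \<in> beam k l" "f y = v" "norm (y - x) \<le> r / 4" "exp (x $ 3) \<le> 2 * exp (y $ 3)"
        using c0(2)[OF x nz[OF vn(1)] _ r near0[OF vn(1)]] v3 by auto
      obtain k' l' where kl': "y \<in> beam k' l'" "odd (k + l + (k' + l'))"
        using adjacent_beam[OF y(1)] y(2) v3 by auto
      then have "parity (k' + l') = - parity (k + l)" by (auto simp: parity_def)
      then have sw: "parity (k' + l') * w $ 3 \<ge> 0" using ab by (simp add: b_def)
      have "norm (w - f y) \<le> c * exp (x $ 3) * r" using vn(2) near y(2) by simp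
      also have "\<dots> \<le> (c0 / 2) * (2 * exp (y $ 3)) * r"
        using c c0(1) y(4) r by (intro mult_right_mono mult_mono) auto
      finally have "norm (w - f y) \<le> c0 * exp (y $ 3) * r" by simp
      then obtain z where z: "f z = w" "norm (z - y) \<le> r / 4"
        using c0(2)[OF kl'(1) nz[OF order_refl] sw r] by blast
      have "norm (z - x) \<le> r / 4 + r / 4"
        using norm_triangle_ineq[of "z - y" "y - x"] z(2) y(3) by simp
      then show ?thesis using z(1) r by (intro image_eqI[of _ _ z]) (auto simp: dist_norm norm_minus_commute)
    qed
  qed
qed

lemma closed_beam: "closed (beam k l)"
  unfolding beam_def by (intro closed_Collect_conj closed_Collect_le continuous_intros)

lemma f_continuous_beam: "continuous_on (beam k l) f"
proof -
  have T1: "continuous_on S (\<lambda>x::real^3. T (x $ i))" for S i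
    by (rule continuous_on_compose2[OF T_continuous[of UNIV]]) (auto intro!: continuous_intros)
  have "continuous_on UNIV foot"
    unfolding foot_def by (intro continuous_on_vector2 continuous_intros T1) (use lam_pos in auto)
  then have hf: "continuous_on UNIV (\<lambda>x. h (foot x))"
    by (rule continuous_on_compose2[OF h_continuous]) (auto simp: foot_in)
  have rc: "continuous_on UNIV (reflect_if_odd n)" for n
  proof -
    have "reflect_if_odd n = (\<lambda>y. y $ 1 *\<^sub>R axis 1 1 + y $ 2 *\<^sub>R axis 2 1 + (parity n * y $ 3) *\<^sub>R axis 3 1)"
      by (auto simp: vec_eq_iff forall_3 axis_def)
    moreover have "continuous_on UNIV (\<lambda>y::real^3. y $ 1 *\<^sub>R (axis 1 1 :: real^3) + y $ 2 *\<^sub>R axis 2 1 + (parity n * y $ 3) *\<^sub>R axis 3 1)"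
      by (intro continuous_intros)
    ultimately show ?thesis by metis
  qed
  have "continuous_on UNIV (\<lambda>x. reflect_if_odd (k + l) ((exp (x $ 3) * lam) *\<^sub>R h (foot x)))"
    by (rule continuous_on_compose2[OF rc]) (auto intro!: continuous_intros hf)
  then show ?thesis
    using f_beam by (subst continuous_on_cong[OF refl]) (auto intro: continuous_on_subset)
qed

text \<open>The ball of radius \<open>lam\<close> about x is covered by nine closed beams, and
  \<open>f\<close> is continuous on each of them.\<close>

lemma f_continuous: "continuous_on S f"
proof (rule continuous_on_subset[OF _ subset_UNIV], rule continuous_at_imp_continuous_on, rule ballI)
  fix x :: "real^3"
  define k l where "k = fold_idx lam (x $ 1)" and "l = fold_idx lam (x $ 2)"
  define A where "A = {k - 1..k + 1} \<times> {l - 1..l + 1}"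
  have "continuous_on (\<Union>p\<in>A. beam (fst p) (snd p)) f"
    by (intro continuous_on_closed_Union) (auto simp: A_def closed_beam f_continuous_beam)
  moreover have idx: "\<bar>fold_idx lam t - fold_idx lam s\<bar> \<le> 1" if "\<bar>t - s\<bar> < lam" for s t
  proof -
    have "(2 * real_of_int (fold_idx lam t) - 1) * lam < (2 * real_of_int (fold_idx lam s) + 2) * lam"
      "(2 * real_of_int (fold_idx lam s) - 1) * lam < (2 * real_of_int (fold_idx lam t) + 2) * lam"
      using fold_idx_bounds[of s] fold_idx_bounds[of t] that by (simp_all add: algebra_simps abs_less_iff)
    then have "2 * real_of_int (fold_idx lam t) - 1 < 2 * real_of_int (fold_idx lam s) + 2"
      "2 * real_of_int (fold_idx lam s) - 1 < 2 * real_of_int (fold_idx lam t) + 2"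
      using lam_pos by (simp_all only: mult_less_cancel_right_pos)
    then show ?thesis by linarith
  qed
  have "ball x lam \<subseteq> (\<Union>p\<in>A. beam (fst p) (snd p))"
  proof
    fix y assume "y \<in> ball x lam"
    then have "norm (y - x) < lam" by (simp add: dist_norm norm_minus_commute)
    then have "\<bar>y $ 1 - x $ 1\<bar> < lam" "\<bar>y $ 2 - x $ 2\<bar> < lam"
      using component_le_norm_cart[of "y - x" 1] component_le_norm_cart[of "y - x" 2] by auto
    then have "(fold_idx lam (y $ 1), fold_idx lam (y $ 2)) \<in> A"
      using idx[of "y $ 1" "x $ 1"] idx[of "y $ 2" "x $ 2"] by (auto simp: A_def k_def l_def)
    then show "y \<in> (\<Union>p\<in>A. beam (fst p) (snd p))" using in_some_beam[of y] by force
  qed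
  ultimately have "continuous_on (ball x lam) f" using continuous_on_subset by blast
  then show "isCont f x" using lam_pos by (simp add: continuous_on_eq_continuous_at)
qed

end

section \<open>The origin has zero capacity\<close>

lemma poly_exp_tendsto_0:
  fixes p :: "real poly"
  shows "((\<lambda>t::real. poly p (1/t) * exp (- (1/t))) \<longlongrightarrow> 0) (at_right 0)"
proof -
  have "((\<lambda>s. poly p s * exp (- s)) \<longlongrightarrow> (0::real)) at_top"
  proof -
    have "((\<lambda>s. \<Sum>i\<le>degree p. coeff p i * (s ^ i / exp s)) \<longlongrightarrow> (\<Sum>i\<le>degree p. coeff p i * 0)) at_top"
      by (intro tendsto_sum tendsto_mult tendsto_const tendsto_power_div_exp_0)
    then show ?thesis
      by (simp add: poly_altdef sum_distrib_right exp_minus divide_inverse mult.assoc)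
  qed
  moreover have "filterlim (\<lambda>t::real. 1/t) at_top (at_right 0)"
    using filterlim_inverse_at_top_right by (simp add: divide_inverse)
  ultimately show ?thesis
    by (rule filterlim_compose)
qed

definition flat_exp :: "real poly \<Rightarrow> real \<Rightarrow> real" where
  "flat_exp p t = (if t > 0 then poly p (1/t) * exp (- (1/t)) else 0)"

text \<open>With s = 1 / t, the t-derivative of p(s) * exp (- s) is s ^ 2 * (p(s) - p'(s)) * exp (-
  s), so the family is closed under differentiation.\<close>

definition flat_exp_deriv :: "real poly \<Rightarrow> real poly" where
  "flat_exp_deriv p = [:0,0,1:] * (p - pderiv p)"

lemma flat_exp_has_derivative:
  "(flat_exp p has_real_derivative flat_exp (flat_exp_deriv p) t) (at t)"
proof -
  consider "t > 0" | "t < 0" | "t = 0" by linarith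
  then show ?thesis
  proof cases
    case 1
    have "((\<lambda>t. poly p (1/t) * exp (- (1/t))) has_real_derivative flat_exp (flat_exp_deriv p) t) (at t)"
      using 1 by (auto intro!: derivative_eq_intros
          simp: flat_exp_def flat_exp_deriv_def field_simps power2_eq_square)
    moreover have "\<forall>\<^sub>F x in nhds t. poly p (1/x) * exp (- (1/x)) = flat_exp p x"
      using eventually_nhds_in_open[of "{0<..}" t] 1
      by (auto elim!: eventually_mono simp: flat_exp_def)
    ultimately show ?thesis
      by (subst (asm) DERIV_cong_ev[OF refl _ refl])
  next
    case 2
    have "((\<lambda>t::real. 0) has_real_derivative flat_exp (flat_exp_deriv p) t) (at t)"
      using 2 by (simp add: flat_exp_def)
    moreover have "\<forall>\<^sub>F x in nhds t. 0 = flat_exp p x"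
      using eventually_nhds_in_open[of "{..<0}" t] 2
      by (auto elim!: eventually_mono simp: flat_exp_def)
    ultimately show ?thesis
      by (subst (asm) DERIV_cong_ev[OF refl _ refl])
  next
    case 3
    \<comment> \<open>Dividing by y multiplies the polynomial in 1 / y by its variable, so the
      difference quotient is of the same type.\<close>
    have "((\<lambda>y. (flat_exp p y - flat_exp p 0) / (y - 0)) \<longlongrightarrow> 0) (at_right 0)"
      by (rule Lim_transform_eventually[OF poly_exp_tendsto_0[of "[:0,1:] * p"]])
        (auto simp: eventually_at_right_field flat_exp_def intro!: exI[of _ 1])
    moreover have "((\<lambda>y. (flat_exp p y - flat_exp p 0) / (y - 0)) \<longlongrightarrow> 0) (at_left 0)"
      by (rule Lim_transform_eventually[OF tendsto_const])
        (auto simp: eventually_at_left_field flat_exp_def intro!: exI[of _ "-1"])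
    ultimately have "((\<lambda>y. (flat_exp p y - flat_exp p 0) / (y - 0)) \<longlongrightarrow> 0) (at 0)"
      by (simp add: filterlim_split_at)
    then show ?thesis
      by (simp add: 3 has_field_derivative_iff flat_exp_def)
  qed
qed

text \<open>A class closed under directional derivatives, so that mere membership gives derivatives
  of all orders as \<open>smooth_inf\<close> requires.\<close>

inductive_set smooth_alg :: "(real^3 \<Rightarrow> real) set" where
  const: "(\<lambda>x. c) \<in> smooth_alg"
| coord: "(\<lambda>x. x $ i) \<in> smooth_alg"
| add: "u \<in> smooth_alg \<Longrightarrow> v \<in> smooth_alg \<Longrightarrow> (\<lambda>x. u x + v x) \<in> smooth_alg"
| mult: "u \<in> smooth_alg \<Longrightarrow> v \<in> smooth_alg \<Longrightarrow> (\<lambda>x. u x * v x) \<in> smooth_alg"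
| inv: "u \<in> smooth_alg \<Longrightarrow> (\<And>x. u x \<noteq> 0) \<Longrightarrow> (\<lambda>x. inverse (u x)) \<in> smooth_alg"
| flat: "u \<in> smooth_alg \<Longrightarrow> (\<lambda>x. flat_exp p (u x)) \<in> smooth_alg"

lemma smooth_alg_has_derivative:
  assumes "u \<in> smooth_alg"
  shows "\<exists>D. (\<forall>x. (u has_derivative D x) (at x)) \<and> (\<forall>v. (\<lambda>x. D x v) \<in> smooth_alg)"
  using assms
proof induction
  case (const c)
  show ?case
    by (rule exI[of _ "\<lambda>x v. 0"]) (auto intro: smooth_alg.const)
next
  case (coord i)
  show ?case
    by (rule exI[of _ "\<lambda>x v. v $ i"]) (auto intro: smooth_alg.const bounded_linear_imp_has_derivative bounded_linear_vec_nth)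
next
  case (add u v)
  then obtain D E where "\<forall>x. (u has_derivative D x) (at x)" "\<forall>w. (\<lambda>x. D x w) \<in> smooth_alg"
    "\<forall>x. (v has_derivative E x) (at x)" "\<forall>w. (\<lambda>x. E x w) \<in> smooth_alg" by blast
  then show ?case
    by (intro exI[of _ "\<lambda>x w. D x w + E x w"]) (auto intro: smooth_alg.add has_derivative_add)
next
  case (mult u v)
  then obtain D E where "\<forall>x. (u has_derivative D x) (at x)" "\<forall>w. (\<lambda>x. D x w) \<in> smooth_alg"
    "\<forall>x. (v has_derivative E x) (at x)" "\<forall>w. (\<lambda>x. E x w) \<in> smooth_alg" by blast
  then show ?case using mult.hyps
    by (intro exI[of _ "\<lambda>x w. u x * E x w + D x w * v x"])
      (auto intro!: smooth_alg.add smooth_alg.mult has_derivative_mult)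
next
  case (inv u)
  then obtain D where "\<forall>x. (u has_derivative D x) (at x)" "\<forall>w. (\<lambda>x. D x w) \<in> smooth_alg" by blast
  then show ?case using inv.hyps
    by (intro exI[of _ "\<lambda>x w. (-1) * (inverse (u x) * D x w * inverse (u x))"])
      (intro conjI allI smooth_alg.const smooth_alg.mult smooth_alg.inv; auto intro!: derivative_eq_intros)
next
  case (flat u p)
  then obtain D where D: "\<forall>x. (u has_derivative D x) (at x)" "\<forall>w. (\<lambda>x. D x w) \<in> smooth_alg" by blast
  have "((\<lambda>x. flat_exp p (u x)) has_derivative (\<lambda>w. flat_exp (flat_exp_deriv p) (u x) * D x w)) (at x)" for x
    using has_derivative_compose[OF D(1)[rule_format, of x]
        flat_exp_has_derivative[of p "u x", unfolded has_field_derivative_def]] by simp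
  with D flat.hyps show ?case
    by (intro exI[of _ "\<lambda>x w. flat_exp (flat_exp_deriv p) (u x) * D x w"])
      (auto intro!: smooth_alg.intros)
qed

lemma smooth_alg_smooth:
  assumes "u \<in> smooth_alg"
  shows "smooth_inf u"
proof -
  have "smooth_n n u" for n
    using assms
  proof (induction n arbitrary: u)
    case 0
    then obtain D where "\<forall>x. (u has_derivative D x) (at x)"
      using smooth_alg_has_derivative by blast
    then show ?case
      by (auto intro!: continuous_at_imp_continuous_on has_derivative_continuous)
  next
    case (Suc n)
    obtain D where D: "\<forall>x. (u has_derivative D x) (at x)" "\<forall>v. (\<lambda>x. D x v) \<in> smooth_alg"
      using smooth_alg_has_derivative[OF Suc.prems] by blast
    then have "frechet_derivative u (at x) = D x" for x
      using frechet_derivative_at by metis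
    with D Suc.IH show ?case
      by (auto simp: differentiable_def)
  qed
  then show ?thesis
    by (simp add: smooth_inf_def)
qed

lemma smooth_alg_sum:
  "finite A \<Longrightarrow> (\<And>i. i \<in> A \<Longrightarrow> u i \<in> smooth_alg) \<Longrightarrow> (\<lambda>x. \<Sum>i\<in>A. u i x) \<in> smooth_alg"
  by (induction A rule: finite_induct) (auto intro: smooth_alg.intros)

lemma smooth_alg_norm_power2: "(\<lambda>x. (norm x)\<^sup>2) \<in> smooth_alg"
proof -
  have "(\<lambda>x. (norm x)\<^sup>2) = (\<lambda>x::real^3. \<Sum>i\<in>UNIV. x $ i * x $ i)"
    by (simp add: power2_norm_eq_inner inner_vec_def)
  moreover have "(\<lambda>x::real^3. \<Sum>i\<in>UNIV. x $ i * x $ i) \<in> smooth_alg"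
    by (rule smooth_alg_sum) (auto intro!: smooth_alg.intros)
  ultimately show ?thesis by simp
qed

text \<open>The usual quotient cut-off in the variable (r * norm x) ^ 2, falling from 1 to 0 between
  the radii 1 / r and 2 / r.\<close>

definition bump :: "real \<Rightarrow> real^3 \<Rightarrow> real" where
  "bump r x = flat_exp 1 (4 - r\<^sup>2 * (norm x)\<^sup>2) *
     inverse (flat_exp 1 (4 - r\<^sup>2 * (norm x)\<^sup>2) + flat_exp 1 (r\<^sup>2 * (norm x)\<^sup>2 - 1))"

lemma flat_exp_1_nonneg: "flat_exp 1 t \<ge> 0"
  by (simp add: flat_exp_def)

lemma flat_exp_1_pos: "flat_exp 1 t > 0 \<longleftrightarrow> t > 0"
  by (simp add: flat_exp_def)

lemma bump_denominator_pos: "flat_exp 1 (4 - t) + flat_exp 1 (t - 1) > 0"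
proof (cases "t < 4")
  case True
  then show ?thesis using flat_exp_1_pos[of "4 - t"] flat_exp_1_nonneg[of "t - 1"] by linarith
next
  case False
  then show ?thesis using flat_exp_1_pos[of "t - 1"] flat_exp_1_nonneg[of "4 - t"] by linarith
qed

lemma bump_smooth: "bump r \<in> smooth_alg"
proof -
  have a: "(\<lambda>x. flat_exp 1 (4 - r\<^sup>2 * (norm x)\<^sup>2)) \<in> smooth_alg"
    using smooth_alg.flat[OF smooth_alg.add[OF smooth_alg.const[of 4]
        smooth_alg.mult[OF smooth_alg.const[of "- r\<^sup>2"] smooth_alg_norm_power2]]] by simp
  have b: "(\<lambda>x. flat_exp 1 (r\<^sup>2 * (norm x)\<^sup>2 - 1)) \<in> smooth_alg"
    using smooth_alg.flat[OF smooth_alg.add[OF smooth_alg.mult[OF smooth_alg.const[of "r\<^sup>2"] smooth_alg_norm_power2]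
        smooth_alg.const[of "-1"]]] by simp
  have "flat_exp 1 (4 - r\<^sup>2 * (norm x)\<^sup>2) + flat_exp 1 (r\<^sup>2 * (norm x)\<^sup>2 - 1) \<noteq> 0" for x :: "real^3"
    using bump_denominator_pos[of "r\<^sup>2 * (norm x)\<^sup>2"] by simp
  then show ?thesis
    unfolding bump_def
    by (intro smooth_alg.mult smooth_alg.inv smooth_alg.add a b) auto
qed

lemma bump_nonneg: "bump r x \<ge> 0"
  using bump_denominator_pos[of "r\<^sup>2 * (norm x)\<^sup>2"]
  by (auto simp: bump_def flat_exp_1_nonneg intro!: mult_nonneg_nonneg)

lemma bump_eq_1:
  assumes "r > 0" "norm x \<le> 1 / r"
  shows "bump r x = 1"
proof -
  have "r * norm x \<le> 1" using assms by (simp add: field_simps)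
  then have "(r * norm x)\<^sup>2 \<le> 1" using assms by (simp add: power_le_one)
  then show ?thesis
    using flat_exp_1_pos[of "4 - r\<^sup>2 * (norm x)\<^sup>2"]
    by (auto simp: bump_def flat_exp_def[of 1 "r\<^sup>2 * (norm x)\<^sup>2 - 1"] power_mult_distrib)
qed

lemma bump_eq_0:
  assumes "r > 0" "norm x \<ge> 2 / r"
  shows "bump r x = 0"
proof -
  have "r * norm x \<ge> 2" using assms by (simp add: field_simps)
  then have "(r * norm x)\<^sup>2 \<ge> 2\<^sup>2" using assms by (intro power_mono) auto
  then show ?thesis
    by (auto simp: bump_def flat_exp_def[of 1 "4 - r\<^sup>2 * (norm x)\<^sup>2"] power_mult_distrib)
qed

lemma bump_scale: "bump r x = bump 1 (r *\<^sub>R x)"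
  by (simp add: bump_def power_mult_distrib)

lemma grad3_continuous:
  assumes "smooth_inf u"
  shows "continuous_on UNIV (grad3 u)"
proof -
  have "smooth_n 1 u" using assms by (simp add: smooth_inf_def)
  then have "continuous_on UNIV (\<lambda>x. frechet_derivative u (at x) (axis i 1))" for i
    by (simp add: One_nat_def)
  then show ?thesis
    unfolding grad3_def by (intro continuous_on_vec_lambda) auto
qed

lemma grad3_has_derivative:
  assumes "(u has_derivative D) (at x)"
  shows "grad3 u x = (\<chi> i. D (axis i 1))"
  using frechet_derivative_at[OF assms] by (simp add: grad3_def)

lemma bump_differentiable: "bump r differentiable (at x)"
  using smooth_alg_has_derivative[OF bump_smooth, of r] by (auto simp: differentiable_def)

lemma bump_has_derivative: "(bump r has_derivative frechet_derivative (bump r) (at x)) (at x)"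
  using bump_differentiable frechet_derivative_works by blast

lemma grad3_bump_scale: "grad3 (bump r) x = r *\<^sub>R grad3 (bump 1) (r *\<^sub>R x)"
proof -
  have "((\<lambda>x. bump 1 (r *\<^sub>R x)) has_derivative (\<lambda>w. frechet_derivative (bump 1) (at (r *\<^sub>R x)) (r *\<^sub>R w))) (at x)"
    by (rule has_derivative_compose[OF _ bump_has_derivative]) (auto intro!: derivative_eq_intros)
  moreover have "bump r = (\<lambda>x. bump 1 (r *\<^sub>R x))"
    using bump_scale by blast
  moreover have "linear (frechet_derivative (bump 1) (at (r *\<^sub>R x)))"
    using bump_differentiable linear_frechet_derivative by blast
  ultimately show ?thesis
    by (simp only: grad3_has_derivative) (simp add: grad3_def vec_eq_iff linear_scale)
qed

lemma grad3_locally_const: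
  assumes "open S" "x \<in> S" "\<And>y. y \<in> S \<Longrightarrow> u y = c"
  shows "grad3 u x = 0"
proof -
  have "((\<lambda>y. c) has_derivative (\<lambda>w. 0)) (at x)" by simp
  then have "(u has_derivative (\<lambda>w. 0)) (at x)"
    by (rule has_derivative_transform_within_open[OF _ assms(1,2)]) (use assms(3) in auto)
  then show ?thesis by (simp add: grad3_has_derivative vec_eq_iff)
qed

lemma grad3_bump_eq_0:
  assumes "r > 0" "norm x < 1 / r \<or> norm x > 2 / r"
  shows "grad3 (bump r) x = 0"
  using assms(2)
proof
  assume "norm x < 1 / r"
  then show ?thesis
    by (intro grad3_locally_const[of "ball 0 (1/r)" x _ 1]) (auto intro!: bump_eq_1 assms)
next
  assume "norm x > 2 / r"
  then show ?thesis
    by (intro grad3_locally_const[of "- cball 0 (2/r)" x _ 0]) (auto intro!: bump_eq_0 assms)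
qed

text \<open>The exponent of the gradient equals the dimension: rescaling by r multiplies the cubed
  gradient by r ^ 3 and divides volume by r ^ 3.\<close>

lemma bump_energy:
  obtains E where "E < \<infinity>"
    "\<And>r. r > 0 \<Longrightarrow> (\<integral>\<^sup>+ x. ennreal ((norm (grad3 (bump r) x)) ^ 3) \<partial>lborel) = E"
proof
  have c: "continuous_on UNIV (\<lambda>x. norm (grad3 (bump r) x) ^ 3)" for r
    by (intro continuous_intros grad3_continuous smooth_alg_smooth bump_smooth)
  then have m: "(\<lambda>x. ennreal (norm (grad3 (bump r) x) ^ 3)) \<in> borel_measurable borel" for r
    by (intro measurable_compose[OF _ measurable_ennreal] borel_measurable_continuous_onI)
  obtain B where B: "\<And>x. x \<in> cball 0 2 \<Longrightarrow> norm (grad3 (bump 1) x) ^ 3 \<le> B"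
  proof -
    have "compact ((\<lambda>x. norm (grad3 (bump 1) x) ^ 3) ` cball 0 2)"
      by (intro compact_continuous_image continuous_on_subset[OF c]) auto
    then have "bdd_above ((\<lambda>x. norm (grad3 (bump 1) x) ^ 3) ` cball 0 2)"
      by (intro bounded_imp_bdd_above compact_imp_bounded)
    then obtain B where "\<forall>x\<in>cball 0 2. norm (grad3 (bump 1) x) ^ 3 \<le> B"
      by (auto simp: bdd_above_def)
    then show ?thesis by (intro that) blast
  qed
  have "(\<integral>\<^sup>+ x. ennreal ((norm (grad3 (bump 1) x)) ^ 3) \<partial>lborel) \<le>
      (\<integral>\<^sup>+ x. ennreal B * indicator (cball 0 2) x \<partial>(lborel :: (real^3) measure))"
  proof (intro nn_integral_mono)
    fix x :: "real^3"
    show "ennreal ((norm (grad3 (bump 1) x)) ^ 3) \<le> ennreal B * indicator (cball 0 2) x"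
      using B[of x] grad3_bump_eq_0[of 1 x] by (auto simp: indicator_def intro: ennreal_leI)
  qed
  also have "\<dots> = ennreal B * emeasure lborel (cball 0 2 :: (real^3) set)"
    by (subst nn_integral_cmult_indicator) auto
  also have "\<dots> < \<infinity>"
    using emeasure_lborel_cball_finite[of "0::real^3" 2] by (simp add: ennreal_mult_less_top)
  finally show "(\<integral>\<^sup>+ x. ennreal ((norm (grad3 (bump 1) x)) ^ 3) \<partial>lborel) < \<infinity>" .
  fix r :: real assume r: "r > 0"
  have "(\<integral>\<^sup>+ x. ennreal ((norm (grad3 (bump 1) x)) ^ 3) \<partial>lborel) =
     (\<integral>\<^sup>+ x. ennreal ((norm (grad3 (bump 1) x)) ^ 3) \<partial>density (distr lborel borel (\<lambda>x. 0 + r *\<^sub>R x)) (\<lambda>_. \<bar>r\<bar> ^ DIM(real^3)))"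
    by (subst lborel_affine[of r 0]) (use r in auto)
  also have "\<dots> = (\<integral>\<^sup>+ x. ennreal (r ^ 3) * ennreal ((norm (grad3 (bump 1) (r *\<^sub>R x))) ^ 3) \<partial>lborel)"
    using r m[of 1] by (subst nn_integral_density; simp add: nn_integral_distr)
  also have "\<dots> = (\<integral>\<^sup>+ x. ennreal ((norm (grad3 (bump r) x)) ^ 3) \<partial>lborel)"
    using r by (simp add: grad3_bump_scale[of r] power_mult_distrib ennreal_mult)
  finally show "(\<integral>\<^sup>+ x. ennreal ((norm (grad3 (bump r) x)) ^ 3) \<partial>lborel) =
     (\<integral>\<^sup>+ x. ennreal ((norm (grad3 (bump 1) x)) ^ 3) \<partial>lborel)" ..
qed

text \<open>The 3-energy is conformally invariant, so averaging \<open>N\<close> dyadic rescalings of one bump, whose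
  gradients have essentially disjoint supports, divides the energy by \<open>N\<^sup>2\<close>.\<close>
definition bump_avg :: "nat \<Rightarrow> real^3 \<Rightarrow> real" where
  "bump_avg N x = (\<Sum>j<N. (1 / real N) * bump (2 ^ j) x)"

lemma bump_avg_smooth: "bump_avg N \<in> smooth_alg"
  unfolding bump_avg_def[abs_def]
  by (intro smooth_alg_sum smooth_alg.mult smooth_alg.const bump_smooth) auto

lemma grad3_bump_avg: "grad3 (bump_avg N) x = (\<Sum>j<N. (1 / real N) *\<^sub>R grad3 (bump (2 ^ j)) x)"
proof -
  have "(bump_avg N has_derivative (\<lambda>w. \<Sum>j<N. (1 / real N) * frechet_derivative (bump (2 ^ j)) (at x) w)) (at x)"
    unfolding bump_avg_def[abs_def]
    by (intro has_derivative_sum has_derivative_mult_right bump_has_derivative)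
  then show ?thesis
    by (simp only: grad3_has_derivative) (simp add: grad3_def vec_eq_iff)
qed

text \<open>The gradients live in the dyadic shells between radii 2 ^ (- j) and 2 ^ (1 - j), which
  meet only in the excluded spheres. At most one summand survives, so no mixed terms arise from the
  cube.\<close>

lemma grad3_bump_avg_norm:
  assumes "\<And>j. norm x \<noteq> 1 / 2 ^ j" "norm x \<noteq> 2"
  shows "(norm (grad3 (bump_avg N) x)) ^ 3 \<le> (\<Sum>j<N. (1 / real N) ^ 3 * (norm (grad3 (bump (2 ^ j)) x)) ^ 3)"
proof (cases "\<exists>k<N. grad3 (bump (2 ^ k)) x \<noteq> 0")
  case False
  then show ?thesis by (simp add: grad3_bump_avg)
next
  case True
  then obtain k where k: "k < N" "grad3 (bump (2 ^ k)) x \<noteq> 0" by blast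
  have nx: "1 / 2 ^ k \<le> norm x \<and> norm x \<le> 2 / 2 ^ k" if "grad3 (bump (2 ^ k)) x \<noteq> 0" for k
    using grad3_bump_eq_0[of "2 ^ k" x] that by force
  have z: "grad3 (bump (2 ^ j)) x = 0" if "j \<noteq> k" for j
  proof (rule ccontr)
    assume nz: "grad3 (bump (2 ^ j)) x \<noteq> 0"
    have main: False if "a < b" "1 / 2 ^ a \<le> norm x" "norm x \<le> 2 / 2 ^ b" for a b
    proof -
      have "(2::real) ^ Suc a \<le> 2 ^ b" using that(1) by (intro power_increasing) auto
      then have "2 / 2 ^ b \<le> (1::real) / 2 ^ a" by (simp add: field_simps)
      then have "norm x = 1 / 2 ^ a" using that by linarith
      then show False using assms(1)[of a] by simp
    qed
    show False
      using main[of j k] main[of k j] nx[OF nz] nx[OF k(2)] that by linarith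
  qed
  have "grad3 (bump_avg N) x = (1 / real N) *\<^sub>R grad3 (bump (2 ^ k)) x"
    unfolding grad3_bump_avg using k z
    by (subst sum.remove[of _ k]) (auto intro!: sum.neutral)
  then have "(norm (grad3 (bump_avg N) x)) ^ 3 = (1 / real N) ^ 3 * (norm (grad3 (bump (2 ^ k)) x)) ^ 3"
    by (simp add: power_mult_distrib power_divide)
  also have "\<dots> \<le> (\<Sum>j<N. (1 / real N) ^ 3 * (norm (grad3 (bump (2 ^ j)) x)) ^ 3)"
    by (rule member_le_sum) (use k in auto)
  finally show ?thesis .
qed

lemma bump_avg_energy:
  obtains E where "E < \<infinity>"
    "\<And>N. (\<integral>\<^sup>+ x. ennreal ((norm (grad3 (bump_avg N) x)) ^ 3) \<partial>lborel) \<le> ennreal (1 / real N ^ 2) * E"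
proof -
  obtain E where E: "E < \<infinity>"
    "\<And>r. r > 0 \<Longrightarrow> (\<integral>\<^sup>+ x. ennreal ((norm (grad3 (bump r) x)) ^ 3) \<partial>lborel) = E"
    using bump_energy by blast
  have m: "(\<lambda>x. ennreal (norm (grad3 (bump r) x) ^ 3)) \<in> borel_measurable borel" for r
    by (intro measurable_compose[OF _ measurable_ennreal] borel_measurable_continuous_onI
        continuous_intros grad3_continuous smooth_alg_smooth bump_smooth)
  have null: "AE x in lborel. norm (x::real^3) \<noteq> s" for s :: real
  proof -
    have "sphere (0::real^3) s \<in> null_sets lborel"
      using negligible_sphere[of "0::real^3" s]
      by (intro null_setsI) (auto simp: negligible_iff_null_sets null_sets_completion_iff)
    then show ?thesis
      by (rule AE_I[rotated 2, OF _ _ ] AE_not_in[THEN eventually_mono]) (auto simp: sphere_def)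
  qed
  have "(\<integral>\<^sup>+ x. ennreal ((norm (grad3 (bump_avg N) x)) ^ 3) \<partial>lborel) \<le> ennreal (1 / real N ^ 2) * E" for N
  proof -
    have "(\<integral>\<^sup>+ x. ennreal ((norm (grad3 (bump_avg N) x)) ^ 3) \<partial>lborel) \<le>
       (\<integral>\<^sup>+ x. (\<Sum>j<N. ennreal ((1 / real N) ^ 3) * ennreal ((norm (grad3 (bump (2 ^ j)) x)) ^ 3)) \<partial>lborel)"
    proof (rule nn_integral_mono_AE)
      have "AE x in lborel. \<forall>j. norm (x::real^3) \<noteq> 1 / 2 ^ (j::nat)"
        by (subst AE_all_countable) (use null in blast)
      with null[of 2] show "AE x in lborel. ennreal ((norm (grad3 (bump_avg N) x)) ^ 3) \<le>
         (\<Sum>j<N. ennreal ((1 / real N) ^ 3) * ennreal ((norm (grad3 (bump (2 ^ j)) x)) ^ 3))"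
      proof eventually_elim
        case (elim x)
        have "(\<Sum>j<N. ennreal ((1 / real N) ^ 3) * ennreal ((norm (grad3 (bump (2 ^ j)) x)) ^ 3)) =
          ennreal (\<Sum>j<N. (1 / real N) ^ 3 * (norm (grad3 (bump (2 ^ j)) x)) ^ 3)"
          by (simp add: ennreal_mult[symmetric] sum_ennreal)
        then show ?case
          using grad3_bump_avg_norm[of x N] elim by (simp add: ennreal_leI)
      qed
    qed
    also have "\<dots> = (\<Sum>j<N. ennreal ((1 / real N) ^ 3) * E)"
      using m by (subst nn_integral_sum) (auto simp: nn_integral_cmult E(2))
    also have "\<dots> = ennreal (real N) * ennreal ((1 / real N) ^ 3) * E"
      by (simp add: ennreal_of_nat_eq_real_of_nat mult.assoc)
    also have "ennreal (real N) * ennreal ((1 / real N) ^ 3) = ennreal (1 / real N ^ 2)"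
      by (subst ennreal_mult[symmetric]) (auto simp: power2_eq_square power3_eq_cube field_simps)
    finally show ?thesis .
  qed
  then show ?thesis using that E(1) by blast
qed

lemma bump_avg_admissible:
  assumes "N > 0"
  shows "bump_avg N \<in> cap_admissible (ball 0 3) {0}"
proof -
  have supp: "fsupport (bump_avg N) \<subseteq> cball 0 2"
    unfolding fsupport_def
  proof (rule closure_minimal)
    show "{x. bump_avg N x \<noteq> 0} \<subseteq> cball 0 2"
    proof (rule ccontr)
      assume "\<not> ?thesis"
      then obtain x where "bump_avg N x \<noteq> 0" "x \<notin> cball 0 2" by blast
      then have x: "bump_avg N x \<noteq> 0" "norm x > 2" by auto
      have "bump (2 ^ j) x = 0" for j :: nat
      proof (rule bump_eq_0)
        have "2 / 2 ^ j \<le> (2::real)" by (simp add: field_simps)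
        then show "2 / 2 ^ j \<le> norm x" using x by linarith
      qed simp
      with x show False by (simp add: bump_avg_def)
    qed
  qed auto
  moreover have "compact (fsupport (bump_avg N))"
    using supp by (metis bounded_cball bounded_subset closed_closure compact_eq_bounded_closed fsupport_def)
  moreover have "bump_avg N 0 = 1"
    using assms by (simp add: bump_avg_def bump_eq_1)
  ultimately show ?thesis
    by (auto simp: cap_admissible_def smooth_alg_smooth[OF bump_avg_smooth] bump_avg_def
        intro!: sum_nonneg divide_nonneg_nonneg bump_nonneg)
qed

lemma capacity_origin: "capacity (ball 0 3) {0} = 0"
proof -
  obtain E where E: "E < \<infinity>"
    "\<And>N. (\<integral>\<^sup>+ x. ennreal ((norm (grad3 (bump_avg N) x)) ^ 3) \<partial>lborel) \<le> ennreal (1 / real N ^ 2) * E"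
    using bump_avg_energy by blast
  have "capacity (ball 0 3) {0} \<le> ennreal (1 / real (Suc N) ^ 2) * E" for N
  proof -
    have "capacity (ball 0 3) {0} \<le>
       (\<integral>\<^sup>+ x. ennreal ((norm (grad3 (bump_avg (Suc N)) x)) ^ 3) * indicator (ball 0 3) x \<partial>lborel)"
      unfolding capacity_def by (rule INF_lower) (simp add: bump_avg_admissible)
    also have "\<dots> \<le> (\<integral>\<^sup>+ x. ennreal ((norm (grad3 (bump_avg (Suc N)) x)) ^ 3) \<partial>lborel)"
      by (intro nn_integral_mono) (auto simp: indicator_def)
    finally show ?thesis using E(2)[of "Suc N"] by (rule order_trans)
  qed
  moreover have "(\<lambda>N. ennreal (1 / real (Suc N) ^ 2) * E) \<longlonglongrightarrow> ennreal 0 * E"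
  proof (rule tendsto_mult_ennreal)
    have "(\<lambda>N. (1 / real (Suc N)) ^ 2) \<longlonglongrightarrow> 0 ^ 2"
      by (intro tendsto_power LIMSEQ_Suc lim_1_over_n)
    then show "(\<lambda>N. ennreal (1 / real (Suc N) ^ 2)) \<longlonglongrightarrow> ennreal 0"
      by (intro tendsto_ennrealI) (simp add: power_divide)
  qed (use E(1) in auto)
  ultimately have "capacity (ball 0 3) {0} \<le> ennreal 0 * E"
    by (intro LIMSEQ_le_const) auto
  then show ?thesis by simp
qed

lemma zero_capacity_subset_origin:
  assumes "E \<subseteq> {0}"
  shows "zero_capacity E"
  unfolding zero_capacity_def
proof (intro allI impI)
  fix C :: "(real^3) set" assume "compact C \<and> C \<subseteq> E"
  then have C: "C \<subseteq> {0}" using assms by auto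
  have "capacity (ball 0 3) C \<le> capacity (ball 0 3) {0}"
    unfolding capacity_def by (rule INF_superset_mono) (use C in \<open>auto simp: cap_admissible_def\<close>)
  then have "capacity (ball 0 3) C = 0" by (simp add: capacity_origin)
  moreover have "C \<subseteq> ball 0 3" using C by auto
  ultimately show "compact_zero_cap C"
    unfolding compact_zero_cap_def using open_ball bounded_ball by blast
qed

section \<open>Sequences of heights and distances\<close>

lemma square_le_power_3: "(real k)\<^sup>2 \<le> 3 ^ k"
proof (induction k)
  case (Suc k)
  show ?case
  proof (cases "k \<ge> 2")
    case True
    then have "2 * real k \<le> real k * real k" by (intro mult_right_mono) auto
    moreover have "real k \<ge> 2" using True by simp
    ultimately have "2 * real k + 1 \<le> 2 * (real k)\<^sup>2"
      unfolding power2_eq_square by linarith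
    then have "(real (Suc k))\<^sup>2 \<le> 3 * (real k)\<^sup>2" by (simp add: power2_eq_square algebra_simps)
    then show ?thesis using Suc by simp
  next
    case False
    then have "k = 0 \<or> k = 1" by auto
    then show ?thesis by auto
  qed
qed simp

lemma power_3_dominates:
  obtains k0 :: nat where "\<And>k. k \<ge> k0 \<Longrightarrow> 3 ^ k \<ge> A * real k + B"
proof -
  obtain k0 :: nat where k0: "\<bar>A\<bar> + \<bar>B\<bar> + 1 \<le> real k0" using real_arch_simple by blast
  have "3 ^ k \<ge> A * real k + B" if "k \<ge> k0" for k
  proof -
    have k: "\<bar>A\<bar> + \<bar>B\<bar> + 1 \<le> real k" using k0 that by linarith
    have "A * real k \<le> \<bar>A\<bar> * real k" by (intro mult_right_mono) auto
    moreover have "\<bar>B\<bar> * 1 \<le> \<bar>B\<bar> * real k" using k by (intro mult_left_mono) linarith+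
    moreover have "(\<bar>A\<bar> + \<bar>B\<bar>) * real k \<le> real k * real k" using k by (intro mult_right_mono) linarith+
    ultimately have "A * real k + B \<le> (real k)\<^sup>2" by (simp add: power2_eq_square algebra_simps)
    then show ?thesis using square_le_power_3[of k] by linarith
  qed
  then show ?thesis using that by blast
qed

text \<open>Only exp s >= 1 + s is used: it shows that t + 1 at least triples, a weak but sufficient
  trace of the iterated exponential.\<close>

lemma tower_growth:
  fixes t :: "nat \<Rightarrow> real"
  assumes t0: "t a \<ge> 0"
    and step: "\<And>j. a \<le> j \<Longrightarrow> j < b \<Longrightarrow> t (Suc j) \<ge> 3 * exp (t j)"
    and "a + i \<le> b"
  shows "t (a + i) \<ge> 3 ^ i - 1"
  using \<open>a + i \<le> b\<close>
proof (induction i)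
  case 0
  then show ?case using t0 by simp
next
  case (Suc i)
  then have "t (a + i) \<ge> 3 ^ i - 1" by simp
  moreover have "t (a + Suc i) \<ge> 3 * exp (t (a + i))"
    using step[of "a + i"] Suc.prems by simp
  moreover have "exp (t (a + i)) \<ge> 1 + t (a + i)"
    by (rule exp_ge_add_one_self)
  moreover have "(3::real) ^ Suc i = 3 * 3 ^ i" by simp
  ultimately show ?case by linarith
qed

lemma exp_sum_le:
  fixes p t :: "nat \<Rightarrow> real"
  assumes "L \<ge> 0" and "\<And>j. a \<le> j \<Longrightarrow> j < a + k \<Longrightarrow> p (Suc j) \<le> L * exp (t j) * p j"
  shows "p (a + k) \<le> L ^ k * exp (\<Sum>j = a..<a + k. t j) * p a"
  using assms(2)
proof (induction k)
  case 0
  then show ?case by simp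
next
  case (Suc k)
  have "p (a + Suc k) \<le> L * exp (t (a + k)) * p (a + k)"
    using Suc.prems[of "a + k"] by simp
  also have "\<dots> \<le> L * exp (t (a + k)) * (L ^ k * exp (\<Sum>j = a..<a + k. t j) * p a)"
    by (intro mult_left_mono Suc.IH) (use Suc.prems \<open>L \<ge> 0\<close> in auto)
  also have "\<dots> = L ^ Suc k * exp (\<Sum>j = a..<a + Suc k. t j) * p a"
    by (simp add: exp_add algebra_simps)
  finally show ?case .
qed

text \<open>In the orbit \<open>t\<close> is the height, \<open>e\<close> the distance to the nearest preimage of the axis and
  \<open>p\<close> the distance to the axis itself. An orbit that is low must be close to a preimage of the axis, hence
  lands next to the axis and climbs along it; the height reached on leaving the axis outweighs everything
  lost since, because heights grow like an exponential tower in the number of steps.\<close>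
lemma expansion_step:
  fixes L lam c :: real
  assumes L: "L \<ge> 1" and lam: "lam \<ge> 4 * L"
  obtains H \<eta> :: real where "0 < \<eta>" and
    "\<And>t p e :: nat \<Rightarrow> real. \<And>n.
       (\<And>j. n \<le> j \<Longrightarrow> 0 < e j \<and> e j \<le> 2 * lam \<and> e j \<le> p j) \<Longrightarrow>
       (\<And>j. n \<le> j \<Longrightarrow> p (Suc j) \<le> L * exp (t j) * e j) \<Longrightarrow>
       (\<And>j. n \<le> j \<Longrightarrow> p j \<le> lam \<Longrightarrow> t (Suc j) \<ge> exp (t j) * (lam - L * p j)) \<Longrightarrow>
       (\<And>j. n \<le> j \<Longrightarrow> H < t j \<or> L * exp (t j) * e j < \<eta>) \<Longrightarrow>
       \<exists>n'>n. (\<Sum>j<n'. t j + c) \<ge> (\<Sum>j<n. t j + c) + 1"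
proof -
  \<comment> \<open>Bounds all additive losses: the constant c, the factor \<open>L\<close> and the
    width 2 * lam, each per step.\<close>
  define M where "M = \<bar>c\<bar> + ln L + ln (2 * lam)"
  have lam2: "2 * lam \<ge> 1" "lam > 0" using L lam by auto
  have M: "M \<ge> 0" using L lam2 by (auto simp: M_def)
  obtain k0 where "\<And>k. k \<ge> k0 \<Longrightarrow> 3 ^ k \<ge> 2 * M * real k + (6 * M + 3)"
    using power_3_dominates by blast
  \<comment> \<open>The 3 instead of 2 absorbs a shift: the tower is started one step after landing,
    when the height is certainly nonnegative.\<close>
  then have k0: "\<And>k. k \<ge> k0 \<Longrightarrow> 3 ^ k - 1 \<ge> 2 * (real k + 3) * M + 2"
    by (simp add: algebra_simps)
  \<comment> \<open>A single step from above this height already contributes at least 1.\<close>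
  define H where "H = 1 + \<bar>c\<bar>"
  define Y where "Y = 2 * (real k0 + 3) * M + 2"
  \<comment> \<open>So small that a point landing this close to the axis can leave it within k0
    steps only if its height then exceeds \<open>Y\<close>.\<close>
  define \<eta> where "\<eta> = exp (- (real (k0 + 2) * Y)) / L ^ (k0 + 1)"
  have \<eta>: "\<eta> > 0" using L by (simp add: \<eta>_def)
  show ?thesis
  proof (rule that[OF \<eta>, of H])
    fix t p e :: "nat \<Rightarrow> real" and n
    assume e: "\<And>j. n \<le> j \<Longrightarrow> 0 < e j \<and> e j \<le> 2 * lam \<and> e j \<le> p j"
      and p: "\<And>j. n \<le> j \<Longrightarrow> p (Suc j) \<le> L * exp (t j) * e j"
      and climb: "\<And>j. n \<le> j \<Longrightarrow> p j \<le> lam \<Longrightarrow> t (Suc j) \<ge> exp (t j) * (lam - L * p j)"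
      and near: "\<And>j. n \<le> j \<Longrightarrow> H < t j \<or> L * exp (t j) * e j < \<eta>"
    define S where "S n = (\<Sum>j<n. t j + c)" for n
    have SS: "S b = S a + (\<Sum>j=a..<b. t j + c)" if "a \<le> b" for a b
      using that by (simp add: S_def atLeast0LessThan[symmetric] sum.atLeastLessThan_concat)
    show "\<exists>n'>n. (\<Sum>j<n'. t j + c) \<ge> (\<Sum>j<n. t j + c) + 1"
    proof (cases "H < t n")
      case True
      then show ?thesis by (intro exI[of _ "Suc n"]) (auto simp: H_def)
    next
      case False
      define a where "a = Suc n"
      have p0: "p j > 0" if "n \<le> j" for j using e[OF that] by linarith
      have L0: "L > 0" using L by simp
      have pa: "p a \<le> L * exp (t n) * e n" "p a < \<eta>"
        using p[of n] near[of n] False by (auto simp: a_def)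
      have \<eta>1: "\<eta> \<le> 1"
      proof -
        have "exp (- (real (k0 + 2) * Y)) \<le> 1" using M by (auto simp: Y_def intro!: mult_nonneg_nonneg)
        moreover have "L ^ (k0 + 1) \<ge> 1" using L by (rule one_le_power)
        ultimately show ?thesis
          unfolding \<eta>_def by (subst divide_le_eq_1_pos) linarith+
      qed
      \<comment> \<open>Closeness to the axis relative to the height. With the halved exponent, the
        first failure occurs at distance at least exp (- t / 2), so half of the final height is left
        after all losses are paid.\<close>
      define Q where "Q j \<longleftrightarrow> p j * exp (max (t j) 0 / 2) < 1" for j
      have step: "t (Suc j) \<ge> 3 * exp (t j)" if "n \<le> j" "Q j" for j
      proof -
        have "p j * 1 \<le> p j * exp (max (t j) 0 / 2)"
          using p0[OF that(1)] by (intro mult_left_mono) auto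
        then have p1: "p j < 1" using that(2) by (simp add: Q_def)
        then have "L * p j \<le> L * 1" using L by (intro mult_left_mono) auto
        then have "3 \<le> lam - L * p j" using lam L by linarith
        then have "exp (t j) * 3 \<le> exp (t j) * (lam - L * p j)" by (intro mult_left_mono) auto
        moreover have "t (Suc j) \<ge> exp (t j) * (lam - L * p j)"
          using climb[OF that(1)] p1 lam L by simp
        ultimately show ?thesis by linarith
      qed
      show ?thesis
      proof (cases "\<forall>j\<ge>a. Q j")
        case True
        have t0: "t (Suc a) \<ge> 0"
          using step[of a] True by (auto simp: a_def intro: order_trans[rotated])
        have tow: "t (Suc a + i) \<ge> 3 ^ i - 1" for i
          by (rule tower_growth[of t "Suc a" "Suc a + i", OF t0]) (use True step in \<open>auto simp: a_def\<close>)
        obtain i0 where i0: "\<And>i. i \<ge> i0 \<Longrightarrow> 3 ^ i \<ge> 0 * real i + (2 - c)"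
          using power_3_dominates by blast
        define j0 where "j0 = Suc a + i0"
        have big: "t j + c \<ge> 1" if "j \<ge> j0" for j
        proof -
          have "i0 \<le> j - Suc a" "Suc a + (j - Suc a) = j" using that by (auto simp: j0_def)
          then show ?thesis using tow[of "j - Suc a"] i0[of "j - Suc a"] by simp
        qed
        obtain k where k: "real k \<ge> S n + 1 - S j0" using real_arch_simple by blast
        have "(\<Sum>j=j0..<j0 + k. t j + c) \<ge> (\<Sum>j=j0..<j0 + k. 1)"
          by (intro sum_mono) (use big in auto)
        then have "S (j0 + k) \<ge> S n + 1" using k SS[of j0 "j0 + k"] by simp
        then show ?thesis
          by (intro exI[of _ "j0 + k"]) (auto simp: S_def j0_def a_def)
      next
        case False
        define N where "N = (LEAST j. a \<le> j \<and> \<not> Q j)"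
        have N: "a \<le> N" "\<not> Q N" and less: "\<And>j. a \<le> j \<Longrightarrow> j < N \<Longrightarrow> Q j"
        proof -
          obtain j1 where "a \<le> j1 \<and> \<not> Q j1" using False by blast
          then have "a \<le> N \<and> \<not> Q N" unfolding N_def by (rule LeastI)
          then show "a \<le> N" "\<not> Q N" by auto
          show "Q j" if "a \<le> j" "j < N" for j
            using not_less_Least[of j "\<lambda>j. a \<le> j \<and> \<not> Q j"] that unfolding N_def by blast
        qed
        define k where "k = N - a"
        have Nk: "N = a + k" using N(1) by (simp add: k_def)
        have stepN: "t (Suc j) \<ge> 3 * exp (t j)" if "a \<le> j" "j < N" for j
          using step[of j] less[OF that] that by (simp add: a_def)
        have exit: "1 \<le> p N * exp (max (t N) 0 / 2)" using N(2) by (simp add: Q_def)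
        have tN: "t N > 0"
        proof (cases k)
          case 0
          then have "p N < 1" using pa \<eta>1 Nk by simp
          show ?thesis
          proof (rule ccontr)
            assume "\<not> ?thesis"
            then have "max (t N) 0 = 0" by simp
            with exit \<open>p N < 1\<close> show False by simp
          qed
        next
          case (Suc k')
          then have "t N \<ge> 3 * exp (t (a + k'))" using stepN[of "a + k'"] Nk by simp
          then show ?thesis by (rule less_le_trans[rotated]) simp
        qed
        have mono: "t (a + i) \<le> t (a + i')" if "i \<le> i'" "i' \<le> k" for i i'
          using that
        proof (induction i' rule: dec_induct)
          case (step m)
          have "t (a + Suc m) \<ge> 3 * exp (t (a + m))" using stepN[of "a + m"] step.prems Nk by simp
          moreover have "exp (t (a + m)) \<ge> t (a + m)" using exp_ge_add_one_self[of "t (a + m)"] by linarith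
          moreover have "exp (t (a + m)) > 0" by simp
          ultimately have "t (a + Suc m) \<ge> t (a + m)" by linarith
          then show ?case using step by simp
        qed simp
        define T where "T = (\<Sum>j = a..<a + k. t j)"
        have "p (a + k) \<le> L ^ k * exp T * p a"
          unfolding T_def
        proof (rule exp_sum_le)
          fix j assume j: "a \<le> j" "j < a + k"
          then have "p (Suc j) \<le> L * exp (t j) * e j" using p[of j] by (simp add: a_def)
          also have "\<dots> \<le> L * exp (t j) * p j"
            using e[of j] j L0 by (intro mult_left_mono) (auto simp: a_def)
          finally show "p (Suc j) \<le> L * exp (t j) * p j" .
        qed (use L in simp)
        then have "p N * exp (t N / 2) \<le> L ^ k * exp T * p a * exp (t N / 2)"
          using Nk by (intro mult_right_mono) auto
        \<comment> \<open>The distance at the exit is at least exp (- t N / 2), yet it arose from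
          \<open>p a\<close> by a factor of at most L ^ k * exp T. This bounds the heights in
          between from below.\<close>
        then have key: "1 \<le> L ^ k * exp (T + t N / 2) * p a"
        proof -
          have "1 \<le> p N * exp (t N / 2)" using exit tN by simp
          also have "\<dots> \<le> L ^ k * exp T * p a * exp (t N / 2)" by fact
          finally show ?thesis by (simp add: exp_add mult_ac)
        qed
        have Tle: "T \<le> real k * t N"
        proof -
          have "T \<le> (\<Sum>j = a..<a + k. t N)"
            unfolding T_def
          proof (intro sum_mono)
            fix j assume "j \<in> {a..<a + k}"
            then show "t j \<le> t N" using mono[of "j - a" k] Nk by auto
          qed
          then show ?thesis by simp
        qed
        \<comment> \<open>An early exit is forced to be high by the choice of \<open>\<eta>\<close>,
          a late one by the tower growth.\<close>
        have big: "t N \<ge> 2 * (real k + 2) * M + 2"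
        proof (cases "k \<le> k0")
          case True
          have "1 < L ^ k * exp (T + t N / 2) * \<eta>"
            by (rule le_less_trans[OF key]) (use pa L0 in \<open>auto intro!: mult_strict_left_mono mult_pos_pos\<close>)
          also have "\<dots> \<le> L ^ k0 * exp (real (k0 + 1) * t N) * \<eta>"
          proof -
            have "real k * t N \<le> real k0 * t N" using True tN by (intro mult_right_mono) auto
            then have "T + t N / 2 \<le> real k0 * t N + t N" using Tle tN by linarith
            then have "T + t N / 2 \<le> real (k0 + 1) * t N" by (simp add: algebra_simps)
            moreover have "L ^ k \<le> L ^ k0" using True L by (intro power_increasing) auto
            ultimately show ?thesis
              using \<eta> L0 by (intro mult_right_mono mult_mono) auto
          qed
          also have "\<dots> = exp (real (k0 + 1) * t N - real (k0 + 2) * Y) / L"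
          proof -
            define Z W where "Z = real (k0 + 2) * Y" and "W = real (k0 + 1) * t N"
            have "L ^ k0 * exp W * (exp (- Z) / L ^ (k0 + 1)) = exp (W - Z) / L"
              using L0 by (simp add: exp_diff exp_minus field_simps)
            then show ?thesis by (simp only: \<eta>_def Z_def W_def)
          qed
          also have "\<dots> \<le> exp (real (k0 + 1) * t N - real (k0 + 2) * Y)"
            using L by (simp add: field_simps)
          finally have "real (k0 + 1) * t N > real (k0 + 2) * Y" by simp
          moreover have "real (k0 + 2) * Y \<ge> real (k0 + 1) * Y"
            using M by (intro mult_right_mono) (auto simp: Y_def)
          ultimately have "real (k0 + 1) * Y < real (k0 + 1) * t N" by linarith
          then have "Y < t N" by (subst (asm) mult_less_cancel_left_pos) auto
          moreover have "2 * (real k + 2) * M + 2 \<le> Y"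
            using True M by (auto simp: Y_def intro!: mult_right_mono)
          ultimately show ?thesis by linarith
        next
          case False
          then obtain k' where k': "k = Suc k'" "k0 \<le> k'" by (cases k) auto
          have "t (Suc a) \<ge> 3 * exp (t a)" using stepN[of a] Nk k' by simp
          then have t0: "t (Suc a) \<ge> 0" by (rule order_trans[rotated]) simp
          have "t (Suc a + k') \<ge> 3 ^ k' - 1"
            by (rule tower_growth[of t "Suc a" N, OF t0]) (use stepN Nk k' in auto)
          then show ?thesis using k0[OF k'(2)] k'(1) Nk by (simp add: algebra_simps)
        qed
        \<comment> \<open>How a deep descent is repaid: a very negative \<open>t n\<close> makes
          \<open>p a\<close> proportionally small, so the climb is longer and \<open>T + t n\<close>
          stays bounded below in terms of the exit height.\<close>
        have "1 \<le> L ^ k * exp (T + t N / 2) * (L * exp (t n) * (2 * lam))"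
        proof (rule order_trans[OF key])
          have "p a \<le> L * exp (t n) * (2 * lam)"
            using pa(1) e[of n] L0 by (intro order_trans[OF pa(1)] mult_left_mono) auto
          then show "L ^ k * exp (T + t N / 2) * p a \<le> L ^ k * exp (T + t N / 2) * (L * exp (t n) * (2 * lam))"
            using L0 by (intro mult_left_mono) auto
        qed
        then have "0 \<le> ln (L ^ k * exp (T + t N / 2) * (L * exp (t n) * (2 * lam)))" by simp
        also have "\<dots> = real (k + 1) * ln L + T + t N / 2 + t n + ln (2 * lam)"
          using L0 lam2 by (simp add: ln_mult ln_realpow algebra_simps)
        finally have lower: "T + t n \<ge> - (t N / 2) - real (k + 1) * ln L - ln (2 * lam)" by linarith
        have "(\<Sum>j=n..<Suc N. t j + c) = t n + T + t N + real (k + 2) * c"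
        proof -
          have "(\<Sum>j=n..<Suc N. t j + c) = (t n + c) + (\<Sum>j=a..<Suc N. t j + c)"
            using N(1) by (subst sum.atLeast_Suc_lessThan) (auto simp: a_def)
          also have "(\<Sum>j=a..<Suc N. t j + c) = T + real k * c + (t N + c)"
            using Nk by (simp add: T_def sum.distrib algebra_simps)
          finally show ?thesis by (simp add: algebra_simps)
        qed
        moreover have "real (k + 2) * c \<ge> - (real (k + 2) * \<bar>c\<bar>)"
          using mult_left_mono[of "- \<bar>c\<bar>" c "real (k + 2)"] by simp
        moreover have "real (k + 1) * ln L + ln (2 * lam) + real (k + 2) * \<bar>c\<bar> \<le> (real k + 2) * M"
        proof -
          have "real (k + 1) * ln L \<le> (real k + 2) * ln L" using L by (intro mult_right_mono) auto
          moreover have "1 * ln (2 * lam) \<le> (real k + 2) * ln (2 * lam)" using lam2 by (intro mult_right_mono) auto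
          ultimately show ?thesis by (simp add: M_def algebra_simps)
        qed
        ultimately have "(\<Sum>j=n..<Suc N. t j + c) \<ge> 1" using lower big by linarith
        then have "S (Suc N) \<ge> S n + 1" using SS[of n "Suc N"] N(1) by (simp add: a_def)
        then show ?thesis
          using N(1) by (intro exI[of _ "Suc N"]) (auto simp: S_def a_def)
      qed
    qed
  qed
qed

section \<open>Area expansion by maps in logarithmic polar form\<close>

text \<open>Outer regularity reduces to open sets, whose components are countably many disjoint
  intervals.\<close>

lemma measure_le_lborel_if_intervals:
  fixes M :: "real measure"
  assumes M: "sets M = sets borel"
    and le: "\<And>a b. a \<le> b \<Longrightarrow> emeasure M {a..b} \<le> ennreal (b - a)"
    and B: "B \<in> sets borel"
  shows "emeasure M B \<le> emeasure lborel B"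
proof (rule ennreal_le_epsilon)
  fix e :: real assume fin: "emeasure lborel B < top" and e: "0 < e"
  obtain U where U: "open U" "B \<subseteq> U" "emeasure lborel (U - B) < e"
    using outer_regular_lborel[OF B e] by blast
  have finU: "emeasure lborel U \<le> emeasure lborel B + e"
  proof -
    have "emeasure lborel U = emeasure lborel B + emeasure lborel (U - B)"
      using U B by (subst plus_emeasure) (auto intro!: arg_cong[where f = "emeasure lborel"])
    then show ?thesis using U(3) by (simp add: add_left_mono less_imp_le)
  qed
  have cs: "C \<in> sets borel" if "C \<in> components U" for C
    using open_components[OF U(1) that] by simp
  have dis: "disjoint_family_on (\<lambda>C. C) (components U)"
    using pairwise_disjoint_components[of U] by (auto simp: disjoint_family_on_def pairwise_def disjnt_def)
  have cnt: "countable (components U)"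

  proof (rule countable_disjoint_open_subsets)
    show "open C" if "C \<in> components U" for C
      using open_components[OF U(1) that] .
    show "pairwise disjnt (components U)"
      using pairwise_disjoint_components[of U] by (simp add: pairwise_def disjnt_def)
  qed
  have Cle: "emeasure M C \<le> emeasure lborel C" if C: "C \<in> components U" for C
  proof -
    have "emeasure lborel C < \<infinity>"
      using emeasure_mono[of C U lborel] in_components_subset[OF C] U(1) finU fin
      by (metis borel_open ennreal_add_less_top ennreal_less_top infinity_ennreal_def le_less_trans sets_lborel)
    then obtain m where m: "emeasure lborel C = ennreal m" "m \<ge> 0"
      by (cases "emeasure lborel C") auto
    have con: "connected C" "C \<noteq> {}"
      using C in_components_connected in_components_nonempty by auto
    have sub: "{x..y} \<subseteq> C" if "x \<in> C" "y \<in> C" for x y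
      using connected_contains_Icc[OF con(1) that] .
    have le_m: "y - x \<le> m" if "x \<in> C" "y \<in> C" "x \<le> y" for x y
    proof -
      have "ennreal (y - x) \<le> ennreal m"
        using emeasure_mono[OF sub[OF that(1,2)], of lborel] cs[OF C] that(3) m by simp
      then show ?thesis using m(2) by (simp add: ennreal_le_iff)
    qed
    obtain z where z: "z \<in> C" using con(2) by blast
    have bd: "z - m \<le> y \<and> y \<le> z + m" if "y \<in> C" for y
      using le_m[OF z that] le_m[OF that z] m(2) by (cases "y \<le> z") auto
    then have bb: "bdd_below C" "bdd_above C"
      by (auto simp: bdd_below_def bdd_above_def)
    define a b where "a = Inf C" and "b = Sup C"
    have ab: "C \<subseteq> {a..b}"
      using bb by (auto simp: a_def b_def cInf_lower cSup_upper)
    have "{a<..<b} \<subseteq> C"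
    proof
      fix y assume "y \<in> {a<..<b}"
      then obtain u v where "u \<in> C" "u < y" "v \<in> C" "y < v"
        using bb con(2) by (auto simp: a_def b_def cInf_less_iff less_cSup_iff)
      then show "y \<in> C" using sub[of u v] by auto
    qed
    moreover have "a \<le> b" using ab z by auto
    ultimately have "ennreal (b - a) \<le> emeasure lborel C"
      using emeasure_mono[of "{a<..<b}" C lborel] cs[OF C] by simp
    moreover have "emeasure M C \<le> emeasure M {a..b}"
      using ab M by (intro emeasure_mono) auto
    ultimately show ?thesis
      using le[OF \<open>a \<le> b\<close>] by (meson order_trans)
  qed
  have "emeasure M B \<le> emeasure M U"
    using U M by (intro emeasure_mono) auto
  also have "emeasure M U = (\<integral>\<^sup>+C. emeasure M C \<partial>count_space (components U))"
    using emeasure_UN_countable[where X = "\<lambda>C. C" and M = M and I = "components U"] cs M cnt dis by (simp add: Union_components)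
  also have "\<dots> \<le> (\<integral>\<^sup>+C. emeasure lborel C \<partial>count_space (components U))"
    by (intro nn_integral_mono) (use Cle in auto)
  also have "\<dots> = emeasure lborel U"
    using emeasure_UN_countable[where X = "\<lambda>C. C" and M = lborel and I = "components U"] cs cnt dis by (simp add: Union_components)
  also note finU
  finally show "emeasure M B \<le> emeasure lborel B + ennreal e" .
qed

text \<open>Exhaustion by the intervals spanned by the first n points of a countable dense subset.
  Their end points stay in \<open>J\<close>, where the bound is available.\<close>

lemma emeasure_open_connected_le:
  fixes J :: "real set"
  assumes J: "open J" "connected J" and N: "sets N = sets borel"
    and le: "\<And>a b. a \<in> J \<Longrightarrow> b \<in> J \<Longrightarrow> a \<le> b \<Longrightarrow> emeasure N {a..b} \<le> C"
  shows "emeasure N J \<le> C"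
proof (cases "J = {}")
  case False
  define D where "D = J \<inter> \<rat>"
  have D: "countable D" unfolding D_def using countable_rat by blast
  have sides: "\<exists>p\<in>D. \<exists>q\<in>D. p \<le> x \<and> x \<le> q" if x: "x \<in> J" for x
  proof -
    obtain e where e: "e > 0" "ball x e \<subseteq> J"
      using openE[OF J(1) x] by blast
    obtain p q where "p \<in> \<rat>" "x - e < p" "p < x" "q \<in> \<rat>" "x < q" "q < x + e"
      using Rats_dense_in_real[of "x - e" x] Rats_dense_in_real[of x "x + e"] e(1) by auto
    moreover from this have "p \<in> ball x e" "q \<in> ball x e" by (auto simp: dist_real_def)
    ultimately show ?thesis using e(2) by (intro bexI[of _ p] bexI[of _ q]) (auto simp: D_def)
  qed
  then have Dne: "D \<noteq> {}" using False by blast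
  define d where "d = from_nat_into D"
  have dD: "d n \<in> J" for n using from_nat_into[OF Dne] by (simp add: d_def D_def)
  have dsurj: "\<exists>n. d n = x" if "x \<in> D" for x
    using from_nat_into_surj[OF D that] by (simp add: d_def)
  define A where "A n = {Min (d ` {..n})..Max (d ` {..n})}" for n
  have sub: "{x..y} \<subseteq> J" if "x \<in> J" "y \<in> J" for x y
    using connected_contains_Icc[OF J(2) that] .
  have mem: "Min (d ` {..n}) \<in> J" "Max (d ` {..n}) \<in> J" "Min (d ` {..n}) \<le> Max (d ` {..n})" for n
  proof -
    have "Min (d ` {..n}) \<in> d ` {..n}" "Max (d ` {..n}) \<in> d ` {..n}"
      by (intro Min_in Max_in; auto)+
    moreover have "d ` {..n} \<subseteq> J" using dD by auto
    ultimately show "Min (d ` {..n}) \<in> J" "Max (d ` {..n}) \<in> J" by (blast intro: subsetD)+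
    show "Min (d ` {..n}) \<le> Max (d ` {..n})"
      by (rule order_trans[of _ "d 0"]) auto
  qed
  have inc: "incseq A"
  proof (rule monoI)
    fix m n :: nat assume "m \<le> n"
    then have "Min (d ` {..n}) \<le> Min (d ` {..m})" "Max (d ` {..m}) \<le> Max (d ` {..n})"
      by (intro Min_antimono Max_mono image_mono; force)+
    then show "A m \<subseteq> A n" by (auto simp: A_def)
  qed
  have "J = (\<Union>n. A n)"
  proof
    show "(\<Union>n. A n) \<subseteq> J" using sub mem by (auto simp: A_def)
    show "J \<subseteq> (\<Union>n. A n)"
    proof
      fix x assume "x \<in> J"
      then obtain p q where pq: "p \<in> D" "q \<in> D" "p \<le> x" "x \<le> q" using sides by blast
      then obtain i j where ij: "d i = p" "d j = q" using dsurj by metis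
      have "Min (d ` {..max i j}) \<le> d i" "d j \<le> Max (d ` {..max i j})"
        by (intro Min_le Max_ge; auto)+
      then have "x \<in> A (max i j)"
        using pq ij unfolding A_def atLeastAtMost_iff by (metis order_trans)
      then show "x \<in> (\<Union>n. A n)" by blast
    qed
  qed
  moreover have "A n \<in> sets N" for n
    unfolding A_def N by (rule borel_closed[OF closed_atLeastAtMost])
  then have "range A \<subseteq> sets N" by blast
  then have "(SUP n. emeasure N (A n)) = emeasure N (\<Union>n. A n)"
    using inc by (rule SUP_emeasure_incseq)
  ultimately have "emeasure N J = (SUP n. emeasure N (A n))" by simp
  also have "\<dots> \<le> C"
    unfolding A_def by (intro SUP_least le mem)
  finally show ?thesis .
qed simp

text \<open>A substitution inequality that asks for no derivative of \<open>u\<close>. Injectivity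
  makes \<open>u\<close> monotone, so preimages of intervals are intervals and the image under
  \<open>u\<close> of the measure with density \<open>w\<close> is dominated by length
  there.\<close>

lemma nn_integral_preimage_le:
  fixes u w :: "real \<Rightarrow> real"
  assumes I: "open I" "connected I" and u: "continuous_on I u" "inj_on u I"
    and w: "continuous_on I w"
    and le: "\<And>a b. a \<in> I \<Longrightarrow> b \<in> I \<Longrightarrow> a \<le> b \<Longrightarrow>
        (\<integral>\<^sup>+x. ennreal (w x) * indicator {a..b} x \<partial>lborel) \<le> ennreal \<bar>u b - u a\<bar>"
    and B: "B \<in> sets borel"
  shows "(\<integral>\<^sup>+x. ennreal (w x) * indicator {x\<in>I. u x \<in> B} x \<partial>lborel) \<le> emeasure lborel B"
proof -
  have [measurable]: "I \<in> sets borel" using I by simp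
  define v where "v x = indicator I x *\<^sub>R u x" for x
  have v [measurable]: "v \<in> borel_measurable borel"
    unfolding v_def by (intro borel_measurable_continuous_on_indicator u) simp
  have "(\<lambda>x. indicator I x *\<^sub>R w x) \<in> borel_measurable borel"
    by (intro borel_measurable_continuous_on_indicator w) simp
  then have "(\<lambda>x. ennreal (indicator I x *\<^sub>R w x)) \<in> borel_measurable borel" by simp
  moreover have "(\<lambda>x. ennreal (indicator I x *\<^sub>R w x)) = (\<lambda>x. ennreal (w x) * indicator I x)"
    by (auto simp: indicator_def)
  ultimately have m [measurable]: "(\<lambda>x. ennreal (w x) * indicator I x) \<in> borel_measurable borel" by simp
  define N where "N = density lborel (\<lambda>x. ennreal (w x) * indicator I x)"
  define M where "M = distr N borel v"
  have MB: "emeasure M C = (\<integral>\<^sup>+x. ennreal (w x) * indicator {x\<in>I. u x \<in> C} x \<partial>lborel)"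
    if [measurable]: "C \<in> sets borel" for C
  proof -
    have "emeasure M C = emeasure N (v -` C)"
      unfolding M_def by (subst emeasure_distr) (auto simp: N_def)
    also have "\<dots> = (\<integral>\<^sup>+x. ennreal (w x) * indicator I x * indicator (v -` C) x \<partial>lborel)"
      unfolding N_def using measurable_sets[OF v that] by (subst emeasure_density) auto
    also have "\<dots> = (\<integral>\<^sup>+x. ennreal (w x) * indicator {x\<in>I. u x \<in> C} x \<partial>lborel)"
      by (intro nn_integral_cong) (auto simp: indicator_def v_def)
    finally show ?thesis .
  qed
  have open_le: "emeasure M {a<..<b} \<le> ennreal (b - a)" if "a < b" for a b
  proof -
    define J where "J = {x\<in>I. u x \<in> {a<..<b}}"
    have J1: "open J"
      using continuous_open_preimage[OF u(1) I(1), of "{a<..<b}"] by (auto simp: J_def Int_def vimage_def)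
    have "strict_mono_on I u \<or> strict_antimono_on I u"
      using injective_eq_monotone_map[of I u] I(2) u by (simp add: is_interval_connected_1)
    then have mono: "mono_on I u \<or> antimono_on I u"
    proof (elim disjE)
      assume "strict_antimono_on I u"
      then have "u y \<le> u x" if "x \<in> I" "y \<in> I" "x \<le> y" for x y
        using that by (cases "x = y") (auto simp: monotone_on_def intro: less_imp_le)
      then show ?thesis by (auto simp: monotone_on_def)
    qed (auto intro: strict_mono_on_imp_mono_on)
    have "is_interval J"
      unfolding is_interval_1
    proof (intro ballI allI impI)
      fix p q x assume pq: "p \<in> J" "q \<in> J" "p \<le> x \<and> x \<le> q"
      have I': "x \<in> I" "p \<in> I" "q \<in> I"
        using connected_contains_Icc[OF I(2), of p q] pq by (auto simp: J_def)
      from mono have "u p \<le> u x \<and> u x \<le> u q \<or> u q \<le> u x \<and> u x \<le> u p"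
      proof (elim disjE)
        assume m: "mono_on I u"
        show ?thesis using monotone_onD[OF m, of p x] monotone_onD[OF m, of x q] pq I' by simp
      next
        assume m: "antimono_on I u"
        show ?thesis using monotone_onD[OF m, of p x] monotone_onD[OF m, of x q] pq I' by simp
      qed
      then show "x \<in> J" using pq I' by (auto simp: J_def)
    qed
    then have J2: "connected J" by (rule is_interval_connected_1[THEN iffD1])
    have "emeasure N J \<le> ennreal (b - a)"
    proof (rule emeasure_open_connected_le[OF J1 J2])
      show "sets N = sets borel" by (simp add: N_def)
      fix p q assume pq: "p \<in> J" "q \<in> J" "p \<le> q"
      have sub: "{p..q} \<subseteq> I" using connected_contains_Icc[OF I(2), of p q] pq by (auto simp: J_def)
      have "emeasure N {p..q} = (\<integral>\<^sup>+x. ennreal (w x) * indicator {p..q} x \<partial>lborel)"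
        unfolding N_def using sub
        by (subst emeasure_density; simp add: m) (auto intro!: nn_integral_cong split: split_indicator)
      also have "\<dots> \<le> ennreal \<bar>u q - u p\<bar>" using le pq by (auto simp: J_def)
      also have "\<dots> \<le> ennreal (b - a)" using pq by (intro ennreal_leI) (auto simp: J_def)
      finally show "emeasure N {p..q} \<le> ennreal (b - a)" .
    qed
    moreover have "emeasure N J = emeasure M {a<..<b}"
    proof -
      have "emeasure N J = (\<integral>\<^sup>+x. ennreal (w x) * indicator I x * indicator J x \<partial>lborel)"
        unfolding N_def using J1 m by (intro emeasure_density) auto
      also have "\<dots> = (\<integral>\<^sup>+x. ennreal (w x) * indicator {x\<in>I. u x \<in> {a<..<b}} x \<partial>lborel)"
        by (intro nn_integral_cong) (auto simp: J_def split: split_indicator)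
      also have "\<dots> = emeasure M {a<..<b}" by (rule MB[symmetric]) simp
      finally show ?thesis .
    qed
    ultimately show ?thesis by simp
  qed
  have "emeasure M B \<le> emeasure lborel B"
  proof (rule measure_le_lborel_if_intervals)
    fix a b :: real assume "a \<le> b"
    show "emeasure M {a..b} \<le> ennreal (b - a)"
    proof (rule ennreal_le_epsilon)
      fix e :: real assume "0 < e"
      have "emeasure M {a..b} \<le> emeasure M {a - e/2<..<b + e/2}"
        using \<open>0 < e\<close> by (intro emeasure_mono) (auto simp: M_def)
      also have "\<dots> \<le> ennreal ((b + e/2) - (a - e/2))"
        using \<open>0 < e\<close> \<open>a \<le> b\<close> by (intro open_le) auto
      also have "\<dots> = ennreal (b - a) + ennreal e"
        using \<open>0 < e\<close> \<open>a \<le> b\<close> by (subst ennreal_plus[symmetric]) auto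
      finally show "emeasure M {a..b} \<le> ennreal (b - a) + ennreal e" .
    qed
  qed (use B in \<open>auto simp: M_def\<close>)
  then show ?thesis using MB[OF B] by simp
qed

text \<open>Bisection replaces differentiation: the bound holds on short intervals around each point
  and is additive over adjacent ones, so it passes to the whole interval.\<close>

lemma nn_integral_inverse_square_le:
  fixes u g :: "real \<Rightarrow> real"
  assumes I: "connected I" and u: "continuous_on I u" "inj_on u I"
    and g: "continuous_on I g" "\<And>s. s \<in> I \<Longrightarrow> g s > 0"
    and K: "K \<ge> 0" and d: "d > 0"
    and le: "\<And>s s'. s \<in> I \<Longrightarrow> s' \<in> I \<Longrightarrow> \<bar>s - s'\<bar> < d \<Longrightarrow>
        2 * K * \<bar>s - s'\<bar> \<le> \<bar>u s - u s'\<bar> * (g s * g s')"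
    and ab: "a \<in> I" "b \<in> I" "a \<le> b"
  shows "(\<integral>\<^sup>+x. ennreal (K / (g x)\<^sup>2) * indicator {a..b} x \<partial>lborel) \<le> ennreal \<bar>u b - u a\<bar>"
proof -
  have sub: "{a..b} \<subseteq> I" using connected_contains_Icc[OF I ab(1,2)] .
  have "strict_mono_on I u \<or> strict_antimono_on I u"
    using injective_eq_monotone_map[of I u] I u by (simp add: is_interval_connected_1)
  \<comment> \<open>The sign of monotonicity. Without absolute values the right-hand side is
    additive, which the bisection needs.\<close>
  then obtain c :: real where c: "\<And>x y. x \<in> I \<Longrightarrow> y \<in> I \<Longrightarrow> x \<le> y \<Longrightarrow> \<bar>u y - u x\<bar> = c * (u y - u x)"
  proof (elim disjE)
    assume "strict_mono_on I u"
    then have "u x \<le> u y" if "x \<in> I" "y \<in> I" "x \<le> y" for x y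
      using that by (cases "x = y") (auto simp: monotone_on_def intro: less_imp_le)
    then show ?thesis by (intro that[of 1]) auto
  next
    assume "strict_antimono_on I u"
    then have "u y \<le> u x" if "x \<in> I" "y \<in> I" "x \<le> y" for x y
      using that by (cases "x = y") (auto simp: monotone_on_def intro: less_imp_le)
    then show ?thesis by (intro that[of "-1"]) auto
  qed
  have gm: "(\<lambda>x. ennreal (K / (g x)\<^sup>2) * indicator {p..q} x) \<in> borel_measurable borel"
    if "a \<le> p" "q \<le> b" for p q
  proof -
    have pq: "{p..q} \<subseteq> I" using sub that by auto
    then have "g x \<noteq> 0" if "x \<in> {p..q}" for x using g(2)[of x] that by auto
    then have "(\<lambda>x. indicator {p..q} x *\<^sub>R (K / (g x)\<^sup>2)) \<in> borel_measurable borel"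
      by (intro borel_measurable_continuous_on_indicator continuous_intros continuous_on_subset[OF g(1) pq]) auto
    then have "(\<lambda>x. ennreal (indicator {p..q} x *\<^sub>R (K / (g x)\<^sup>2))) \<in> borel_measurable borel" by simp
    moreover have "(\<lambda>x. ennreal (indicator {p..q} x *\<^sub>R (K / (g x)\<^sup>2))) =
        (\<lambda>x. ennreal (K / (g x)\<^sup>2) * indicator {p..q} x)"
      by (auto simp: indicator_def)
    ultimately show ?thesis by simp
  qed
  let ?P = "\<lambda>p q. a \<le> p \<longrightarrow> q \<le> b \<longrightarrow> p \<le> q \<longrightarrow>
     (\<integral>\<^sup>+x. ennreal (K / (g x)\<^sup>2) * indicator {p..q} x \<partial>lborel) \<le> ennreal (c * (u q - u p))"
  have cpos: "c * (u q - u p) \<ge> 0" if "a \<le> p" "p \<le> q" "q \<le> b" for p q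
  proof -
    have "p \<in> I" "q \<in> I" using that sub by auto
    then show ?thesis using c[of p q] that by (metis abs_ge_zero)
  qed
  have "?P a b"
  proof (rule Bolzano[where P = ?P, OF ab(3)])
    fix p q r assume 1: "?P p q" "?P q r" "p \<le> q" "q \<le> r"
    show "?P p r"
    proof (intro impI)
      assume pr: "a \<le> p" "r \<le> b" "p \<le> r"
      have "(\<integral>\<^sup>+x. ennreal (K / (g x)\<^sup>2) * indicator {p..r} x \<partial>lborel) \<le>
        (\<integral>\<^sup>+x. ennreal (K / (g x)\<^sup>2) * indicator {p..q} x + ennreal (K / (g x)\<^sup>2) * indicator {q..r} x \<partial>lborel)"
        by (intro nn_integral_mono) (auto simp: indicator_def)
      also have "\<dots> = (\<integral>\<^sup>+x. ennreal (K / (g x)\<^sup>2) * indicator {p..q} x \<partial>lborel) +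
         (\<integral>\<^sup>+x. ennreal (K / (g x)\<^sup>2) * indicator {q..r} x \<partial>lborel)"
        using gm[of p q] gm[of q r] 1 pr by (intro nn_integral_add) auto
      also have "\<dots> \<le> ennreal (c * (u q - u p)) + ennreal (c * (u r - u q))"
        using 1 pr by (intro add_mono) auto
      also have "\<dots> = ennreal (c * (u r - u p))"
        using cpos 1 pr by (subst ennreal_plus[symmetric]) (auto simp: algebra_simps)
      finally show "(\<integral>\<^sup>+x. ennreal (K / (g x)\<^sup>2) * indicator {p..r} x \<partial>lborel) \<le> ennreal (c * (u r - u p))" .
    qed
  next
    fix x assume "a \<le> x" "x \<le> b"
    then have x: "x \<in> I" using sub by auto
    define G where "G = g x"
    have G: "G > 0" using g(2)[OF x] by (simp add: G_def)
    obtain e where e: "e > 0" "\<And>y. y \<in> I \<Longrightarrow> dist y x < e \<Longrightarrow> dist (g y) G < G / 10"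
      using g(1)[unfolded continuous_on_iff, rule_format, OF x, of "G / 10"] G unfolding G_def by auto
    show "\<exists>d>0. \<forall>p q. p \<le> x \<and> x \<le> q \<and> q - p < d \<longrightarrow> ?P p q"
    proof (intro exI[of _ "min d e"] conjI allI impI)
      fix p q assume pq: "p \<le> x \<and> x \<le> q \<and> q - p < min d e" "a \<le> p" "q \<le> b" "p \<le> q"
      \<comment> \<open>The variation of g costs (11/9) ^ 2, less than the factor 2 granted in the
        hypothesis.\<close>
      have near: "9/10 * G \<le> g y \<and> g y \<le> 11/10 * G" if "p \<le> y" "y \<le> q" for y
      proof -
        have "y \<in> I" using that sub pq by auto
        then have "dist (g y) G < G / 10" using that pq by (intro e(2)) (auto simp: dist_real_def)
        then have "\<bar>g y - G\<bar> < G / 10" by (simp add: dist_real_def)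
        then show ?thesis by linarith
      qed
      have "(\<integral>\<^sup>+x. ennreal (K / (g x)\<^sup>2) * indicator {p..q} x \<partial>lborel) \<le>
        (\<integral>\<^sup>+x. ennreal (K / (9/10 * G)\<^sup>2) * indicator {p..q} x \<partial>lborel)"
      proof (intro nn_integral_mono)
        fix y
        have "K / (g y)\<^sup>2 \<le> K / (9/10 * G)\<^sup>2" if "p \<le> y" "y \<le> q"
          using near[OF that] G K by (intro divide_left_mono power_mono) (auto intro!: mult_pos_pos)
        then show "ennreal (K / (g y)\<^sup>2) * indicator {p..q} y \<le> ennreal (K / (9/10 * G)\<^sup>2) * indicator {p..q} y"
          by (auto simp: indicator_def intro: ennreal_leI)
      qed
      also have "\<dots> = ennreal (K / (9/10 * G)\<^sup>2 * (q - p))"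
        using pq K by (subst nn_integral_cmult_indicator) (auto simp: ennreal_mult[symmetric])
      also have "\<dots> \<le> ennreal \<bar>u q - u p\<bar>"
      proof (rule ennreal_leI)
        have I': "p \<in> I" "q \<in> I" using sub pq by auto
        have "2 * K * \<bar>p - q\<bar> \<le> \<bar>u p - u q\<bar> * (g p * g q)"
          using pq by (intro le I') auto
        also have "\<dots> \<le> \<bar>u p - u q\<bar> * ((11/10 * G) * (11/10 * G))"
          using near[of p] near[of q] pq G g(2)[OF I'(1)] g(2)[OF I'(2)]
          by (intro mult_left_mono mult_mono) auto
        finally have *: "2 * K * (q - p) \<le> \<bar>u p - u q\<bar> * (121/100 * G\<^sup>2)"
          using pq by (simp add: power2_eq_square)
        have "K * (q - p) \<le> \<bar>u p - u q\<bar> * (81/100 * G\<^sup>2)"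
        proof -
          have "\<bar>u p - u q\<bar> * (121/100 * G\<^sup>2) \<le> \<bar>u p - u q\<bar> * (2 * (81/100 * G\<^sup>2))"
            using G by (intro mult_left_mono) auto
          then show ?thesis using * by linarith
        qed
        then show "K / (9/10 * G)\<^sup>2 * (q - p) \<le> \<bar>u q - u p\<bar>"
          using G by (simp add: field_simps power2_eq_square abs_minus_commute)
      qed
      also have "\<bar>u q - u p\<bar> = c * (u q - u p)"
        using sub pq by (intro c) auto
      finally show "(\<integral>\<^sup>+x. ennreal (K / (g x)\<^sup>2) * indicator {p..q} x \<partial>lborel) \<le> ennreal (c * (u q - u p))" .
    qed (use d e in auto)
  qed
  then show ?thesis using c[OF ab] ab(3) by simp
qed

text \<open>With x = exp t * p s and slope u = q / p, the image of (s, t) is (x, x * u s). Fubini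
  splits this into two injective one-variable substitutions: t to x for fixed s, and s to x * u s
  for fixed x.\<close>

lemma planar_preimage_le:
  fixes p q :: "real \<Rightarrow> real"
  assumes I: "open I" "connected I"
    and p: "continuous_on I p" "\<And>s. s \<in> I \<Longrightarrow> p s > 0" and q: "continuous_on I q"
    and inj: "inj_on (\<lambda>s. q s / p s) I"
    and K: "K \<ge> 0" and d: "d > 0"
    and le: "\<And>s s'. s \<in> I \<Longrightarrow> s' \<in> I \<Longrightarrow> \<bar>s - s'\<bar> < d \<Longrightarrow>
        2 * K * \<bar>s - s'\<bar> \<le> \<bar>q s * p s' - q s' * p s\<bar>"
    and B [measurable]: "B \<in> sets borel"
  shows "ennreal K * emeasure lborel {(s, t). s \<in> I \<and> 0 < t \<and> (exp t * p s, exp t * q s) \<in> B} \<le> emeasure lborel B"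
proof -
  have [measurable]: "I \<in> sets borel" using I by simp
  define u where "u s = q s / p s" for s
  have uc: "continuous_on I u"
    unfolding u_def using p by (intro continuous_intros q) force+
  define p' u' where "p' s = indicator I s *\<^sub>R p s" and "u' s = indicator I s *\<^sub>R u s" for s
  have [measurable]: "p' \<in> borel_measurable borel" "u' \<in> borel_measurable borel"
    unfolding p'_def u'_def by (intro borel_measurable_continuous_on_indicator p uc; simp)+
  define E where "E = {(s, t). s \<in> I \<and> 0 < t \<and> (exp t * p s, exp t * q s) \<in> B}"
  have E_eq: "E = {z \<in> space (borel \<Otimes>\<^sub>M borel). fst z \<in> I \<and> 0 < snd z \<and>
      (exp (snd z) * p' (fst z), exp (snd z) * p' (fst z) * u' (fst z)) \<in> B}"
  proof -
    have "p s * u s = q s" if "s \<in> I" for s using p(2)[OF that] by (simp add: u_def)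
    then show ?thesis by (auto simp: E_def p'_def u'_def space_pair_measure mult.assoc)
  qed
  have B2 [measurable]: "B \<in> sets (borel \<Otimes>\<^sub>M borel)" using B unfolding borel_prod .
  have E [measurable]: "E \<in> sets (borel \<Otimes>\<^sub>M borel)"
    unfolding E_eq by measurable
  \<comment> \<open>Density in (s, x) after t has been traded for x; K * x / p ^ 2 is the rate at
    which s moves x * u s.\<close>
  define \<Phi> where "\<Phi> = (\<lambda>s x. ennreal (K * x / (p' s)\<^sup>2) * indicator I s * indicator {0<..} x * indicator B (x, x * u' s))"
  have [measurable]: "(\<lambda>(s, x). \<Phi> s x) \<in> borel_measurable (borel \<Otimes>\<^sub>M borel)"
    unfolding \<Phi>_def by measurable
  have "ennreal K * emeasure lborel E = (\<integral>\<^sup>+s. ennreal K * emeasure lborel (Pair s -` E) \<partial>lborel)"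
  proof -
    have E': "E \<in> sets (lborel \<Otimes>\<^sub>M lborel)" using E by simp
    have "emeasure lborel E = (\<integral>\<^sup>+s. emeasure lborel (Pair s -` E) \<partial>lborel)"
      unfolding lborel_prod[symmetric] by (rule lborel.emeasure_pair_measure_alt[OF E'])
    moreover have "(\<lambda>s. emeasure lborel (Pair s -` E)) \<in> borel_measurable lborel"
      by (rule lborel.measurable_emeasure_Pair[OF E'])
    ultimately show ?thesis by (simp add: nn_integral_cmult)
  qed
  also have "\<dots> \<le> (\<integral>\<^sup>+s. \<integral>\<^sup>+x. \<Phi> s x \<partial>lborel \<partial>lborel)"
  proof (intro nn_integral_mono)
    fix s
    show "ennreal K * emeasure lborel (Pair s -` E) \<le> (\<integral>\<^sup>+x. \<Phi> s x \<partial>lborel)"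
    proof (cases "s \<in> I")
      case False
      then have "Pair s -` E = {}" by (auto simp: E_def)
      then show ?thesis by simp
    next
      case True
      define a where "a = p s"
      have a: "a > 0" "p' s = a" using p(2)[OF True] True by (auto simp: a_def p'_def)
      have au: "q s = a * u s" "u' s = u s" using a True by (auto simp: u_def a_def u'_def)
      define C where "C = {x. a < x \<and> (x, x * u s) \<in> B}"
      have C: "C \<in> sets borel" unfolding C_def by measurable
      have "(\<integral>\<^sup>+t. ennreal a * indicator {t \<in> {0<..}. a * exp t \<in> C} t \<partial>lborel) \<le> emeasure lborel C"
      proof (rule nn_integral_preimage_le)
        show "inj_on (\<lambda>t. a * exp t) {0<..}" using a by (auto simp: inj_on_def)
        fix b c :: real assume bc: "b \<in> {0<..}" "c \<in> {0<..}" "b \<le> c"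
        have "exp b * (1 + (c - b)) \<le> exp b * exp (c - b)"
          by (intro mult_left_mono exp_ge_add_one_self) simp
        then have "exp b * (c - b) \<le> exp c - exp b" by (simp add: exp_diff algebra_simps)
        moreover have "1 * (c - b) \<le> exp b * (c - b)"
          using bc by (intro mult_right_mono) auto
        ultimately have "1 * (c - b) \<le> exp c - exp b" by (rule order_trans[rotated])
        then have "c - b \<le> exp c - exp b" by simp
        then have "a * (c - b) \<le> \<bar>a * exp c - a * exp b\<bar>"
          using a mult_left_mono[of "c - b" "exp c - exp b" a] by (simp add: right_diff_distrib)
        then show "(\<integral>\<^sup>+x. ennreal a * indicator {b..c} x \<partial>lborel) \<le> ennreal \<bar>a * exp c - a * exp b\<bar>"
          using bc a by (simp add: nn_integral_cmult_indicator ennreal_mult[symmetric] ennreal_leI)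
      qed (auto intro!: continuous_intros C)
      also have "{t \<in> {0<..}. a * exp t \<in> C} = Pair s -` E"
        using True a by (auto simp: E_def C_def au a_def[symmetric] mult_ac)
      finally have 1: "ennreal a * emeasure lborel (Pair s -` E) \<le> emeasure lborel C"
        using E by (subst (asm) nn_integral_cmult_indicator) (auto intro: sets_Pair1)
      have "ennreal K * emeasure lborel (Pair s -` E) = ennreal (K / a) * (ennreal a * emeasure lborel (Pair s -` E))"
        using a K by (simp add: mult.assoc[symmetric] ennreal_mult[symmetric])
      also have "\<dots> \<le> ennreal (K / a) * emeasure lborel C"
        by (intro mult_left_mono 1) auto
      also have "\<dots> = (\<integral>\<^sup>+x. ennreal (K / a) * indicator C x \<partial>lborel)"
        using C by (simp add: nn_integral_cmult_indicator)
      also have "\<dots> \<le> (\<integral>\<^sup>+x. \<Phi> s x \<partial>lborel)"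
      proof (intro nn_integral_mono)
        fix x
        \<comment> \<open>Here the condition 0 < t enters, in the form x > p s.\<close>
        have "K / a \<le> K * x / a\<^sup>2" if "x > a"
          using that a K by (simp add: field_simps power2_eq_square mult_left_mono)
        then show "ennreal (K / a) * indicator C x \<le> \<Phi> s x"
          using a True by (auto simp: \<Phi>_def indicator_def C_def au intro: ennreal_leI)
      qed
      finally show ?thesis .
    qed
  qed
  also have "\<dots> = (\<integral>\<^sup>+x. \<integral>\<^sup>+s. \<Phi> s x \<partial>lborel \<partial>lborel)"
    by (rule lborel_pair.Fubini'[symmetric]) measurable
  also have "\<dots> \<le> (\<integral>\<^sup>+x. emeasure lborel (Pair x -` B) \<partial>lborel)"
  proof (intro nn_integral_mono)
    fix x
    show "(\<integral>\<^sup>+s. \<Phi> s x \<partial>lborel) \<le> emeasure lborel (Pair x -` B)"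
    proof (cases "x > 0")
      case False
      then show ?thesis by (simp add: \<Phi>_def)
    next
      case True
      have BC: "Pair x -` B \<in> sets borel" using sets_Pair1[OF B2] .
      have "(\<integral>\<^sup>+s. \<Phi> s x \<partial>lborel) = (\<integral>\<^sup>+s. ennreal (x * K / (p s)\<^sup>2) * indicator {s \<in> I. x * u s \<in> Pair x -` B} s \<partial>lborel)"
        using True by (intro nn_integral_cong) (auto simp: \<Phi>_def p'_def u'_def indicator_def mult.commute)
      also have "\<dots> \<le> emeasure lborel (Pair x -` B)"
      proof (rule nn_integral_preimage_le[OF I _ _ _ _ BC])
        show c: "continuous_on I (\<lambda>s. x * u s)" by (intro continuous_intros uc)
        show i: "inj_on (\<lambda>s. x * u s) I"
        proof (rule inj_onI)
          fix a b assume "a \<in> I" "b \<in> I" "x * u a = x * u b"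
          moreover from this have "u a = u b" using True by (simp only: mult_cancel_left) simp
          ultimately show "a = b" using inj by (auto simp: inj_on_def u_def)
        qed
        show "continuous_on I (\<lambda>s. x * K / (p s)\<^sup>2)"
          using p by (intro continuous_intros) force+
        fix a b assume ab: "a \<in> I" "b \<in> I" "a \<le> b"
        show "(\<integral>\<^sup>+s. ennreal (x * K / (p s)\<^sup>2) * indicator {a..b} s \<partial>lborel) \<le> ennreal \<bar>x * u b - x * u a\<bar>"
        proof (rule nn_integral_inverse_square_le[OF I(2) c i p _ d _ ab])
          fix s s' assume s: "s \<in> I" "s' \<in> I" "\<bar>s - s'\<bar> < d"
          have "u s - u s' = (q s * p s' - q s' * p s) / (p s * p s')"
            using p(2)[OF s(1)] p(2)[OF s(2)] by (simp add: u_def field_simps)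
          then have "\<bar>u s - u s'\<bar> * (p s * p s') = \<bar>q s * p s' - q s' * p s\<bar>"
            using p(2)[OF s(1)] p(2)[OF s(2)] by (simp add: abs_mult)
          moreover have "\<bar>x * u s - x * u s'\<bar> = x * \<bar>u s - u s'\<bar>"
            using True by (simp flip: right_diff_distrib add: abs_mult)
          ultimately show "2 * (x * K) * \<bar>s - s'\<bar> \<le> \<bar>x * u s - x * u s'\<bar> * (p s * p s')"
            using mult_left_mono[OF le[OF s], of x] True by (simp add: mult_ac)
        qed (use True K in auto)
      qed
      finally show ?thesis .
    qed
  qed
  also have "\<dots> = emeasure lborel B"
    unfolding lborel_prod[symmetric] by (rule lborel.emeasure_pair_measure_alt[symmetric]) (use B2 in simp)
  finally show ?thesis by (simp add: E_def)
qed

section \<open>Images of neighbourhoods of axial points\<close>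

context zorich_surface
begin

text \<open>Beams of opposite parity reach both half-spaces, and since \<open>norm h\<close> lies
  between m and 1, the norm of the target confines the height of its preimage.\<close>

lemma shell_in_image:
  assumes W: "\<And>x. x \<in> beam k l \<union> beam k' l' \<Longrightarrow> a \<le> x $ 3 \<Longrightarrow> x $ 3 \<le> b \<Longrightarrow> x \<in> W"
    and par: "odd (k + l + (k' + l'))" and w: "lam * exp a \<le> norm w" "norm w \<le> lam * m * exp b"
  shows "w \<in> f ` W"
proof -
  have "lam * exp a > 0" using lam_pos by simp
  then have w0: "w \<noteq> 0" using w(1) by auto
  have "parity (k' + l') = - parity (k + l)" using par by (auto simp: parity_def)
  then have "parity (k + l) * w $ 3 \<ge> 0 \<or> parity (k' + l') * w $ 3 \<ge> 0" by auto
  then obtain y where y: "y \<in> beam k l \<union> beam k' l'" "f y = w"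
    using beam_surj[OF w0] by blast
  have "lam * exp a \<le> lam * exp (y $ 3)" using norm_f_le[of y] w(1) y(2) by (simp add: mult.commute)
  then have "a \<le> y $ 3" using lam_pos by simp
  moreover have "lam * m * exp (y $ 3) \<le> lam * m * exp b"
    using norm_f_ge[of y] w(2) y(2) by (simp add: mult_ac)
  then have "y $ 3 \<le> b" using lam_pos m_pos by simp
  ultimately show ?thesis using W y by blast
qed

lemma open_image_f:
  assumes "open V"
  shows "open (f ` V)"
proof -
  obtain c where c: "c > 0" "\<And>x r. 0 < r \<Longrightarrow> r \<le> 2 * lam \<Longrightarrow> ball (f x) (c * exp (x $ 3) * r) \<subseteq> f ` ball x r"
    using ball_covering by blast
  show ?thesis
    unfolding open_contains_ball
  proof
    fix w assume "w \<in> f ` V"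
    then obtain x where x: "x \<in> V" "w = f x" by blast
    obtain e where e: "e > 0" "ball x e \<subseteq> V" using openE[OF assms x(1)] by blast
    define r where "r = min e (2 * lam)"
    have r: "0 < r" "r \<le> 2 * lam" "r \<le> e" using e lam_pos by (auto simp: r_def)
    have "ball w (c * exp (x $ 3) * r) \<subseteq> f ` ball x r" using c(2)[OF r(1,2), of x] x(2) by simp
    also have "\<dots> \<subseteq> f ` V" using e(2) r(3) subset_ball[of r e x] by blast
    finally show "\<exists>e>0. ball w e \<subseteq> f ` V" using c(1) r(1) by (intro exI[of _ "c * exp (x $ 3) * r"]) auto
  qed
qed

lemma open_iterate_image: "open V \<Longrightarrow> open ((f ^^ n) ` V)"
proof (induction n)
  case (Suc n)
  have "(f ^^ Suc n) ` V = f ` (f ^^ n) ` V" by (simp add: image_comp)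
  then show ?case using open_image_f Suc by simp
qed simp

text \<open>Each step multiplies the radius by c * exp (t n), eventually at least 2, up to the
  ceiling 2 * lam of \<open>ball_covering\<close>. One more step from that ceiling gives radius 2 *
  c * lam * exp (t n) = 2 * c * t (Suc n), proportional to the height.\<close>

lemma axis_orbit_balls:
  fixes V :: "(real^3) set" and t :: "nat \<Rightarrow> real"
  assumes V: "open V" "vector [0, 0, t 0] \<in> V" and t0: "t 0 \<ge> 0"
    and tS: "\<And>n. t (Suc n) = lam * exp (t n)"
  obtains d N where "0 < d" "d \<le> 1 / 2"
    "\<And>n. n \<ge> N \<Longrightarrow> ball (vector [0, 0, t n]) (2 * d * t n) \<subseteq> (f ^^ n) ` V"
proof -
  obtain c where c: "c > 0" "\<And>x r. 0 < r \<Longrightarrow> r \<le> 2 * lam \<Longrightarrow> ball (f x) (c * exp (x $ 3) * r) \<subseteq> f ` ball x r"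
    using ball_covering by blast
  define z where "z n = (vector [0, 0, t n] :: real^3)" for n
  have z3: "z n $ 3 = t n" for n by (simp add: z_def)
  have fz: "f (z n) = z (Suc n)" for n
    using f_central_axis[of "z n"] by (simp add: pdist_def norm_real2 z_def tS)
  have t_ge: "t n \<ge> real n" for n
  proof (induction n)
    case (Suc n)
    have "1 * exp (t n) \<le> lam * exp (t n)" using lam_ge_1 by (intro mult_right_mono) auto
    then show ?case using exp_ge_add_one_self[of "t n"] Suc tS[of n] by linarith
  qed (use t0 in simp)
  have step: "ball (z (Suc n)) (c * exp (t n) * r) \<subseteq> (f ^^ Suc n) ` V"
    if "ball (z n) r \<subseteq> (f ^^ n) ` V" "0 < r" "r \<le> 2 * lam" for n r
  proof -
    have "ball (z (Suc n)) (c * exp (t n) * r) \<subseteq> f ` ball (z n) r"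
      using c(2)[OF that(2,3), of "z n"] by (simp add: fz z3)
    also have "\<dots> \<subseteq> f ` (f ^^ n) ` V" using that(1) by (rule image_mono)
    finally show ?thesis by (simp add: image_comp)
  qed
  obtain n1 :: nat where n1: "ln (2 / c) \<le> real n1" using real_arch_simple by blast
  have double: "2 \<le> c * exp (t n)" if "n \<ge> n1" for n
  proof -
    have "ln (2 / c) \<le> t n" using t_ge[of n] n1 that by simp
    then have "2 / c \<le> exp (t n)" using c(1) by (metis divide_pos_pos exp_le_cancel_iff exp_ln zero_less_numeral)
    then show ?thesis using c(1) by (simp add: field_simps)
  qed
  have zn: "z n \<in> (f ^^ n) ` V" for n
  proof (induction n)
    case 0 then show ?case using V(2) by (simp add: z_def)
  next
    case (Suc n)
    then have "f (z n) \<in> f ` (f ^^ n) ` V" by blast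
    then show ?case by (simp add: fz image_comp)
  qed
  obtain r1 where r1: "r1 > 0" "ball (z n1) r1 \<subseteq> (f ^^ n1) ` V"
    using openE[OF open_iterate_image[OF V(1)] zn[of n1]] by blast
  have grow: "ball (z (n1 + k)) (min (2 * lam) (2 ^ k * r1)) \<subseteq> (f ^^ (n1 + k)) ` V" for k
  proof (induction k)
    case 0
    have "ball (z n1) (min (2 * lam) r1) \<subseteq> ball (z n1) r1" by (rule subset_ball) simp
    then show ?case using r1(2) by auto
  next
    case (Suc k)
    define r where "r = min (2 * lam) (2 ^ k * r1)"
    have r: "0 < r" "r \<le> 2 * lam" using r1(1) lam_pos by (auto simp: r_def)
    have "min (2 * lam) (2 ^ Suc k * r1) \<le> 2 * r" using lam_pos by (auto simp: r_def min_def)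
    also have "\<dots> \<le> c * exp (t (n1 + k)) * r" using double[of "n1 + k"] r(1) by (intro mult_right_mono) auto
    finally have "ball (z (Suc (n1 + k))) (min (2 * lam) (2 ^ Suc k * r1)) \<subseteq>
        ball (z (Suc (n1 + k))) (c * exp (t (n1 + k)) * r)" by (rule subset_ball)
    also have "\<dots> \<subseteq> (f ^^ Suc (n1 + k)) ` V"
      using step[OF Suc.IH[folded r_def] r] .
    finally show ?case by simp
  qed
  obtain K where K: "2 * lam / r1 < 2 ^ K" using real_arch_pow[of 2] by auto
  \<comment> \<open>The cap 1 / 2 keeps heights t * (1 - d) above t / 2 in
    \<open>large_ball_covers\<close>.\<close>
  define d where "d = min c (1 / 2)"
  have d: "0 < d" "d \<le> 1 / 2" "d \<le> c" using c(1) by (auto simp: d_def)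
  show ?thesis
  proof (rule that[OF d(1,2), of "Suc (n1 + K)"])
    fix n assume n: "n \<ge> Suc (n1 + K)"
    define k where "k = n - 1 - n1"
    have nk: "n = Suc (n1 + k)" "K \<le> k" using n by (auto simp: k_def)
    have "(2::real) ^ K \<le> 2 ^ k" using nk(2) by (intro power_increasing) auto
    then have "2 * lam / r1 < 2 ^ k" using K by linarith
    then have "2 * lam \<le> 2 ^ k * r1" using r1(1) by (simp add: field_simps)
    then have "ball (z (n1 + k)) (2 * lam) \<subseteq> (f ^^ (n1 + k)) ` V" using grow[of k] by (simp add: min_def)
    from step[OF this] have "ball (z n) (c * exp (t (n1 + k)) * (2 * lam)) \<subseteq> (f ^^ n) ` V"
      using lam_pos nk(1) by simp
    moreover have "2 * d * t n \<le> c * exp (t (n1 + k)) * (2 * lam)"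
    proof -
      have "d * (lam * exp (t (n1 + k))) \<le> c * (lam * exp (t (n1 + k)))"
        using d(3) lam_pos by (intro mult_right_mono) auto
      then show ?thesis using tS[of "n1 + k"] nk(1) by (simp add: mult_ac)
    qed
    ultimately show "ball (vector [0, 0, t n]) (2 * d * t n) \<subseteq> (f ^^ n) ` V"
      using subset_ball unfolding z_def by (meson order_trans)
  qed
qed

text \<open>The ball contains pieces of two neighbouring beams with heights t * (1 - d) to t * (1 +
  d), so its image contains a shell of huge radius ratio. That shell contains two neighbouring beam
  pieces with very low and very high points, whose image is a shell around 0 that contains
  \<open>w\<close>.\<close>

lemma large_ball_covers:
  assumes d: "0 < d" "d \<le> 1 / 2" and w: "w \<noteq> 0"
  obtains R where "\<And>t W. t \<ge> R \<Longrightarrow> ball (vector [0, 0, t] :: real^3) (2 * d * t) \<subseteq> W \<Longrightarrow> w \<in> f ` f ` W"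
proof -
  \<comment> \<open>In order: the ball contains both beam pieces, R2 is at least 4 * R1, R1 is at
    least 7 * lam, and the inner and the outer radius of the second shell enclose
    \<open>norm w\<close>.\<close>
  define R where "R = max (max (8 * lam / d) (ln (4 / m) / (2 * d)))
    (max (2 * ln 7) (max (2 * ln (lam / norm w) / (lam * m)) (2 * ln (norm w / (lam * m)) / (lam * m))))"
  show ?thesis
  proof (rule that[of R])
    fix t W assume t: "t \<ge> R" and W: "ball (vector [0, 0, t] :: real^3) (2 * d * t) \<subseteq> W"
    have tt: "8 * lam / d \<le> t" "ln (4 / m) / (2 * d) \<le> t" "2 * ln 7 \<le> t"
      "2 * ln (lam / norm w) / (lam * m) \<le> t" "2 * ln (norm w / (lam * m)) / (lam * m) \<le> t"
      using t unfolding R_def by (meson max.bounded_iff)+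
    have "8 * lam / d > 0" using d lam_pos by simp
    then have t0: "t > 0" using tt(1) by linarith
    define R1 R2 where "R1 = lam * exp (t * (1 - d))" and "R2 = lam * m * exp (t * (1 + d))"
    have shell: "v \<in> f ` W" if v: "R1 \<le> norm v" "norm v \<le> R2" for v
    proof (rule shell_in_image[of 0 0 1 0 "t * (1 - d)" "t * (1 + d)"])
      fix x assume x: "x \<in> beam 0 0 \<union> beam 1 0" "t * (1 - d) \<le> x $ 3" "x $ 3 \<le> t * (1 + d)"
      have b: "\<bar>x $ 1\<bar> \<le> 3 * lam" "\<bar>x $ 2\<bar> \<le> lam" using x(1) lam_pos by (auto simp: beam_def abs_le_iff)
      have b3: "\<bar>x $ 3 - t\<bar> \<le> d * t" using x(2,3) by (simp add: abs_le_iff algebra_simps)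
      have "norm (x - vector [0, 0, t]) \<le> \<bar>x $ 1\<bar> + \<bar>x $ 2\<bar> + \<bar>x $ 3 - t\<bar>"
        using norm_le_abs_sum_real3[of "x - vector [0, 0, t]"] by simp
      also have "\<dots> \<le> 4 * lam + d * t" using b b3 by linarith
      also have "\<dots> < 2 * d * t" using tt(1) d lam_pos by (simp add: field_simps)
      finally show "x \<in> W" using W by (auto simp: dist_norm norm_minus_commute)
    qed (use v in \<open>auto simp: R1_def R2_def\<close>)
    have e1: "4 / m \<le> exp (2 * d * t)"
    proof -
      have "ln (4 / m) \<le> 2 * d * t" using tt(2) d by (simp add: field_simps)
      then have "exp (ln (4 / m)) \<le> exp (2 * d * t)" by simp
      then show ?thesis using m_pos by simp
    qed
    have e2: "7 \<le> exp (t * (1 - d))"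
    proof -
      have "t * (1 / 2) \<le> t * (1 - d)" using d t0 by (intro mult_left_mono) auto
      then have "ln 7 \<le> t * (1 - d)" using tt(3) by simp
      then have "exp (ln 7) \<le> exp (t * (1 - d))" by (simp only: exp_le_cancel_iff)
      then show ?thesis by simp
    qed
    have "exp (t * (1 + d)) = exp (t * (1 - d)) * exp (2 * d * t)"
      by (simp flip: exp_add add: algebra_simps)
    then have "R2 = m * exp (2 * d * t) * R1" by (simp add: R1_def R2_def)
    moreover have "4 * R1 \<le> m * exp (2 * d * t) * R1"
      using e1 m_pos lam_pos by (intro mult_right_mono) (auto simp: R1_def field_simps)
    ultimately have R12: "4 * R1 \<le> R2" by simp
    have R1: "R1 \<ge> 7 * lam" using e2 lam_pos by (simp add: R1_def)
    have R2t: "R2 \<ge> lam * m * t"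
    proof -
      have "t * 1 \<le> t * (1 + d)" using d t0 by (intro mult_left_mono) auto
      moreover have "t * (1 + d) + 1 \<le> exp (t * (1 + d))" using exp_ge_add_one_self[of "t * (1 + d)"] by (simp only: add.commute)
      ultimately have "t \<le> exp (t * (1 + d))" by linarith
      then show ?thesis unfolding R2_def using lam_pos m_pos by (intro mult_left_mono) auto
    qed
    \<comment> \<open>Beams \<open>k\<close> and \<open>k + 1\<close> start just outside radius R1
      and end before R1 + 6 * lam, well inside the shell.\<close>
    define k where "k = \<lceil>(R1 + lam) / (2 * lam)\<rceil>"
    have k: "R1 + lam \<le> 2 * real_of_int k * lam" "2 * real_of_int k * lam \<le> R1 + 3 * lam"
    proof -
      have "(R1 + lam) / (2 * lam) \<le> real_of_int k" "real_of_int k \<le> (R1 + lam) / (2 * lam) + 1"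
        unfolding k_def by linarith+
      then show "R1 + lam \<le> 2 * real_of_int k * lam" "2 * real_of_int k * lam \<le> R1 + 3 * lam"
        using lam_pos by (simp_all add: field_simps)
    qed
    show "w \<in> f ` f ` W"
    proof (rule shell_in_image[of k 0 "k + 1" 0 "- (R2 / 2)" "R2 / 2"])
      fix x assume x: "x \<in> beam k 0 \<union> beam (k + 1) 0" "- (R2 / 2) \<le> x $ 3" "x $ 3 \<le> R2 / 2"
      have x1: "R1 \<le> x $ 1" "x $ 1 \<le> R1 + 6 * lam" and x2: "\<bar>x $ 2\<bar> \<le> lam"
        using x(1) k lam_pos by (auto simp: beam_def abs_le_iff algebra_simps)
      show "x \<in> f ` W"
      proof (rule shell)
        show "R1 \<le> norm x" using x1(1) component_le_norm_cart[of x 1] by linarith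
        have "\<bar>x $ 1\<bar> \<le> R1 + 6 * lam" "\<bar>x $ 3\<bar> \<le> R2 / 2" using x1 R1 lam_pos x(2,3) by auto
        then show "norm x \<le> R2" using norm_le_abs_sum_real3[of x] x2 R1 R12 by linarith
      qed
    next
      have nw: "norm w > 0" using w by simp
      have lm: "lam * m > 0" using lam_pos m_pos by simp
      have "ln (lam / norm w) \<le> lam * m * t / 2" using tt(4) lm by (simp add: field_simps)
      then have "ln (lam / norm w) \<le> R2 / 2" using R2t by linarith
      then have "exp (ln (lam / norm w)) \<le> exp (R2 / 2)" by (simp only: exp_le_cancel_iff)
      moreover have "exp (ln (lam / norm w)) = lam / norm w" by (rule exp_ln) (use nw lam_pos in simp)
      ultimately have "lam / norm w \<le> exp (R2 / 2)" by simp
      then show "lam * exp (- (R2 / 2)) \<le> norm w" using nw by (simp add: exp_minus field_simps)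
      have "ln (norm w / (lam * m)) \<le> lam * m * t / 2" using tt(5) lm by (simp add: field_simps)
      then have "ln (norm w / (lam * m)) \<le> R2 / 2" using R2t by linarith
      then have "exp (ln (norm w / (lam * m))) \<le> exp (R2 / 2)" by (simp only: exp_le_cancel_iff)
      moreover have "exp (ln (norm w / (lam * m))) = norm w / (lam * m)" by (rule exp_ln) (use nw lm in simp)
      ultimately have "norm w / (lam * m) \<le> exp (R2 / 2)" by simp
      then show "norm w \<le> lam * m * exp (R2 / 2)" using lm by (simp add: field_simps)
    qed auto
  qed
qed

text \<open>Two steps reach the positive half of the axis: the first image lies on the axis at a
  height of either sign, and the central beam is not reflected.\<close>

lemma axis_point_covers:
  assumes V: "open V" "x \<in> V" "axdist x = 0" and w: "w \<noteq> 0"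
  shows "\<exists>n\<ge>1. w \<in> (f ^^ n) ` V"
proof -
  define t where "t = rec_nat (lam * exp (f x $ 3)) (\<lambda>_ s. lam * exp s)"
  have t: "t 0 = lam * exp (f x $ 3)" "\<And>n. t (Suc n) = lam * exp (t n)" by (simp_all add: t_def)
  have z0: "f (f x) = vector [0, 0, t 0]"
    using f_central_axis[OF f_axis(1)[OF V(3)]] by (simp add: t)
  define V' where "V' = (f ^^ 2) ` V"
  have "vector [0, 0, t 0] \<in> V'"
    using V(2) z0 unfolding V'_def by (intro image_eqI[of _ _ x]) (simp_all add: numeral_2_eq_2)
  moreover have "open V'" unfolding V'_def by (rule open_iterate_image[OF V(1)])
  moreover have "t 0 \<ge> 0" using lam_pos by (simp add: t)
  ultimately obtain d N where d: "0 < d" "d \<le> 1 / 2"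
    and ball: "\<And>n. n \<ge> N \<Longrightarrow> ball (vector [0, 0, t n]) (2 * d * t n) \<subseteq> (f ^^ n) ` V'"
    using axis_orbit_balls[of V' t] t(2) by metis
  obtain R where R: "\<And>s W. s \<ge> R \<Longrightarrow> ball (vector [0, 0, s]) (2 * d * s) \<subseteq> W \<Longrightarrow> w \<in> f ` f ` W"
    using large_ball_covers[OF d w] by blast
  have t_ge: "t n \<ge> real n" for n
  proof (induction n)
    case 0 show ?case using lam_pos by (simp add: t)
  next
    case (Suc n)
    have "1 * exp (t n) \<le> lam * exp (t n)" using lam_ge_1 by (intro mult_right_mono) auto
    then show ?case using exp_ge_add_one_self[of "t n"] Suc t(2)[of n] by linarith
  qed
  obtain n :: nat where n: "R \<le> real n" using real_arch_simple by blast
  define k where "k = max n N"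
  have "t k \<ge> R" using t_ge[of k] n by (simp add: k_def)
  then have "w \<in> f ` f ` (f ^^ k) ` V'" using R ball[of k] by (simp add: k_def)
  also have "f ` f ` (f ^^ k) ` V' = (f ^^ (Suc (Suc (k + 2)))) ` V"
    unfolding V'_def by (simp only: funpow.simps(2) funpow_add image_comp o_assoc)
  finally show ?thesis by (intro exI[of _ "Suc (Suc (k + 2))"]) auto
qed

text \<open>As long as the images of a neighbourhood of \<open>x\<close> miss the preimages of the axis, the inscribed balls
  have radius at most \<open>axdist \<le> 2 * lam\<close>, which bounds the accumulated expansion.\<close>
lemma expansion_bounded:
  obtains c where "\<And>U x. open U \<Longrightarrow> x \<in> U \<Longrightarrow> (\<And>n y. y \<in> U \<Longrightarrow> axdist ((f ^^ n) y) \<noteq> 0) \<Longrightarrow>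
    \<exists>B. \<forall>n. (\<Sum>j<n. ((f ^^ j) x) $ 3 + c) \<le> B"
proof -
  obtain c where c: "c > 0" "\<And>x r. 0 < r \<Longrightarrow> r \<le> 2 * lam \<Longrightarrow> ball (f x) (c * exp (x $ 3) * r) \<subseteq> f ` ball x r"
    using ball_covering by blast
  show ?thesis
  proof (rule that[of "ln c"])
    fix U x assume U: "open U" "x \<in> U" and ax: "\<And>n y. y \<in> U \<Longrightarrow> axdist ((f ^^ n) y) \<noteq> 0"
    obtain r where r: "r > 0" "ball x r \<subseteq> U" using openE[OF U] by blast
    define S where "S n = (\<Sum>j<n. ((f ^^ j) x) $ 3 + ln c)" for n
    have le: "s \<le> 2 * lam" if sub: "ball ((f ^^ n) x) s \<subseteq> (f ^^ n) ` U" for n s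
    proof (rule ccontr)
      assume "\<not> s \<le> 2 * lam"
      obtain y where y: "axdist y = 0" "dist ((f ^^ n) x) y = axdist ((f ^^ n) x)" using axdist_nearest by blast
      then have "y \<in> ball ((f ^^ n) x) s" using axdist_le[of "(f ^^ n) x"] \<open>\<not> s \<le> 2 * lam\<close> by simp
      then obtain u where "u \<in> U" "y = (f ^^ n) u" using sub by blast
      then show False using ax[of u n] y(1) by simp
    qed
    have balls: "ball ((f ^^ n) x) (r * exp (S n)) \<subseteq> (f ^^ n) ` U" for n
    proof (induction n)
      case 0 then show ?case using r(2) by (simp add: S_def)
    next
      case (Suc n)
      have eq: "r * exp (S (Suc n)) = c * exp (((f ^^ n) x) $ 3) * (r * exp (S n))"
        using c(1) by (simp add: S_def exp_add)
      have "ball (f ((f ^^ n) x)) (c * exp (((f ^^ n) x) $ 3) * (r * exp (S n))) \<subseteq>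
          f ` ball ((f ^^ n) x) (r * exp (S n))"
        by (rule c(2)[OF _ le[OF Suc.IH]]) (use r(1) in simp)
      then have "ball ((f ^^ Suc n) x) (r * exp (S (Suc n))) \<subseteq> f ` ball ((f ^^ n) x) (r * exp (S n))"
        by (simp only: eq funpow.simps(2) o_apply)
      also have "\<dots> \<subseteq> f ` (f ^^ n) ` U" using Suc.IH by (rule image_mono)
      finally show ?case by (simp add: image_comp)
    qed
    have "S n \<le> ln (2 * lam / r)" for n
    proof -
      have "r * exp (S n) \<le> 2 * lam" using le[OF balls] .
      then have "exp (S n) \<le> 2 * lam / r" using r(1) by (simp add: field_simps)
      then show ?thesis using r(1) lam_pos by (subst ln_ge_iff) auto
    qed
    then show "\<exists>B. \<forall>n. (\<Sum>j<n. ((f ^^ j) x) $ 3 + ln c) \<le> B" by (auto simp: S_def)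
  qed
qed

end

section \<open>Expansion of the weighted volume\<close>

text \<open>Both eigenvalues of the form are at least \<open>\<mu>\<close>. The proof subtracts
  \<open>\<mu>\<close> times the identity and uses the discriminant of the remaining nonnegative
  form.\<close>

lemma form_ge_imp_det_ge:
  fixes A B C \<mu> :: real
  assumes \<mu>: "\<mu> \<ge> 0" and ge: "\<And>s t. A * s\<^sup>2 + 2 * B * s * t + C * t\<^sup>2 \<ge> \<mu> * (s\<^sup>2 + t\<^sup>2)"
  shows "A * C - B\<^sup>2 \<ge> \<mu>\<^sup>2"
proof -
  have A: "A \<ge> \<mu>" and C: "C \<ge> \<mu>" using ge[of 1 0] ge[of 0 1] by simp_all
  have disc: "(A - \<mu>) * (C - \<mu>) \<ge> B\<^sup>2"
  proof (cases "A = \<mu>")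
    case True
    have "B = 0"
    proof (rule ccontr)
      assume "B \<noteq> 0"
      define s where "s = - (C - \<mu> + 1) / (2 * B)"
      have "2 * B * s = - (C - \<mu> + 1)" using \<open>B \<noteq> 0\<close> by (simp add: s_def)
      then show False using ge[of s 1] True by (simp add: algebra_simps)
    qed
    then show ?thesis using True by simp
  next
    case False
    have "(A - \<mu>) * ((A - \<mu>) * (C - \<mu>) - B\<^sup>2) \<ge> 0"
      using ge[of B "- (A - \<mu>)"] by (simp add: power2_eq_square algebra_simps)
    then have "(A - \<mu>) * (C - \<mu>) - B\<^sup>2 \<ge> 0"
      using A False by (simp add: zero_le_mult_iff)
    then show ?thesis by simp
  qed
  have "\<mu> * \<mu> \<le> \<mu> * A" "\<mu> * \<mu> \<le> \<mu> * C" using A C \<mu> by (auto intro: mult_left_mono)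
  then show ?thesis using disc by (simp add: power2_eq_square algebra_simps)
qed

lemma det_vector_square:
  fixes a b z :: "real^3"
  shows "(det (vector [a, b, z] :: real^3^3))\<^sup>2 =
    (z \<bullet> z) * ((a \<bullet> a) * (b \<bullet> b) - (a \<bullet> b)\<^sup>2) -
    ((a \<bullet> z)\<^sup>2 * (b \<bullet> b) - 2 * (a \<bullet> z) * (b \<bullet> z) * (a \<bullet> b) + (b \<bullet> z)\<^sup>2 * (a \<bullet> a))"
  by (simp add: det_3 inner_real3 power2_eq_square) algebra

text \<open>The determinant is the area spanned by a and b times the distance of z from their plane.
  The area is at least 1 / L ^ 2, and \<open>angle\<close> limits the projection of z to cos
  \<open>\<theta>\<close> times its length.\<close>

lemma det_lower_bound:
  fixes a b z :: "real^3" and L m \<theta> :: real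
  assumes L: "L > 0" and m: "m > 0" "m \<le> norm z" and sin: "0 \<le> sin \<theta>"
    and lower: "\<And>s t. sqrt (s\<^sup>2 + t\<^sup>2) / L \<le> norm (s *\<^sub>R a + t *\<^sub>R b)"
    and angle: "\<And>s t. \<bar>z \<bullet> (s *\<^sub>R a + t *\<^sub>R b)\<bar> \<le> cos \<theta> * (norm z * norm (s *\<^sub>R a + t *\<^sub>R b))"
  shows "\<bar>det (vector [a, b, z] :: real^3^3)\<bar> \<ge> m * sin \<theta> / L\<^sup>2"
proof -
  define A B C p q Z where "A = a \<bullet> a" and "B = a \<bullet> b" and "C = b \<bullet> b" and "p = a \<bullet> z" and "q = b \<bullet> z" and "Z = z \<bullet> z"
  have ns: "(norm (s *\<^sub>R a + t *\<^sub>R b))\<^sup>2 = A * s\<^sup>2 + 2 * B * s * t + C * t\<^sup>2" for s t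
    unfolding power2_norm_eq_inner
    by (simp add: inner_simps A_def B_def C_def inner_commute power2_eq_square algebra_simps)
  have "A * s\<^sup>2 + 2 * B * s * t + C * t\<^sup>2 \<ge> (1 / L\<^sup>2) * (s\<^sup>2 + t\<^sup>2)" for s t
  proof -
    have "(sqrt (s\<^sup>2 + t\<^sup>2) / L)\<^sup>2 \<le> (norm (s *\<^sub>R a + t *\<^sub>R b))\<^sup>2"
      using lower L by (intro power_mono) auto
    then show ?thesis by (simp add: ns power_divide)
  qed
  then have G: "A * C - B\<^sup>2 \<ge> (1 / L\<^sup>2)\<^sup>2" by (intro form_ge_imp_det_ge) auto
  define G where "G = A * C - B\<^sup>2"
  have Gpos: "G > 0" using G L unfolding G_def by (rule_tac less_le_trans) auto
  define X where "X = p\<^sup>2 * C - 2 * p * q * B + q\<^sup>2 * A"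
  \<comment> \<open>Cramer's rule without the division: these coefficients give \<open>G\<close>
    times the orthogonal projection of z onto the plane of a and b.\<close>
  define s t where "s = p * C - q * B" and "t = q * A - p * B"
  have zw: "z \<bullet> (s *\<^sub>R a + t *\<^sub>R b) = X"
    by (simp add: inner_simps X_def s_def t_def inner_commute[of z] p_def[symmetric] q_def[symmetric] power2_eq_square algebra_simps)
  have ww: "(norm (s *\<^sub>R a + t *\<^sub>R b))\<^sup>2 = G * X"
    unfolding ns X_def s_def t_def G_def by algebra
  have X0: "X \<ge> 0"
    using ww Gpos zero_le_power2[of "norm (s *\<^sub>R a + t *\<^sub>R b)"] by (simp add: zero_le_mult_iff)
  have "\<bar>X\<bar>\<^sup>2 \<le> (cos \<theta> * (norm z * norm (s *\<^sub>R a + t *\<^sub>R b)))\<^sup>2"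
    using angle[of s t] zw by (intro power_mono) auto
  then have "X\<^sup>2 \<le> (cos \<theta>)\<^sup>2 * (Z * (G * X))"
    by (simp add: power_mult_distrib ww Z_def power2_norm_eq_inner[of z])
  then have "X * X \<le> (cos \<theta>)\<^sup>2 * (Z * G) * X" by (simp add: power2_eq_square mult_ac)
  moreover have "Z \<ge> 0" by (simp add: Z_def)
  ultimately have "X \<le> (cos \<theta>)\<^sup>2 * (Z * G)"
    using X0 Gpos by (cases "X = 0") auto
  moreover have det2: "(det (vector [a, b, z] :: real^3^3))\<^sup>2 = Z * G - X"
    unfolding det_vector_square G_def X_def A_def B_def C_def p_def q_def Z_def by simp
  ultimately have "(det (vector [a, b, z] :: real^3^3))\<^sup>2 \<ge> (sin \<theta>)\<^sup>2 * (Z * G)"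
    by (simp add: sin_squared_eq algebra_simps)
  moreover have "(m * sin \<theta> / L\<^sup>2)\<^sup>2 \<le> (sin \<theta>)\<^sup>2 * (Z * G)"
  proof -
    have "m\<^sup>2 \<le> Z" unfolding Z_def power2_norm_eq_inner[symmetric] using m by (intro power_mono) auto
    moreover have "(1 / L\<^sup>2)\<^sup>2 \<le> G" using G by (simp add: G_def)
    ultimately have "m\<^sup>2 * (1 / L\<^sup>2)\<^sup>2 \<le> Z * G" by (intro mult_mono) (auto simp: Z_def)
    then have "(sin \<theta>)\<^sup>2 * (m\<^sup>2 * (1 / L\<^sup>2)\<^sup>2) \<le> (sin \<theta>)\<^sup>2 * (Z * G)" by (intro mult_left_mono) auto
    then show ?thesis by (simp add: power_mult_distrib power_divide mult_ac)
  qed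
  ultimately have "(m * sin \<theta> / L\<^sup>2)\<^sup>2 \<le> \<bar>det (vector [a, b, z] :: real^3^3)\<bar>\<^sup>2" by simp
  then show ?thesis by (rule power2_le_imp_le) simp
qed

lemma linear_real2:
  fixes D :: "real^2 \<Rightarrow> 'a::real_vector"
  assumes "linear D"
  shows "D v = v $ 1 *\<^sub>R D (axis 1 1) + v $ 2 *\<^sub>R D (axis 2 1)"
proof -
  have "v = v $ 1 *\<^sub>R axis 1 1 + v $ 2 *\<^sub>R axis 2 1" by (simp add: vec_eq_iff forall_2 axis_def)
  then have "D v = D (v $ 1 *\<^sub>R axis 1 1 + v $ 2 *\<^sub>R axis 2 1)" by simp
  then show ?thesis using assms by (simp add: linear_add linear_scale)
qed

lemma negligible_cylinder:
  fixes N :: "(real^2) set"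
  assumes "negligible N"
  shows "negligible {x :: real^3. vector [x $ 1, x $ 2] \<in> N}"
proof -
  obtain N' where N': "N' \<in> null_sets lborel" "N \<subseteq> N'"
    using assms by (auto simp: negligible_iff_null_sets null_sets_completion_iff2)
  have "N' \<times> (UNIV :: real set) \<in> null_sets (lborel \<Otimes>\<^sub>M lborel)"
    using lborel.times_in_null_sets1[of N' lborel "UNIV :: real set"] N'(1) by simp
  then have "negligible (N' \<times> (UNIV :: real set))"
    by (simp add: lborel_prod negligible_iff_null_sets null_sets_completionI)
  moreover define F where "F z = (fst z $ 1 *\<^sub>R axis 1 1 + fst z $ 2 *\<^sub>R axis 2 1 + snd z *\<^sub>R axis 3 1 :: real^3)"
    for z :: "(real^2) \<times> real"
  have "linear F"
    by (rule linearI) (auto simp: F_def algebra_simps)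
  then have "F differentiable_on S" for S
    by (simp add: linear_imp_differentiable_on)
  ultimately have "negligible (F ` (N' \<times> UNIV))"
    by (intro negligible_differentiable_image_negligible) auto
  moreover have "{x :: real^3. vector [x $ 1, x $ 2] \<in> N} \<subseteq> F ` (N' \<times> UNIV)"
  proof
    fix x :: "real^3" assume "x \<in> {x. vector [x $ 1, x $ 2] \<in> N}"
    then have "(vector [x $ 1, x $ 2], x $ 3) \<in> N' \<times> (UNIV :: real set)" using N'(2) by auto
    moreover have "x = F (vector [x $ 1, x $ 2], x $ 3)"
      by (simp add: F_def vec_eq_iff forall_3 axis_def)
    ultimately show "x \<in> F ` (N' \<times> UNIV)" by blast
  qed
  ultimately show ?thesis by (rule negligible_subset)
qed

text \<open>Integrability of \<open>\<phi>\<close> admits the substitution rule for absolutely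
  integrable functions, applied with values in \<open>real^1\<close>; the pointwise bound does the
  rest.\<close>

lemma nn_integral_change_of_variables_le:
  fixes g :: "real^'n::{finite,wellorder} \<Rightarrow> real^'n::_" and \<phi> \<psi> :: "real^'n::_ \<Rightarrow> real"
  assumes S: "S \<in> sets lebesgue"
    and der: "\<And>x. x \<in> S \<Longrightarrow> (g has_derivative g' x) (at x)"
    and inj: "inj_on g S"
    and \<phi>: "\<phi> \<in> borel_measurable borel" "\<And>x. \<phi> x \<ge> 0" "(\<integral>\<^sup>+x. ennreal (\<phi> x) \<partial>lborel) < \<infinity>"
    and le: "\<And>x. x \<in> S \<Longrightarrow> \<psi> x \<le> \<bar>det (matrix (g' x))\<bar> * \<phi> (g x)"
  shows "(\<integral>\<^sup>+x. ennreal (\<psi> x) * indicator S x \<partial>lborel) \<le> (\<integral>\<^sup>+x. ennreal (\<phi> x) * indicator (g ` S) x \<partial>lborel)"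
proof -
  have der': "(g has_derivative g' x) (at x within S)" if "x \<in> S" for x
    using der[OF that] by (rule has_derivative_at_withinI)
  have gS: "g ` S \<in> sets lebesgue"
    by (rule differentiable_image_in_sets_lebesgue[OF S])
      (use der' in \<open>auto simp: differentiable_on_def differentiable_def\<close>)
  have "integrable lborel \<phi>"
    using \<phi> by (intro integrableI_nonneg) auto
  then have "\<phi> absolutely_integrable_on UNIV"
    by (simp add: set_integrable_def integrable_completion)
  then have "\<phi> absolutely_integrable_on (g ` S)"
    by (rule set_integrable_subset[OF _ gS]) simp
  then have v: "(\<lambda>x. vec (\<phi> x) :: real^1) absolutely_integrable_on (g ` S)"
    by (simp add: absolutely_integrable_on_1_iff)
  define I where "I = integral (g ` S) (\<lambda>x. vec (\<phi> x) :: real^1)"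
  have "(\<lambda>x. \<bar>det (matrix (g' x))\<bar> *\<^sub>R (vec (\<phi> (g x)) :: real^1)) absolutely_integrable_on S \<and>
      integral S (\<lambda>x. \<bar>det (matrix (g' x))\<bar> *\<^sub>R (vec (\<phi> (g x)) :: real^1)) = I"
    using has_absolute_integral_change_of_variables[OF S der' inj, of "\<lambda>x. vec (\<phi> x) :: real^1" I] v I_def by blast
  then have w: "(\<lambda>x. \<bar>det (matrix (g' x))\<bar> * \<phi> (g x)) absolutely_integrable_on S"
    "integral S (\<lambda>x. \<bar>det (matrix (g' x))\<bar> * \<phi> (g x)) = I $ 1"
    by (auto simp: absolutely_integrable_on_1_iff integral_on_1_eq)
  have I1: "I $ 1 = integral (g ` S) \<phi>"
    using v unfolding I_def by (simp add: integral_on_1_eq)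
  have "(\<integral>\<^sup>+x. ennreal (\<psi> x) * indicator S x \<partial>lborel) \<le>
      (\<integral>\<^sup>+x. ennreal (\<bar>det (matrix (g' x))\<bar> * \<phi> (g x)) * indicator S x \<partial>lborel)"
    using le by (intro nn_integral_mono) (auto simp: indicator_def intro: ennreal_leI)
  also have "\<dots> = ennreal (I $ 1)"
  proof (rule nn_integral_has_integral_lebesgue')
    show "((\<lambda>x. \<bar>det (matrix (g' x))\<bar> * \<phi> (g x)) has_integral I $ 1) S"
      using integrable_integral[OF set_lebesgue_integral_eq_integral(1)[OF w(1)]] w(2) by simp
  qed (use \<phi>(2) in simp)
  also have "\<dots> = (\<integral>\<^sup>+x. ennreal (\<phi> x) * indicator (g ` S) x \<partial>lborel)"
  proof (rule nn_integral_has_integral_lebesgue'[symmetric])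
    show "(\<phi> has_integral I $ 1) (g ` S)"
      using integrable_integral[OF set_lebesgue_integral_eq_integral(1)[OF \<open>\<phi> absolutely_integrable_on (g ` S)\<close>]] I1
      by simp
  qed (use \<phi>(2) in simp)
  finally show ?thesis .
qed

context zorich_surface
begin

section \<open>Derivative of the surface map and Jacobian of \<open>f\<close>\<close>

definition diff_pts :: "(real^2) set" where
  "diff_pts = {p \<in> box (- 1) 1. \<exists>D. (h has_derivative D) (at p)}"

lemma diff_pts_derivative:
  assumes "p \<in> diff_pts"
  shows "(h has_derivative frechet_derivative h (at p)) (at p)"
proof -
  have "h differentiable (at p)" using assms by (auto simp: diff_pts_def differentiable_def)
  then show ?thesis by (simp add: frechet_derivative_works)
qed

text \<open>Existence of the derivative almost everywhere is part of
  \<open>sense_preserving_surf\<close>.\<close>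

lemma negligible_nondiff: "negligible (box (- 1) 1 - diff_pts)"
proof -
  have "AE x in lebesgue. x \<in> box (- 1) 1 \<longrightarrow> x \<in> diff_pts"
    using sense unfolding sense_preserving_surf_def diff_pts_def by (rule AE_mp) auto
  then obtain N where N: "{x \<in> space lebesgue. \<not> (x \<in> box (- 1) 1 \<longrightarrow> x \<in> diff_pts)} \<subseteq> N" "N \<in> null_sets lebesgue"
    by (auto elim!: AE_E simp: null_sets_def)
  then have "box (- 1) 1 - diff_pts \<subseteq> N" by auto
  then show ?thesis using N(2) negligible_iff_null_sets negligible_subset by blast
qed

text \<open>Both bounds hold for the chords from \<open>h p\<close> in direction v and survive the
  passage to the limit.\<close>

lemma derivative_bounds:
  assumes p: "p \<in> box (- 1) 1" and D: "(h has_derivative D) (at p)"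
  shows "norm v / L \<le> norm (D v)" and "\<bar>h p \<bullet> D v\<bar> \<le> cos \<theta> * (norm (h p) * norm (D v))"
proof -
  have lin: "linear D" using D has_derivative_linear by blast
  have pQ: "p \<in> sqQ" using p box_subset_sqQ by blast
  have approx: "\<exists>y t. y \<in> sqQ \<and> norm (h y - h p) \<le> \<epsilon> \<and> y - p = t *\<^sub>R v \<and> t > 0 \<and>
      norm (h y - h p - t *\<^sub>R D v) \<le> e * t * norm v" if e: "e > 0" for e
  proof -
    obtain d where d: "d > 0" "\<And>y. norm (y - p) < d \<Longrightarrow> norm (h y - h p - D (y - p)) \<le> e * norm (y - p)"
      using D e unfolding has_derivative_at_alt by blast
    obtain r where r: "r > 0" "ball p r \<subseteq> box (- 1) 1" using openE[OF open_box p] by blast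
    \<comment> \<open>\<open>d\<close> for the linear approximation, \<open>r\<close> to stay in the
      square, and \<open>\<epsilon> / L\<close> so that the chord is short enough for the
      non-tangential property.\<close>
    define s where "s = min (min d r) (\<epsilon> / L)"
    have s: "s > 0" "s \<le> d" "s \<le> r" "s \<le> \<epsilon> / L" using d r theta(3) L_pos by (auto simp: s_def)
    \<comment> \<open>The added 1 covers v = 0.\<close>
    define N where "N = norm v + 1"
    define t where "t = s / (2 * N)"
    have nv: "N > 0" by (simp add: N_def add_nonneg_pos)
    have t: "t > 0" "t * norm v < s"
    proof -
      show "t > 0" using s nv by (simp add: t_def)
      have "t * norm v \<le> t * N" using \<open>t > 0\<close> by (intro mult_left_mono) (auto simp: N_def)
      also have "\<dots> = s / 2" using nv by (simp add: t_def)
      finally show "t * norm v < s" using s(1) by simp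
    qed
    define y where "y = p + t *\<^sub>R v"
    have yp: "y - p = t *\<^sub>R v" "norm (y - p) = t * norm v" using t by (auto simp: y_def)
    have "norm (y - p) < r" using yp(2) t(2) s(3) by linarith
    then have "y \<in> ball p r" by (simp add: dist_norm norm_minus_commute)
    then have yQ: "y \<in> sqQ" using r(2) box_subset_sqQ by blast
    have "norm (h y - h p) \<le> L * (t * norm v)" using lip[OF yQ pQ] yp(2) by simp
    also have "\<dots> \<le> L * (\<epsilon> / L)" using t s L_pos by (intro mult_left_mono) auto
    finally have "norm (h y - h p) \<le> \<epsilon>" using L_pos by simp
    moreover have "norm (h y - h p - D (y - p)) \<le> e * norm (y - p)" using yp t s by (intro d(2)) auto
    ultimately show ?thesis using yQ yp t lin by (intro exI[of _ y] exI[of _ t]) (simp add: linear_scale mult.assoc)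
  qed
  show "norm v / L \<le> norm (D v)"
  proof (rule field_le_epsilon)
    fix e0 :: real assume "e0 > 0"
    define e where "e = e0 / (norm v + 1)"
    have nv: "norm v + 1 > 0" by (simp add: add_nonneg_pos)
    have e: "e > 0" "e * norm v \<le> e0" using \<open>e0 > 0\<close> nv by (auto simp: e_def field_simps)
    obtain y t where y: "y \<in> sqQ" "y - p = t *\<^sub>R v" "t > 0" "norm (h y - h p - t *\<^sub>R D v) \<le> e * t * norm v"
      using approx[OF e(1)] by blast
    have "t * (norm v / L) = norm (y - p) / L" using y by simp
    also have "\<dots> \<le> norm (h y - h p)" by (rule lip_lower[OF y(1) pQ])
    also have "\<dots> \<le> norm (t *\<^sub>R D v) + norm (h y - h p - t *\<^sub>R D v)"
      using norm_triangle_ineq[of "t *\<^sub>R D v" "h y - h p - t *\<^sub>R D v"] by simp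
    also have "\<dots> \<le> t * (norm (D v) + e * norm v)" using y by (simp add: algebra_simps)
    finally have "norm v / L \<le> norm (D v) + e * norm v" using y(3) by (simp only: mult_le_cancel_left_pos)
    then show "norm v / L \<le> norm (D v) + e0" using e(2) by linarith
  qed
  show "\<bar>h p \<bullet> D v\<bar> \<le> cos \<theta> * (norm (h p) * norm (D v))"
  proof (rule field_le_epsilon)
    fix e0 :: real assume "e0 > 0"
    define e where "e = e0 / (2 * (norm v + 1))"
    have nv: "norm v + 1 > 0" by (simp add: add_nonneg_pos)
    have e: "e > 0" "2 * (e * norm v) \<le> e0" using \<open>e0 > 0\<close> nv by (auto simp: e_def field_simps)
    obtain y t where y: "y \<in> sqQ" "norm (h y - h p) \<le> \<epsilon>" "t > 0" "norm (h y - h p - t *\<^sub>R D v) \<le> e * t * norm v"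
      using approx[OF e(1)] by blast
    define r where "r = h y - h p - t *\<^sub>R D v"
    have hy: "h y - h p = t *\<^sub>R D v + r" by (simp add: r_def)
    have rr: "norm r \<le> e * t * norm v" using y(4) by (simp add: r_def)
    have np: "0 \<le> norm (h p)" "norm (h p) \<le> 1" using norm_le_1[OF pQ] by auto
    have c: "0 \<le> cos \<theta>" "cos \<theta> \<le> 1" using theta by (auto intro!: cos_ge_zero)
    have "\<bar>h p \<bullet> (h y - h p)\<bar> \<le> cos \<theta> * (norm (h p) * norm (h y - h p))"
      using nontang_inner[OF y(1) pQ y(2), of 1 1] by simp
    also have "\<dots> \<le> cos \<theta> * (norm (h p) * (t * norm (D v) + norm r))"
      using c np y(3) norm_triangle_ineq[of "t *\<^sub>R D v" r] by (intro mult_left_mono) (auto simp: hy)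
    also have "\<dots> = t * (cos \<theta> * (norm (h p) * norm (D v))) + cos \<theta> * norm (h p) * norm r"
      by (simp add: algebra_simps)
    also have "cos \<theta> * norm (h p) * norm r \<le> 1 * norm r"
      using c np by (intro mult_right_mono mult_le_one) auto
    finally have 1: "\<bar>h p \<bullet> (h y - h p)\<bar> \<le> t * (cos \<theta> * (norm (h p) * norm (D v))) + norm r" by simp
    have "\<bar>h p \<bullet> r\<bar> \<le> 1 * norm r"
      using Cauchy_Schwarz_ineq2[of "h p" r] np by (meson mult_right_mono norm_ge_zero order_trans)
    moreover have "t * (h p \<bullet> D v) = h p \<bullet> (h y - h p) - h p \<bullet> r" by (simp add: hy inner_simps)
    ultimately have "\<bar>t * (h p \<bullet> D v)\<bar> \<le> t * (cos \<theta> * (norm (h p) * norm (D v))) + 2 * norm r"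
      using 1 by linarith
    also have "\<dots> \<le> t * (cos \<theta> * (norm (h p) * norm (D v)) + 2 * (e * norm v))"
      using rr by (simp add: algebra_simps)
    finally have "\<bar>h p \<bullet> D v\<bar> \<le> cos \<theta> * (norm (h p) * norm (D v)) + 2 * (e * norm v)"
      using y(3) by (simp add: abs_mult mult_le_cancel_left_pos)
    then show "\<bar>h p \<bullet> D v\<bar> \<le> cos \<theta> * (norm (h p) * norm (D v)) + e0" using e(2) by linarith
  qed
qed

lemma det_h_lower:
  assumes p: "p \<in> box (- 1) 1" and D: "(h has_derivative D) (at p)"
  shows "\<bar>det (vector [D (axis 1 1), D (axis 2 1), h p] :: real^3^3)\<bar> \<ge> m * sin \<theta> / L\<^sup>2"
proof (rule det_lower_bound[OF L_pos m_pos])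
  have lin: "linear D" using D has_derivative_linear by blast
  show "m \<le> norm (h p)" using m_le p box_subset_sqQ by blast
  show "0 \<le> sin \<theta>" using sin_pos by simp
  fix s t :: real
  have e: "D (vector [s, t]) = s *\<^sub>R D (axis 1 1) + t *\<^sub>R D (axis 2 1)"
    using linear_real2[OF lin, of "vector [s, t]"] by simp
  show "sqrt (s\<^sup>2 + t\<^sup>2) / L \<le> norm (s *\<^sub>R D (axis 1 1) + t *\<^sub>R D (axis 2 1))"
    using derivative_bounds(1)[OF p D, of "vector [s, t]"] by (simp add: e norm_real2)
  show "\<bar>h p \<bullet> (s *\<^sub>R D (axis 1 1) + t *\<^sub>R D (axis 2 1))\<bar> \<le>
      cos \<theta> * (norm (h p) * norm (s *\<^sub>R D (axis 1 1) + t *\<^sub>R D (axis 2 1)))"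
    using derivative_bounds(2)[OF p D, of "vector [s, t]"] by (simp add: e)
qed

definition open_beam :: "int \<Rightarrow> int \<Rightarrow> (real^3) set" where
  "open_beam k l = {x. \<bar>x $ 1 - 2 * k * lam\<bar> < lam \<and> \<bar>x $ 2 - 2 * l * lam\<bar> < lam}"

text \<open>The factor \<open>lam\<close> of the range cancels the 1 / lam hidden in
  \<open>foot\<close>, so it survives only in the vertical direction. Hence the Jacobian contains
  \<open>lam\<close> once but the exponential three times.\<close>

definition jac :: "int \<Rightarrow> int \<Rightarrow> real^3 \<Rightarrow> real^3 \<Rightarrow> real^3" where
  "jac k l x v = reflect_if_odd (k + l) (exp (x $ 3) *\<^sub>R (frechet_derivative h (at (foot x))
      (vector [parity k * v $ 1, parity l * v $ 2]) + (lam * v $ 3) *\<^sub>R h (foot x)))"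

lemma open_open_beam: "open (open_beam k l)"
  unfolding open_beam_def by (intro open_Collect_conj open_Collect_less continuous_intros)

lemma open_beam_subset: "open_beam k l \<subseteq> beam k l"
  by (auto simp: open_beam_def beam_def)

lemma foot_open_beam:
  assumes "x \<in> open_beam k l"
  shows "foot x = vector [parity k * (x $ 1 - 2 * real_of_int k * lam) / lam, parity l * (x $ 2 - 2 * real_of_int l * lam) / lam]"
    "foot x \<in> box (- 1) 1"
proof -
  have b: "\<bar>x $ 1 - 2 * real_of_int k * lam\<bar> < lam" "\<bar>x $ 2 - 2 * real_of_int l * lam\<bar> < lam"
    using assms by (auto simp: open_beam_def)
  show "foot x = vector [parity k * (x $ 1 - 2 * real_of_int k * lam) / lam, parity l * (x $ 2 - 2 * real_of_int l * lam) / lam]"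
    using T_eq[of "x $ 1" k] T_eq[of "x $ 2" l] b by (simp add: foot_def)
  then show "foot x \<in> box (- 1) 1"
    using b lam_pos by (simp add: in_box2 abs_mult abs_divide)
qed

lemma f_has_derivative:
  assumes x: "x \<in> open_beam k l" and d: "foot x \<in> diff_pts"
  shows "(f has_derivative jac k l x) (at x)"
proof -
  define A where "A y = (y $ 1 * (parity k / lam) - 2 * k * parity k) *\<^sub>R axis 1 1 +
      (y $ 2 * (parity l / lam) - 2 * l * parity l) *\<^sub>R (axis 2 1 :: real^2)" for y :: "real^3"
  define A' where "A' v = (v $ 1 * (parity k / lam)) *\<^sub>R axis 1 1 + (v $ 2 * (parity l / lam)) *\<^sub>R (axis 2 1 :: real^2)"
    for v :: "real^3"
  have footA: "foot y = A y" if "y \<in> open_beam k l" for y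
    unfolding foot_open_beam(1)[OF that]
    using lam_pos by (simp add: A_def vec_eq_iff forall_2 axis_def field_simps)
  define D where "D = frechet_derivative h (at (foot x))"
  have D: "(h has_derivative D) (at (A x))"
    using diff_pts_derivative[OF d] footA[OF x] by (simp add: D_def)
  have vd: "((\<lambda>y. y $ i) has_derivative (\<lambda>v. v $ i)) (at y)" for i and y :: "real^3"
    by (rule bounded_linear_imp_has_derivative[OF bounded_linear_vec_nth])
  have Ad: "(A has_derivative A') (at x)"
    unfolding A_def[abs_def] A'_def[abs_def] using lam_pos by (auto intro!: derivative_eq_intros vd)
  have hA: "((\<lambda>y. h (A y)) has_derivative (\<lambda>v. D (A' v))) (at x)"
    using has_derivative_compose[OF Ad D] .
  define R where "R y = y $ 1 *\<^sub>R axis 1 1 + y $ 2 *\<^sub>R axis 2 1 + (parity (k + l) * y $ 3) *\<^sub>R (axis 3 1 :: real^3)" for y :: "real^3"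
  have R: "R = reflect_if_odd (k + l)" by (auto simp: R_def vec_eq_iff forall_3 axis_def)
  have Rd: "(R has_derivative R) (at y)" for y
    unfolding R_def[abs_def] by (auto intro!: derivative_eq_intros vd)
  have "((\<lambda>y. (exp (y $ 3) * lam) *\<^sub>R h (A y)) has_derivative
      (\<lambda>v. (exp (x $ 3) * lam) *\<^sub>R D (A' v) + (exp (x $ 3) * v $ 3 * lam) *\<^sub>R h (A x))) (at x)"
    by (rule derivative_eq_intros hA vd refl)+ (auto simp: mult_ac)
  then have "((\<lambda>y. R ((exp (y $ 3) * lam) *\<^sub>R h (A y))) has_derivative
      (\<lambda>v. R ((exp (x $ 3) * lam) *\<^sub>R D (A' v) + (exp (x $ 3) * v $ 3 * lam) *\<^sub>R h (A x)))) (at x)"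
    by (rule has_derivative_compose[OF _ Rd])
  moreover have "R ((exp (x $ 3) * lam) *\<^sub>R D (A' v) + (exp (x $ 3) * v $ 3 * lam) *\<^sub>R h (A x)) = jac k l x v" for v
  proof -
    have lin: "linear D" using D has_derivative_linear by blast
    have "lam *\<^sub>R A' v = vector [parity k * v $ 1, parity l * v $ 2]"
      using lam_pos by (simp add: A'_def vec_eq_iff forall_2 axis_def)
    then have "D (vector [parity k * v $ 1, parity l * v $ 2]) = lam *\<^sub>R D (A' v)"
      using linear_scale[OF lin, of lam "A' v"] by simp
    then show ?thesis
      unfolding jac_def R footA[OF x, symmetric] D_def[symmetric] by (simp add: algebra_simps)
  qed
  ultimately have "((\<lambda>y. R ((exp (y $ 3) * lam) *\<^sub>R h (A y))) has_derivative jac k l x) (at x)" by simp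
  then show ?thesis
  proof (rule has_derivative_transform_within_open[OF _ open_open_beam x])
    fix y assume y: "y \<in> open_beam k l"
    show "R ((exp (y $ 3) * lam) *\<^sub>R h (A y)) = f y"
      using f_beam[OF subsetD[OF open_beam_subset y]] footA[OF y] by (simp add: R)
  qed
qed

lemma det_jac_lower:
  assumes x: "x \<in> open_beam k l" and d: "foot x \<in> diff_pts"
  shows "\<bar>det (matrix (jac k l x))\<bar> \<ge> exp (x $ 3) ^ 3 * (lam * m * sin \<theta> / L\<^sup>2)"
proof -
  define D where "D = frechet_derivative h (at (foot x))"
  have D: "(h has_derivative D) (at (foot x))"
    using d unfolding D_def by (rule diff_pts_derivative)
  have lin: "linear D" using D has_derivative_linear by blast
  define a b z E where "a = D (axis 1 1)" and "b = D (axis 2 1)" and "z = h (foot x)" and "E = exp (x $ 3)"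
  have J: "jac k l x v = reflect_if_odd (k + l) (E *\<^sub>R ((parity k * v $ 1) *\<^sub>R a + (parity l * v $ 2) *\<^sub>R b + (lam * v $ 3) *\<^sub>R z))" for v
    unfolding jac_def D_def[symmetric] a_def b_def z_def E_def
    using linear_real2[OF lin, of "vector [parity k * v $ 1, parity l * v $ 2]"] by simp
  have "det (matrix (jac k l x)) = parity (k + l) * parity k * parity l * (E ^ 3 * (lam * det (vector [a, b, z] :: real^3^3)))"
    unfolding det_3 matrix_def by (simp add: J axis_def power3_eq_cube algebra_simps)
  then have "\<bar>det (matrix (jac k l x))\<bar> = E ^ 3 * (lam * \<bar>det (vector [a, b, z] :: real^3^3)\<bar>)"
    using lam_pos by (simp add: abs_mult E_def)
  moreover have "lam * (m * sin \<theta> / L\<^sup>2) \<le> lam * \<bar>det (vector [a, b, z] :: real^3^3)\<bar>"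
    using det_h_lower[OF _ D] foot_open_beam(2)[OF x] lam_pos unfolding a_def b_def z_def
    by (intro mult_left_mono) auto
  then have "E ^ 3 * (lam * (m * sin \<theta> / L\<^sup>2)) \<le> E ^ 3 * (lam * \<bar>det (vector [a, b, z] :: real^3^3)\<bar>)"
    by (rule mult_left_mono) (simp add: E_def)
  ultimately show ?thesis by (simp add: E_def mult.assoc)
qed

text \<open>On the axial lines the value is 0 by the convention for division, not infinity;
  therefore the estimates below require target sets that avoid these lines.\<close>

definition wgt :: "real^3 \<Rightarrow> real" where
  "wgt x = 1 / axdist x ^ 3"

text \<open>L ^ 5 collects L ^ 2 from the Jacobian and L ^ 3 from the cube of the bound in
  \<open>axdist_f\<close>.\<close>

definition \<kappa> :: real where
  "\<kappa> = lam * m * sin \<theta> / L ^ 5"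

lemma kappa_gt_1: "\<kappa> > 1"
  using lamC L_pos by (simp add: \<kappa>_def less_divide_eq)

lemma T_comp_continuous: "continuous_on S (\<lambda>x::real^'n. T (x $ i))"
  by (rule continuous_on_compose2[OF T_continuous[of UNIV]]) (auto intro!: continuous_intros)

lemma axdist_continuous: "continuous_on S axdist"
  unfolding axdist_def[abs_def] by (intro continuous_intros continuous_on_vector2 T_comp_continuous)

lemma wgt_nonneg: "wgt x \<ge> 0"
  by (simp add: wgt_def)

lemma wgt_measurable [measurable]: "wgt \<in> borel_measurable borel"
proof -
  have [measurable]: "axdist \<in> borel_measurable borel"
    by (rule borel_measurable_continuous_onI[OF axdist_continuous])
  show ?thesis unfolding wgt_def[abs_def] by measurable
qed

lemma f_measurable [measurable]: "f \<in> borel_measurable borel"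
  by (rule borel_measurable_continuous_onI[OF f_continuous])

lemma f_inj_beam: "inj_on f (beam k l)"
proof (rule inj_onI)
  fix x y assume xy: "x \<in> beam k l" "y \<in> beam k l" "f x = f y"
  obtain c where c: "c > 0" "\<And>k l x y. x \<in> beam k l \<Longrightarrow> y \<in> beam k l \<Longrightarrow>
    norm (f x - f y) \<ge> c * exp (x $ 3) * (\<bar>1 - exp (y $ 3 - x $ 3)\<bar> + pdist (x - y))"
    using f_diff_lower by blast
  have "c * exp (x $ 3) * (\<bar>1 - exp (y $ 3 - x $ 3)\<bar> + pdist (x - y)) \<le> 0"
    using c(2)[OF xy(1,2)] xy(3) by simp
  moreover have "c * exp (x $ 3) > 0" using c(1) by simp
  ultimately have "\<bar>1 - exp (y $ 3 - x $ 3)\<bar> + pdist (x - y) \<le> 0"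
    by (meson mult_pos_pos not_le)
  then have "\<bar>1 - exp (y $ 3 - x $ 3)\<bar> = 0" "pdist (x - y) = 0"
    using pdist_nonneg[of "x - y"] abs_ge_zero[of "1 - exp (y $ 3 - x $ 3)"] by linarith+
  then have "y $ 3 = x $ 3" "x $ 1 = y $ 1" "x $ 2 = y $ 2" using pdist_le[of "x - y"] by auto
  then show "x = y" by (simp add: vec_eq_iff forall_3)
qed

lemma negligible_coordinate_plane: "negligible {x :: real^3. x $ i = c}"
  using negligible_hyperplane[of "axis i 1 :: real^3" c] by (simp add: inner_axis' axis_eq_0_iff)

lemma negligible_beam_bad: "negligible (beam k l - {x \<in> open_beam k l. foot x \<in> diff_pts})"
proof -
  define G where "G q = (lam * parity k * q $ 1 + 2 * real_of_int k * lam) *\<^sub>R axis 1 1 +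
      (lam * parity l * q $ 2 + 2 * real_of_int l * lam) *\<^sub>R (axis 2 1 :: real^2)" for q :: "real^2"
  have vd: "((\<lambda>y. y $ i) has_derivative (\<lambda>v. v $ i)) (at y)" for i and y :: "real^2"
    by (rule bounded_linear_imp_has_derivative[OF bounded_linear_vec_nth])
  have "G differentiable (at q)" for q
    unfolding differentiable_def G_def[abs_def]
    by (rule exI) (rule derivative_eq_intros vd refl)+
  then have "G differentiable_on S" for S
    by (auto simp: differentiable_on_def intro: differentiable_at_withinI)
  then have "negligible (G ` (box (- 1) 1 - diff_pts))"
    by (intro negligible_differentiable_image_negligible negligible_nondiff) auto
  then have 1: "negligible {x :: real^3. vector [x $ 1, x $ 2] \<in> G ` (box (- 1) 1 - diff_pts)}"
    by (rule negligible_cylinder)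
  let ?P = "\<lambda>i c. {x :: real^3. x $ i = c}"
  have 2: "negligible (?P 1 ((2 * real_of_int k - 1) * lam) \<union> ?P 1 ((2 * real_of_int k + 1) * lam) \<union>
      ?P 2 ((2 * real_of_int l - 1) * lam) \<union> ?P 2 ((2 * real_of_int l + 1) * lam))"
    by (intro negligible_Un negligible_coordinate_plane)
  show ?thesis
  proof (rule negligible_subset[OF negligible_Un[OF 1 2]], rule subsetI)
    fix x assume x: "x \<in> beam k l - {x \<in> open_beam k l. foot x \<in> diff_pts}"
    show "x \<in> {x :: real^3. vector [x $ 1, x $ 2] \<in> G ` (box (- 1) 1 - diff_pts)} \<union>
      (?P 1 ((2 * real_of_int k - 1) * lam) \<union> ?P 1 ((2 * real_of_int k + 1) * lam) \<union>
      ?P 2 ((2 * real_of_int l - 1) * lam) \<union> ?P 2 ((2 * real_of_int l + 1) * lam))"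
    proof (cases "x \<in> open_beam k l")
      case True
      then have "foot x \<in> box (- 1) 1 - diff_pts" using x foot_open_beam(2) by blast
      moreover have "(vector [x $ 1, x $ 2] :: real^2) = G (foot x)"
        unfolding foot_open_beam(1)[OF True] using lam_pos
        by (simp add: G_def vec_eq_iff forall_2 axis_def mult.assoc)
      ultimately show ?thesis by blast
    next
      case False
      then have "\<bar>x $ 1 - 2 * real_of_int k * lam\<bar> = lam \<or> \<bar>x $ 2 - 2 * real_of_int l * lam\<bar> = lam"
        using x by (auto simp: beam_def open_beam_def)
      then show ?thesis by (auto simp: abs_eq_iff' algebra_simps)
    qed
  qed
qed

lemma AE_not_negligible: "negligible N \<Longrightarrow> AE x in lborel. x \<notin> N"
  using AE_not_in[of N lebesgue] by (simp add: negligible_iff_null_sets AE_completion_iff)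

text \<open>On one beam \<open>f\<close> is injective with values in the half-space of its parity.
  Keeping that half-space on the right makes it possible to add beams of opposite parity without
  counting \<open>B\<close> twice.\<close>

lemma beam_preimage_le:
  assumes B [measurable]: "B \<in> sets borel" and off: "\<And>x. x \<in> B \<Longrightarrow> axdist x \<noteq> 0"
    and fin: "(\<integral>\<^sup>+x. ennreal (wgt x) * indicator B x \<partial>lborel) < \<infinity>"
  shows "ennreal \<kappa> * (\<integral>\<^sup>+x. ennreal (wgt x) * indicator (beam k l \<inter> f -` B) x \<partial>lborel) \<le>
     (\<integral>\<^sup>+x. ennreal (wgt x) * indicator (B \<inter> {x. parity (k + l) * x $ 3 \<ge> 0}) x \<partial>lborel)"
proof -
  define S where "S = {x \<in> open_beam k l. foot x \<in> diff_pts}"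
  have SB: "S \<subseteq> beam k l" using open_beam_subset by (auto simp: S_def)
  have "S = open_beam k l - (beam k l - S)" using open_beam_subset by (auto simp: S_def)
  moreover have "beam k l - S \<in> sets lebesgue"
    using negligible_beam_bad unfolding S_def by (rule negligible_imp_sets)
  moreover have "open_beam k l \<in> sets lebesgue" using open_open_beam by (simp add: borel_open)
  ultimately have S: "S \<in> sets lebesgue" by (metis sets.Diff)
  define \<phi> where "\<phi> x = wgt x * indicator B x" for x
  define \<psi> where "\<psi> x = \<kappa> * (wgt x * indicator (f -` B) x)" for x
  have ennphi: "ennreal (\<phi> x) = ennreal (wgt x) * indicator B x" for x
    by (auto simp: \<phi>_def indicator_def)
  have B' [measurable]: "f -` B \<in> sets borel" using measurable_sets[OF f_measurable B] by simp
  have bm: "beam k l \<in> sets borel" using closed_beam by (rule borel_closed)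
  have "ennreal \<kappa> * (\<integral>\<^sup>+x. ennreal (wgt x) * indicator (beam k l \<inter> f -` B) x \<partial>lborel) =
     (\<integral>\<^sup>+x. ennreal \<kappa> * (ennreal (wgt x) * indicator (beam k l \<inter> f -` B) x) \<partial>lborel)"
    using bm by (subst nn_integral_cmult) auto
  also have "\<dots> \<le> (\<integral>\<^sup>+x. ennreal (\<psi> x) * indicator S x \<partial>lborel)"
  proof (rule nn_integral_mono_AE)
    show "AE x in lborel. ennreal \<kappa> * (ennreal (wgt x) * indicator (beam k l \<inter> f -` B) x) \<le> ennreal (\<psi> x) * indicator S x"
      using AE_not_negligible[OF negligible_beam_bad[of k l]]
    proof eventually_elim
      case (elim x)
      then show ?case
        using kappa_gt_1 wgt_nonneg[of x] by (auto simp: \<psi>_def S_def indicator_def ennreal_mult)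
    qed
  qed
  also have "\<dots> \<le> (\<integral>\<^sup>+x. ennreal (\<phi> x) * indicator (f ` S) x \<partial>lborel)"
  proof (rule nn_integral_change_of_variables_le[OF S, where g' = "jac k l"])
    show "\<phi> \<in> borel_measurable borel" unfolding \<phi>_def[abs_def] by measurable
    show "inj_on f S" using f_inj_beam SB by (rule inj_on_subset)
    show "(\<integral>\<^sup>+x. ennreal (\<phi> x) \<partial>lborel) < \<infinity>" using fin by (simp add: ennphi)
    show "\<phi> x \<ge> 0" for x by (simp add: \<phi>_def wgt_nonneg)
    fix x assume "x \<in> S"
    then have x: "x \<in> open_beam k l" "foot x \<in> diff_pts" by (auto simp: S_def)
    show "(f has_derivative jac k l x) (at x)" by (rule f_has_derivative[OF x])
    show "\<psi> x \<le> \<bar>det (matrix (jac k l x))\<bar> * \<phi> (f x)"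
    proof (cases "f x \<in> B")
      case True
      define a b E where "a = axdist x" and "b = axdist (f x)" and "E = exp (x $ 3)"
      have b: "b > 0" using off[OF True] axdist_nonneg[of "f x"] unfolding b_def by linarith
      have ba: "b \<le> L * E * a" unfolding a_def b_def E_def by (rule axdist_f)
      have E: "E > 0" by (simp add: E_def)
      have a: "a > 0"
      proof (rule ccontr)
        assume "\<not> a > 0"
        then have "a = 0" using axdist_nonneg[of x] unfolding a_def by linarith
        then show False using ba b by simp
      qed
      have "b ^ 3 \<le> (L * E * a) ^ 3" using ba b by (intro power_mono) auto
      then have "1 / a ^ 3 \<le> (L * E) ^ 3 / b ^ 3"
        using a b by (simp add: field_simps power_mult_distrib)
      then have "\<kappa> * (1 / a ^ 3) \<le> \<kappa> * ((L * E) ^ 3 / b ^ 3)"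
        using kappa_gt_1 by (intro mult_left_mono) auto
      also have "\<dots> = (E ^ 3 * (lam * m * sin \<theta> / L\<^sup>2)) * (1 / b ^ 3)"
        using L_pos by (simp add: \<kappa>_def power_mult_distrib field_simps eval_nat_numeral)
      also have "\<dots> \<le> \<bar>det (matrix (jac k l x))\<bar> * (1 / b ^ 3)"
        using det_jac_lower[OF x] b unfolding E_def by (intro mult_right_mono) auto
      finally show ?thesis using True by (simp add: \<psi>_def \<phi>_def wgt_def a_def b_def)
    qed (simp add: \<psi>_def \<phi>_def)
  qed
  also have "\<dots> \<le> (\<integral>\<^sup>+x. ennreal (wgt x) * indicator (B \<inter> {x. parity (k + l) * x $ 3 \<ge> 0}) x \<partial>lborel)"
    using f_sign SB by (intro nn_integral_mono) (auto simp: ennphi indicator_def)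
  finally show ?thesis .
qed

text \<open>The two half-spaces meet only in the null plane x3 = 0.\<close>

lemma two_beams_preimage_le:
  assumes B [measurable]: "B \<in> sets borel" and off: "\<And>x. x \<in> B \<Longrightarrow> axdist x \<noteq> 0"
    and fin: "(\<integral>\<^sup>+x. ennreal (wgt x) * indicator B x \<partial>lborel) < \<infinity>"
    and par: "odd (k + l + (k' + l'))"
  shows "ennreal \<kappa> * (\<integral>\<^sup>+x. ennreal (wgt x) * indicator ((beam k l \<union> beam k' l') \<inter> f -` B) x \<partial>lborel) \<le>
     (\<integral>\<^sup>+x. ennreal (wgt x) * indicator B x \<partial>lborel)"
proof -
  have par': "parity (k' + l') = - parity (k + l)" using par by (auto simp: parity_def)
  have B' [measurable]: "f -` B \<in> sets borel" using measurable_sets[OF f_measurable B] by simp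
  have bm [measurable]: "beam k l \<in> sets borel" for k l using closed_beam by (rule borel_closed)
  have hs [measurable]: "{x :: real^3. c * x $ 3 \<ge> 0} \<in> sets borel" for c
    by (intro borel_closed closed_Collect_le continuous_intros)
  let ?I = "\<lambda>k l. (\<integral>\<^sup>+x. ennreal (wgt x) * indicator (beam k l \<inter> f -` B) x \<partial>lborel)"
  let ?J = "\<lambda>k l. (\<integral>\<^sup>+x. ennreal (wgt x) * indicator (B \<inter> {x. parity (k + l) * x $ 3 \<ge> 0}) x \<partial>lborel)"
  have "(\<integral>\<^sup>+x. ennreal (wgt x) * indicator ((beam k l \<union> beam k' l') \<inter> f -` B) x \<partial>lborel) \<le>
     (\<integral>\<^sup>+x. ennreal (wgt x) * indicator (beam k l \<inter> f -` B) x + ennreal (wgt x) * indicator (beam k' l' \<inter> f -` B) x \<partial>lborel)"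
    by (intro nn_integral_mono) (auto simp: indicator_def)
  also have "\<dots> = ?I k l + ?I k' l'"
    by (intro nn_integral_add) measurable
  finally have "ennreal \<kappa> * (\<integral>\<^sup>+x. ennreal (wgt x) * indicator ((beam k l \<union> beam k' l') \<inter> f -` B) x \<partial>lborel) \<le>
      ennreal \<kappa> * (?I k l + ?I k' l')" by (rule mult_left_mono) simp
  also have "\<dots> = ennreal \<kappa> * ?I k l + ennreal \<kappa> * ?I k' l'" by (rule distrib_left)
  also have "\<dots> \<le> ?J k l + ?J k' l'"
    by (intro add_mono beam_preimage_le B off fin)
  also have "\<dots> = (\<integral>\<^sup>+x. ennreal (wgt x) * indicator (B \<inter> {x. parity (k + l) * x $ 3 \<ge> 0}) x +
      ennreal (wgt x) * indicator (B \<inter> {x. parity (k' + l') * x $ 3 \<ge> 0}) x \<partial>lborel)"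
    by (intro nn_integral_add[symmetric]) measurable
  also have "\<dots> \<le> (\<integral>\<^sup>+x. ennreal (wgt x) * indicator B x \<partial>lborel)"
  proof (rule nn_integral_mono_AE)
    show "AE x in lborel. ennreal (wgt x) * indicator (B \<inter> {x. parity (k + l) * x $ 3 \<ge> 0}) x +
      ennreal (wgt x) * indicator (B \<inter> {x. parity (k' + l') * x $ 3 \<ge> 0}) x \<le> ennreal (wgt x) * indicator B x"
      using AE_not_negligible[OF negligible_coordinate_plane[of 3 0]]
    proof eventually_elim
      case (elim x)
      have "parity (k + l) = 1 \<or> parity (k + l) = - 1" by (simp add: parity_def)
      then show ?case using elim by (auto simp: indicator_def par')
    qed
  qed
  finally show ?thesis .
qed

end

section \<open>Orbits off the diagonal planes\<close>

lemma connected_avoids_Ints: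
  fixes g :: "'a::topological_space \<Rightarrow> real"
  assumes "connected C" "continuous_on C g" "\<And>x. x \<in> C \<Longrightarrow> g x \<notin> \<int>"
  obtains i :: int where "\<And>x. x \<in> C \<Longrightarrow> of_int i < g x \<and> g x < of_int i + 1"
proof (cases "C = {}")
  case False
  then obtain x0 where x0: "x0 \<in> C" by blast
  define i where "i = \<lfloor>g x0\<rfloor>"
  have con: "connected (g ` C)" using assms by (intro connected_continuous_image)
  have nint: "of_int k \<notin> g ` C" for k :: int
  proof
    assume "of_int k \<in> g ` C"
    then obtain x where "x \<in> C" "g x = of_int k" by auto
    then show False using assms(3)[of x] by simp
  qed
  have i0: "of_int i < g x0" "g x0 < of_int i + 1"
  proof -
    have "of_int i \<le> g x0" "g x0 < of_int i + 1" unfolding i_def by linarith+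
    moreover have "g x0 \<noteq> of_int i" using nint[of i] x0 by force
    ultimately show "of_int i < g x0" "g x0 < of_int i + 1" by simp_all
  qed
  show ?thesis
  proof (rule that[of i])
    fix x assume x: "x \<in> C"
    have "of_int i < g x"
    proof (rule ccontr)
      assume "\<not> ?thesis"
      then have "of_int i \<in> g ` C"
        using connected_contains_Icc[OF con, of "g x" "g x0"] x x0 i0 by auto
      then show False using nint by blast
    qed
    moreover have "g x < of_int (i + 1)"
    proof (rule ccontr)
      assume "\<not> ?thesis"
      then have "of_int (i + 1) \<in> g ` C"
        using connected_contains_Icc[OF con, of "g x0" "g x"] x x0 i0 by auto
      then show False using nint by blast
    qed
    ultimately show "of_int i < g x \<and> g x < of_int i + 1" by simp
  qed
qed (use that in auto)

lemma AE_eventually_not_in: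
  assumes A: "\<And>n. A n \<in> sets M" and le: "\<And>n. emeasure M (A n) \<le> ennreal (C * q ^ n)"
    and q: "0 \<le> q" "q < 1" and C: "C \<ge> 0"
  shows "AE x in M. \<exists>N. \<forall>n\<ge>N. x \<notin> A n"
proof -
  have fin: "emeasure M (A n) < \<infinity>" for n
    using le[of n] by (rule le_less_trans) simp
  have mle: "measure M (A n) \<le> C * q ^ n" for n
    using le[of n] C q unfolding measure_def by (intro enn2real_leI) auto
  have sq: "summable (\<lambda>n. C * q ^ n)"
    using q by (intro summable_mult summable_geometric) simp
  have "summable (\<lambda>n. measure M (A n))"
  proof (rule summable_comparison_test'[OF sq])
    show "norm (measure M (A n)) \<le> C * q ^ n" for n using mle[of n] by simp
  qed
  from borel_cantelli_AE1[OF A fin this] show ?thesis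
    by eventually_elim (auto simp: eventually_sequentially)
qed

context zorich_surface
begin

text \<open>The vertical planes through the diagonals of the cross-sections of all beams. Their
  intersection lines include all axial lines.\<close>

definition diag_planes :: "(real^3) set" where
  "diag_planes = {x. (x $ 1 + x $ 2) / (2 * lam) \<in> \<int> \<or> (x $ 1 - x $ 2) / (2 * lam) \<in> \<int>}"

text \<open>The complement consists of prisms over squares turned by 45 degrees, each cut in half by
  the common face of two neighbouring beams. The parity of i + j decides in which direction these
  are adjacent.\<close>

lemma connected_off_diag_planes:
  assumes C: "connected C" "C \<inter> diag_planes = {}"
  obtains k l k' l' where "odd (k + l + (k' + l'))" "C \<subseteq> beam k l \<union> beam k' l'"
proof -
  obtain i :: int where i: "\<And>x. x \<in> C \<Longrightarrow> of_int i < (x $ 1 + x $ 2) / (2 * lam) \<and> (x $ 1 + x $ 2) / (2 * lam) < of_int i + 1"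
    by (rule connected_avoids_Ints[OF C(1), of "\<lambda>x. (x $ 1 + x $ 2) / (2 * lam)"])
      (use C(2) lam_pos in \<open>auto simp: diag_planes_def intro!: continuous_intros\<close>)
  obtain j :: int where j: "\<And>x. x \<in> C \<Longrightarrow> of_int j < (x $ 1 - x $ 2) / (2 * lam) \<and> (x $ 1 - x $ 2) / (2 * lam) < of_int j + 1"
    by (rule connected_avoids_Ints[OF C(1), of "\<lambda>x. (x $ 1 - x $ 2) / (2 * lam)"])
      (use C(2) lam_pos in \<open>auto simp: diag_planes_def intro!: continuous_intros\<close>)
  have b: "lam * of_int (i + j) < x $ 1 \<and> x $ 1 < lam * of_int (i + j + 2) \<and>
     lam * of_int (i - j - 1) < x $ 2 \<and> x $ 2 < lam * of_int (i - j + 1)" if "x \<in> C" for x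
    using i[OF that] j[OF that] lam_pos by (simp add: field_simps)
  show ?thesis
  proof (cases "even (i + j)")
    case True
    then obtain k where k: "i + j = 2 * k" by blast
    define l where "l = i - k"
    have l: "i - j = 2 * l" using k by (simp add: l_def)
    have "C \<subseteq> beam k l \<union> beam (k + 1) l"
    proof
      fix x assume "x \<in> C"
      from b[OF this] show "x \<in> beam k l \<union> beam (k + 1) l"
        unfolding k l by (auto simp: beam_def abs_le_iff algebra_simps)
    qed
    then show ?thesis by (intro that[of k l "k + 1" l]) auto
  next
    case False
    then obtain k where k: "i + j = 2 * k + 1" by (elim oddE)
    define l where "l = i - k - 1"
    have l: "i - j = 2 * l + 1" using k by (simp add: l_def)
    have "C \<subseteq> beam (k + 1) l \<union> beam (k + 1) (l + 1)"
    proof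
      fix x assume "x \<in> C"
      from b[OF this] show "x \<in> beam (k + 1) l \<union> beam (k + 1) (l + 1)"
        unfolding k l by (auto simp: beam_def abs_le_iff algebra_simps)
    qed
    then show ?thesis by (intro that[of "k + 1" l "k + 1" "l + 1"]) auto
  qed
qed

text \<open>The last step is peeled off by pulling \<open>B\<close> back. The pulled-back set still
  avoids the axial lines because \<open>f\<close> maps these into the axis, which is axial
  itself.\<close>

lemma itinerary_measure_le:
  fixes A :: "nat \<Rightarrow> (real^3) set"
  assumes A: "\<And>j. \<exists>k l k' l'. odd (k + l + (k' + l')) \<and> A j = beam k l \<union> beam k' l'"
    and "B \<in> sets borel" "\<And>x. x \<in> B \<Longrightarrow> axdist x \<noteq> 0"
    and "(\<integral>\<^sup>+x. ennreal (wgt x) * indicator B x \<partial>lborel) < \<infinity>"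
  shows "ennreal (\<kappa> ^ n) * (\<integral>\<^sup>+x. ennreal (wgt x) * indicator {x. (\<forall>j<n. (f ^^ j) x \<in> A j) \<and> (f ^^ n) x \<in> B} x \<partial>lborel) \<le>
     (\<integral>\<^sup>+x. ennreal (wgt x) * indicator B x \<partial>lborel)"
  using assms(2-4)
proof (induction n arbitrary: B)
  case 0
  then show ?case by simp
next
  case (Suc n)
  obtain k l k' l' where kl: "odd (k + l + (k' + l'))" "A n = beam k l \<union> beam k' l'" using A by blast
  define B' where "B' = A n \<inter> f -` B"
  have one: "ennreal \<kappa> * (\<integral>\<^sup>+x. ennreal (wgt x) * indicator B' x \<partial>lborel) \<le>
     (\<integral>\<^sup>+x. ennreal (wgt x) * indicator B x \<partial>lborel)"
    unfolding B'_def kl(2) by (rule two_beams_preimage_le[OF Suc.prems kl(1)])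
  have fB: "f -` B \<in> sets borel" using measurable_sets[OF f_measurable Suc.prems(1)] by simp
  then have B'1: "B' \<in> sets borel"
    unfolding B'_def kl(2) by (intro sets.Int sets.Un borel_closed[OF closed_beam])
  have B'2: "axdist x \<noteq> 0" if "x \<in> B'" for x
  proof
    assume "axdist x = 0"
    then have "axdist (f x) \<le> 0" using axdist_f[of x] by simp
    then have "axdist (f x) = 0" using axdist_nonneg[of "f x"] by linarith
    then show False using Suc.prems(2)[of "f x"] that by (simp add: B'_def)
  qed
  have le1: "(\<integral>\<^sup>+x. ennreal (wgt x) * indicator B' x \<partial>lborel) \<le> ennreal \<kappa> * (\<integral>\<^sup>+x. ennreal (wgt x) * indicator B' x \<partial>lborel)"
  proof -
    have "ennreal 1 \<le> ennreal \<kappa>" using kappa_gt_1 by (intro ennreal_leI) simp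
    from mult_right_mono[OF this, of "\<integral>\<^sup>+x. ennreal (wgt x) * indicator B' x \<partial>lborel"] show ?thesis by simp
  qed
  then have B'3: "(\<integral>\<^sup>+x. ennreal (wgt x) * indicator B' x \<partial>lborel) < \<infinity>"
    using one Suc.prems(3) by (meson order_le_less_trans)
  have eq: "{x. (\<forall>j<Suc n. (f ^^ j) x \<in> A j) \<and> (f ^^ Suc n) x \<in> B} = {x. (\<forall>j<n. (f ^^ j) x \<in> A j) \<and> (f ^^ n) x \<in> B'}"
    by (auto simp: B'_def less_Suc_eq)
  have "ennreal (\<kappa> ^ Suc n) = ennreal \<kappa> * ennreal (\<kappa> ^ n)" using kappa_gt_1 by (simp add: ennreal_mult)
  then have "ennreal (\<kappa> ^ Suc n) * (\<integral>\<^sup>+x. ennreal (wgt x) * indicator {x. (\<forall>j<Suc n. (f ^^ j) x \<in> A j) \<and> (f ^^ Suc n) x \<in> B} x \<partial>lborel) =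
    ennreal \<kappa> * (ennreal (\<kappa> ^ n) * (\<integral>\<^sup>+x. ennreal (wgt x) * indicator {x. (\<forall>j<n. (f ^^ j) x \<in> A j) \<and> (f ^^ n) x \<in> B'} x \<partial>lborel))"
    unfolding eq by (simp only: mult.assoc)
  also have "\<dots> \<le> ennreal \<kappa> * (\<integral>\<^sup>+x. ennreal (wgt x) * indicator B' x \<partial>lborel)"
    by (intro mult_left_mono Suc.IH B'1 B'2 B'3) auto
  also note one
  finally show ?case .
qed

text \<open>Since \<open>axdist\<close> is at most 2 * lam, the condition with \<open>\<eta>\<close>
  bounds the height from below; with the height at most H it also bounds \<open>axdist\<close> away
  from 0. What remains is a box of fixed size with bounded weight, up to translation the same for
  all beams.\<close>

lemma weighted_measure_slab:
  assumes \<eta>: "\<eta> > 0"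
  obtains C where "C \<ge> 0" "\<And>k l. (\<integral>\<^sup>+x. ennreal (wgt x) *
      indicator (beam k l \<inter> {x. x $ 3 \<le> H \<and> \<eta> \<le> L * exp (x $ 3) * axdist x}) x \<partial>lborel) \<le> ennreal C"
proof -
  define a where "a = ln (\<eta> / (2 * L * lam))"
  define \<delta> where "\<delta> = \<eta> / (L * exp H)"
  have \<delta>: "\<delta> > 0" using \<eta> L_pos by (simp add: \<delta>_def)
  define d :: "real^3" where "d = vector [2 * lam, 2 * lam, max 0 (H - a)]"
  define C where "C = 1 / \<delta> ^ 3 * (\<Prod>b\<in>Basis. d \<bullet> b)"
  have d0: "d \<bullet> b \<ge> 0" if b: "b \<in> Basis" for b
  proof -
    have "\<forall>i. d $ i \<ge> 0" using lam_pos by (simp add: forall_3 d_def)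
    moreover obtain i where "b = axis i 1" using b by (auto simp: Basis_vec_def)
    ultimately show ?thesis by (simp add: inner_axis)
  qed
  show ?thesis
  proof (rule that[of C])
    show "C \<ge> 0" unfolding C_def using \<delta> d0 by (intro mult_nonneg_nonneg prod_nonneg) auto
    fix k l :: int
    define p :: "real^3" where "p = vector [(2 * real_of_int k - 1) * lam, (2 * real_of_int l - 1) * lam, a]"
    have K: "x \<in> cbox p (p + d) \<and> wgt x \<le> 1 / \<delta> ^ 3"
      if x: "x \<in> beam k l" "x $ 3 \<le> H" "\<eta> \<le> L * exp (x $ 3) * axdist x" for x
    proof
      have "\<eta> \<le> L * exp (x $ 3) * (2 * lam)"
        using x(3) axdist_le[of x] L_pos by (intro order_trans[OF x(3)] mult_left_mono) auto
      then have "\<eta> / (2 * L * lam) \<le> exp (x $ 3)" using L_pos lam_pos by (simp add: field_simps)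
      moreover have "exp a = \<eta> / (2 * L * lam)" unfolding a_def using \<eta> L_pos lam_pos by (intro exp_ln) simp
      ultimately have "exp a \<le> exp (x $ 3)" by simp
      then have "a \<le> x $ 3" by simp
      then show "x \<in> cbox p (p + d)"
        using x by (auto simp: mem_box_cart forall_3 p_def d_def beam_def abs_le_iff algebra_simps max_def)
      have "\<eta> \<le> L * exp H * axdist x"
        using x L_pos by (intro order_trans[OF x(3)] mult_right_mono mult_left_mono) auto
      then have "\<delta> \<le> axdist x" using L_pos by (simp add: \<delta>_def field_simps)
      then have "\<delta> ^ 3 \<le> axdist x ^ 3" using \<delta> by (intro power_mono) auto
      then show "wgt x \<le> 1 / \<delta> ^ 3"
        unfolding wgt_def using \<delta> by (intro divide_left_mono mult_pos_pos zero_less_power) (auto intro: less_le_trans[OF _ \<open>\<delta> \<le> axdist x\<close>])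
    qed
    have "(\<integral>\<^sup>+x. ennreal (wgt x) * indicator (beam k l \<inter> {x. x $ 3 \<le> H \<and> \<eta> \<le> L * exp (x $ 3) * axdist x}) x \<partial>lborel) \<le>
      (\<integral>\<^sup>+x. ennreal (1 / \<delta> ^ 3) * indicator (cbox p (p + d)) x \<partial>lborel)"
      using K by (intro nn_integral_mono) (auto simp: indicator_def intro!: ennreal_leI)
    also have "\<dots> = ennreal (1 / \<delta> ^ 3) * emeasure lborel (cbox p (p + d))"
      by (rule nn_integral_cmult_indicator) simp
    also have "emeasure lborel (cbox p (p + d)) = ennreal (\<Prod>b\<in>Basis. d \<bullet> b)"
      using d0 by (subst emeasure_lborel_cbox) (auto simp: inner_add_left)
    also have "ennreal (1 / \<delta> ^ 3) * ennreal (\<Prod>b\<in>Basis. d \<bullet> b) = ennreal C"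
      unfolding C_def using \<delta> d0 by (subst ennreal_mult[symmetric]) (auto intro: prod_nonneg)
    finally show "(\<integral>\<^sup>+x. ennreal (wgt x) * indicator (beam k l \<inter> {x. x $ 3 \<le> H \<and> \<eta> \<le> L * exp (x $ 3) * axdist x}) x \<partial>lborel) \<le> ennreal C" .
  qed
qed

lemma funpow_f_measurable [measurable]: "f ^^ n \<in> borel_measurable borel"
  by (induction n) (auto intro: measurable_comp[OF _ f_measurable])

text \<open>While the images avoid the diagonal planes they stay in one prism, so the weighted measure
  is expanded by \<open>\<kappa>\<close> at each step and Borel-Cantelli applies to every set of finite weight.\<close>
lemma exists_orbit_high_or_near_axis:
  assumes U: "open U" "connected U" "U \<noteq> {}" and ax: "\<And>n y. y \<in> U \<Longrightarrow> axdist ((f ^^ n) y) \<noteq> 0"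
    and off: "\<And>n y. y \<in> U \<Longrightarrow> (f ^^ n) y \<notin> diag_planes" and \<eta>: "\<eta> > 0"
  obtains x N where "x \<in> U"
    "\<And>n. n \<ge> N \<Longrightarrow> H < ((f ^^ n) x) $ 3 \<or> L * exp (((f ^^ n) x) $ 3) * axdist ((f ^^ n) x) < \<eta>"
proof -
  define K where "K = {x. x $ 3 \<le> H \<and> \<eta> \<le> L * exp (x $ 3) * axdist x}"
  have Kclosed: "closed K"
    unfolding K_def by (intro closed_Collect_conj closed_Collect_le continuous_intros axdist_continuous)
  have Kax: "axdist x \<noteq> 0" if "x \<in> K" for x using that \<eta> by (auto simp: K_def)
  obtain C where C: "C \<ge> 0" "\<And>k l. (\<integral>\<^sup>+x. ennreal (wgt x) * indicator (beam k l \<inter> K) x \<partial>lborel) \<le> ennreal C"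
    using weighted_measure_slab[OF \<eta>, of H] unfolding K_def by blast
  have fn: "continuous_on UNIV (f ^^ n)" for n
    by (induction n) (auto intro: continuous_on_compose[OF _ continuous_on_subset[OF f_continuous]] simp del: o_apply)
  have "\<exists>k l k' l'. odd (k + l + (k' + l')) \<and> (f ^^ j) ` U \<subseteq> beam k l \<union> beam k' l'" for j
  proof -
    have "connected ((f ^^ j) ` U)" using U(2) fn continuous_on_subset by (intro connected_continuous_image) blast+
    moreover have "(f ^^ j) ` U \<inter> diag_planes = {}" using off by blast
    ultimately show ?thesis using connected_off_diag_planes by metis
  qed
  then obtain a b a' b' where ab: "\<And>j. odd (a j + b j + (a' j + b' j))" "\<And>j. (f ^^ j) ` U \<subseteq> beam (a j) (b j) \<union> beam (a' j) (b' j)"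
    by metis
  define A where "A j = beam (a j) (b j) \<union> beam (a' j) (b' j)" for j
  have A: "\<exists>k l k' l'. odd (k + l + (k' + l')) \<and> A j = beam k l \<union> beam k' l'" for j
    using ab(1) A_def by blast
  have AK: "A n \<inter> K \<in> sets borel" for n
    unfolding A_def by (intro sets.Int sets.Un borel_closed closed_beam Kclosed)
  have KA: "(\<integral>\<^sup>+x. ennreal (wgt x) * indicator (A n \<inter> K) x \<partial>lborel) \<le> ennreal (2 * C)" for n
  proof -
    have [measurable]: "beam k l \<inter> K \<in> sets borel" for k l
      by (intro sets.Int borel_closed closed_beam Kclosed)
    have "(\<integral>\<^sup>+x. ennreal (wgt x) * indicator (A n \<inter> K) x \<partial>lborel) \<le>
      (\<integral>\<^sup>+x. ennreal (wgt x) * indicator (beam (a n) (b n) \<inter> K) x + ennreal (wgt x) * indicator (beam (a' n) (b' n) \<inter> K) x \<partial>lborel)"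
      by (intro nn_integral_mono) (auto simp: A_def indicator_def)
    also have "\<dots> = (\<integral>\<^sup>+x. ennreal (wgt x) * indicator (beam (a n) (b n) \<inter> K) x \<partial>lborel) +
        (\<integral>\<^sup>+x. ennreal (wgt x) * indicator (beam (a' n) (b' n) \<inter> K) x \<partial>lborel)"
      by (intro nn_integral_add) measurable
    also have "\<dots> \<le> ennreal C + ennreal C" by (intro add_mono C)
    also have "\<dots> = ennreal (2 * C)" using C(1) by (simp flip: ennreal_plus)
    finally show ?thesis .
  qed
  define M where "M = density lborel (\<lambda>x. ennreal (wgt x))"
  \<comment> \<open>Starting points that violate the required alternative at time n; their weight
    decays like the powers of 1 / \<open>\<kappa>\<close>.\<close>
  define E where "E n = U \<inter> (f ^^ n) -` K" for n
  have fK: "(f ^^ n) -` B \<in> sets borel" if "B \<in> sets borel" for n B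
    using measurable_sets[OF funpow_f_measurable that] by simp
  have E: "E n \<in> sets borel" for n
    unfolding E_def by (intro sets.Int fK borel_closed[OF Kclosed] borel_open[OF U(1)])
  have "emeasure M (E n) \<le> ennreal (2 * C * (1 / \<kappa>) ^ n)" for n
  proof -
    define P where "P = {x. (\<forall>j<n. (f ^^ j) x \<in> A j) \<and> (f ^^ n) x \<in> A n \<inter> K}"
    have EP: "E n \<subseteq> P" using ab(2) by (auto simp: E_def P_def A_def)
    have "emeasure M (E n) = (\<integral>\<^sup>+x. ennreal (wgt x) * indicator (E n) x \<partial>lborel)"
      unfolding M_def using E by (subst emeasure_density) auto
    also have "\<dots> \<le> (\<integral>\<^sup>+x. ennreal (wgt x) * indicator P x \<partial>lborel)"
      using EP by (intro nn_integral_mono) (auto simp: indicator_def)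
    finally have "ennreal (\<kappa> ^ n) * emeasure M (E n) \<le> ennreal (\<kappa> ^ n) * (\<integral>\<^sup>+x. ennreal (wgt x) * indicator P x \<partial>lborel)"
      by (rule mult_left_mono) simp
    also have "\<dots> \<le> (\<integral>\<^sup>+x. ennreal (wgt x) * indicator (A n \<inter> K) x \<partial>lborel)"
      unfolding P_def using Kax KA[of n] by (intro itinerary_measure_le[OF A AK]) (auto intro: le_less_trans)
    also note KA
    finally have *: "ennreal (\<kappa> ^ n) * emeasure M (E n) \<le> ennreal (2 * C)" .
    have "emeasure M (E n) = ennreal ((1 / \<kappa>) ^ n) * (ennreal (\<kappa> ^ n) * emeasure M (E n))"
      using kappa_gt_1 by (simp add: mult.assoc[symmetric] ennreal_mult[symmetric] power_divide)
    also have "\<dots> \<le> ennreal ((1 / \<kappa>) ^ n) * ennreal (2 * C)" by (rule mult_left_mono[OF *]) simp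
    also have "\<dots> = ennreal (2 * C * (1 / \<kappa>) ^ n)"
      using C(1) kappa_gt_1 by (simp add: ennreal_mult[symmetric] mult.commute)
    finally show ?thesis .
  qed
  then have "AE x in M. \<exists>N. \<forall>n\<ge>N. x \<notin> E n"
    using E kappa_gt_1 C(1) by (intro AE_eventually_not_in[where C = "2 * C" and q = "1 / \<kappa>"]) (auto simp: M_def)
  then have ae: "AE x in lborel. 0 < ennreal (wgt x) \<longrightarrow> (\<exists>N. \<forall>n\<ge>N. x \<notin> E n)"
    unfolding M_def by (subst (asm) AE_density) auto
  have "\<exists>x\<in>U. \<exists>N. \<forall>n\<ge>N. x \<notin> E n"
  proof (rule ccontr)
    assume neg: "\<not> ?thesis"
    \<comment> \<open>The exceptional set is null for the weight. As U has no axial point, the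
      weight is positive on U and the set is null for Lebesgue measure too.\<close>
    have "0 < wgt x" if "x \<in> U" for x
      using ax[OF that, of 0] axdist_nonneg[of x] by (auto simp: wgt_def less_le)
    then have "AE x in lborel. x \<notin> U" using ae neg by (auto elim!: eventually_mono)
    then have "negligible U"
      using U(1) by (simp add: AE_iff_null_sets[symmetric] negligible_iff_null_sets null_sets_completionI)
    then show False using U open_not_negligible by blast
  qed
  then obtain x N where x: "x \<in> U" "\<And>n. n \<ge> N \<Longrightarrow> x \<notin> E n" by blast
  show ?thesis
    by (rule that[OF x(1), of N]) (use x in \<open>force simp: E_def K_def\<close>)
qed

text \<open>From time N on, the orbit found by Borel-Cantelli satisfies the hypotheses of
  \<open>expansion_step\<close>. Its gains of 1 repeat forever, against
  \<open>expansion_bounded\<close>.\<close>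

lemma meets_diag_planes:
  assumes U: "open U" "connected U" "U \<noteq> {}" and ax: "\<And>n y. y \<in> U \<Longrightarrow> axdist ((f ^^ n) y) \<noteq> 0"
  shows "\<exists>n. \<exists>y\<in>U. (f ^^ n) y \<in> diag_planes"
proof (rule ccontr)
  assume "\<not> ?thesis"
  then have off: "\<And>n y. y \<in> U \<Longrightarrow> (f ^^ n) y \<notin> diag_planes" by blast
  obtain c where c: "\<And>U x. open U \<Longrightarrow> x \<in> U \<Longrightarrow> (\<And>n y. y \<in> U \<Longrightarrow> axdist ((f ^^ n) y) \<noteq> 0) \<Longrightarrow>
    \<exists>B. \<forall>n. (\<Sum>j<n. ((f ^^ j) x) $ 3 + c) \<le> B"
    using expansion_bounded by metis
  show False
  proof (rule expansion_step[OF L_ge_1 lam_ge, of c])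
    fix H \<eta> :: real
    assume \<eta>: "0 < \<eta>" and step:
      "\<And>t p e :: nat \<Rightarrow> real. \<And>n.
         (\<And>j. n \<le> j \<Longrightarrow> 0 < e j \<and> e j \<le> 2 * lam \<and> e j \<le> p j) \<Longrightarrow>
         (\<And>j. n \<le> j \<Longrightarrow> p (Suc j) \<le> L * exp (t j) * e j) \<Longrightarrow>
         (\<And>j. n \<le> j \<Longrightarrow> p j \<le> lam \<Longrightarrow> t (Suc j) \<ge> exp (t j) * (lam - L * p j)) \<Longrightarrow>
         (\<And>j. n \<le> j \<Longrightarrow> H < t j \<or> L * exp (t j) * e j < \<eta>) \<Longrightarrow>
         \<exists>n'>n. (\<Sum>j<n'. t j + c) \<ge> (\<Sum>j<n. t j + c) + 1"
    obtain x N where x: "x \<in> U"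
      "\<And>n. n \<ge> N \<Longrightarrow> H < ((f ^^ n) x) $ 3 \<or> L * exp (((f ^^ n) x) $ 3) * axdist ((f ^^ n) x) < \<eta>"
      using exists_orbit_high_or_near_axis[OF U ax off \<eta>] by metis
    obtain B where B: "\<And>n. (\<Sum>j<n. ((f ^^ j) x) $ 3 + c) \<le> B" using c[OF U(1) x(1) ax] by blast
    define S where "S n = (\<Sum>j<n. ((f ^^ j) x) $ 3 + c)" for n
    have inc: "\<exists>n'>n. S n' \<ge> S n + 1" if "n \<ge> N" for n
      unfolding S_def
    proof (rule step[where p = "\<lambda>j. pdist ((f ^^ j) x)" and e = "\<lambda>j. axdist ((f ^^ j) x)"])
      fix j assume "n \<le> j"
      then have "N \<le> j" using that by simp
      show "0 < axdist ((f ^^ j) x) \<and> axdist ((f ^^ j) x) \<le> 2 * lam \<and> axdist ((f ^^ j) x) \<le> pdist ((f ^^ j) x)"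
        using ax[OF x(1), of j] axdist_nonneg[of "(f ^^ j) x"] axdist_le axdist_le_pdist by (simp add: less_le)
      show "pdist ((f ^^ Suc j) x) \<le> L * exp (((f ^^ j) x) $ 3) * axdist ((f ^^ j) x)"
        using pdist_f[of "(f ^^ j) x"] by simp
      show "((f ^^ Suc j) x) $ 3 \<ge> exp (((f ^^ j) x) $ 3) * (lam - L * pdist ((f ^^ j) x))" if "pdist ((f ^^ j) x) \<le> lam"
        using f_climb[OF that] by simp
      show "H < ((f ^^ j) x) $ 3 \<or> L * exp (((f ^^ j) x) $ 3) * axdist ((f ^^ j) x) < \<eta>"
        by (rule x(2)[OF \<open>N \<le> j\<close>])
    qed
    have "\<exists>n\<ge>N. S n \<ge> S N + real k" for k
    proof (induction k)
      case (Suc k)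
      then obtain n where n: "n \<ge> N" "S n \<ge> S N + real k" by blast
      obtain n' where "n' > n" "S n' \<ge> S n + 1" using inc[OF n(1)] by blast
      then show ?case using n by (intro exI[of _ n']) auto
    qed auto
    moreover obtain k :: nat where "real k > B - S N" using reals_Archimedean2 by blast
    ultimately obtain n where "S n \<ge> S N + real k" by blast
    then show False using B[of n] \<open>real k > B - S N\<close> by (simp add: S_def)
  qed
qed

end

section \<open>Orbits in the diagonal planes\<close>

lemma emeasure_lborel_reflect_fst:
  fixes B :: "(real \<times> real) set"
  assumes B: "B \<in> sets borel"
  shows "emeasure lborel {(x, y). (- x, y) \<in> B} = emeasure lborel B"
proof -
  have pr: "sets (lborel \<Otimes>\<^sub>M lborel) = sets (borel :: (real \<times> real) measure)"
    unfolding lborel_prod by simp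
  have B2: "B \<in> sets (lborel \<Otimes>\<^sub>M lborel)" using B unfolding pr .
  have B'2: "{(x, y). (- x, y) \<in> B} \<in> sets (lborel \<Otimes>\<^sub>M lborel)"
  proof -
    have "(\<lambda>z::real \<times> real. (- fst z, snd z)) \<in> borel_measurable borel"
      by (intro borel_measurable_continuous_onI continuous_intros)
    from measurable_sets[OF this B] show ?thesis unfolding pr by (simp add: vimage_def case_prod_beta')
  qed
  define F where "F x = emeasure lborel (Pair x -` B)" for x
  have F: "F \<in> borel_measurable borel"
    using lborel.measurable_emeasure_Pair[OF B2] by (simp add: F_def[abs_def])
  have "emeasure lborel {(x, y). (- x, y) \<in> B} = (\<integral>\<^sup>+x. emeasure lborel (Pair x -` {(x, y). (- x, y) \<in> B}) \<partial>lborel)"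
    unfolding lborel_prod[symmetric] by (rule lborel.emeasure_pair_measure_alt[OF B'2])
  also have "\<dots> = (\<integral>\<^sup>+x. F (- x) \<partial>lborel)"
    by (intro nn_integral_cong) (simp add: F_def vimage_def)
  also have "\<dots> = (\<integral>\<^sup>+x. F x \<partial>distr lborel borel uminus)"
    using F by (subst nn_integral_distr) auto
  also have "\<dots> = (\<integral>\<^sup>+x. F x \<partial>lborel)" by (simp add: lborel_distr_uminus)
  also have "\<dots> = emeasure lborel B"
    unfolding lborel_prod[symmetric] F_def by (rule lborel.emeasure_pair_measure_alt[OF B2, symmetric])
  finally show ?thesis .
qed

context zorich_surface
begin

section \<open>The map \<open>f\<close> in coordinates of a diagonal plane\<close>

definition diag_foot :: "real \<Rightarrow> real \<Rightarrow> real^2" where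
  "diag_foot \<sigma> s = vector [T s / lam, \<sigma> * T s / lam]"

definition plane_pt :: "real \<Rightarrow> real \<times> real \<Rightarrow> real^3" where
  "plane_pt \<sigma> z = vector [fst z, \<sigma> * fst z, snd z]"

text \<open>\<open>f\<close> in the coordinates x1 and x3 of the plane. No sign appears since every
  point of the plane lies in a beam with even index sum.\<close>

definition plane_map :: "real \<Rightarrow> real \<times> real \<Rightarrow> real \<times> real" where
  "plane_map \<sigma> z = (exp (snd z) * (lam * h (diag_foot \<sigma> (fst z)) $ 1), exp (snd z) * (lam * h (diag_foot \<sigma> (fst z)) $ 3))"

lemma T_shift: "T (s + 2 * real_of_int i * lam) = parity i * T s"
proof -
  let ?k = "fold_idx lam s"
  have e: "s + 2 * real_of_int i * lam - 2 * real_of_int (?k + i) * lam = s - 2 * real_of_int ?k * lam"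
    by (simp add: algebra_simps)
  have "T (s + 2 * real_of_int i * lam) = parity (?k + i) * (s - 2 * real_of_int ?k * lam)"
    using T_eq[of "s + 2 * real_of_int i * lam" "?k + i"] near_even[of s] unfolding e by blast
  also have "\<dots> = parity i * T s"
    unfolding T_eq[OF near_even[of s]] parity_add by (simp only: mult_ac)
  finally show ?thesis .
qed

lemma sign_mult_T: "\<bar>\<sigma>\<bar> = 1 \<Longrightarrow> T (\<sigma> * s) = \<sigma> * T s"
  by (auto simp: abs_if T_minus split: if_splits)

lemma diag_foot_in: "\<bar>\<sigma>\<bar> = 1 \<Longrightarrow> diag_foot \<sigma> s \<in> sqQ"
  using T_bound[of s] lam_pos by (simp add: in_sqQ diag_foot_def abs_mult)

lemma h_diag:
  assumes "\<bar>\<sigma>\<bar> = 1" "a \<in> sqQ" "a $ 2 = \<sigma> * a $ 1"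
  shows "h a $ 2 = \<sigma> * h a $ 1"
proof -
  have a1: "a $ 1 \<in> {-1..1}" using assms(2) by (auto simp: in_sqQ abs_le_iff)
  have "a = vector [a $ 1, \<sigma> * a $ 1]" using assms(3) by (simp add: vec_eq_iff forall_2)
  moreover have "\<sigma> = 1 \<or> \<sigma> = - 1" using assms(1) by auto
  ultimately show ?thesis using diag1 diag2 a1 by (metis minus_minus mult_1 mult_minus1)
qed

lemma h_diag_foot: "\<bar>\<sigma>\<bar> = 1 \<Longrightarrow> h (diag_foot \<sigma> s) $ 2 = \<sigma> * h (diag_foot \<sigma> s) $ 1"
  by (rule h_diag) (auto simp: diag_foot_in, simp add: diag_foot_def)

lemma f_plane_pt:
  assumes \<sigma>: "\<bar>\<sigma>\<bar> = 1"
  shows "f (plane_pt \<sigma> z) = plane_pt \<sigma> (plane_map \<sigma> z)"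
proof -
  define k where "k = fold_idx lam (fst z)"
  have k: "\<bar>fst z - 2 * real_of_int k * lam\<bar> \<le> lam" unfolding k_def by (rule near_even)
  have \<sigma>': "\<sigma> = 1 \<or> \<sigma> = - 1" using \<sigma> by auto
  \<comment> \<open>The choice is l = \<open>\<sigma>\<close> * k, which makes k + l even.\<close>
  then obtain l where l: "even (k + l)" "\<bar>\<sigma> * fst z - 2 * real_of_int l * lam\<bar> \<le> lam"
  proof
    assume "\<sigma> = - 1"
    then show ?thesis using k by (intro that[of "- k"]) (auto simp: abs_le_iff)
  qed (use k that[of k] in auto)
  have "plane_pt \<sigma> z \<in> beam k l" using k l by (simp add: beam_def plane_pt_def)
  moreover have "foot (plane_pt \<sigma> z) = diag_foot \<sigma> (fst z)"
    using sign_mult_T[OF \<sigma>] by (simp add: foot_def diag_foot_def plane_pt_def)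
  ultimately have "f (plane_pt \<sigma> z) = reflect_if_odd (k + l) ((exp (snd z) * lam) *\<^sub>R h (diag_foot \<sigma> (fst z)))"
    using f_beam[of "plane_pt \<sigma> z" k l] by (simp add: plane_pt_def)
  then show ?thesis
    using l(1) h_diag_foot[OF \<sigma>, of "fst z"]
    by (simp add: plane_pt_def plane_map_def vec_eq_iff forall_3 parity_def mult_ac)
qed

lemma funpow_plane_pt:
  assumes "\<bar>\<sigma>\<bar> = 1"
  shows "(f ^^ n) (plane_pt \<sigma> z) = plane_pt \<sigma> ((plane_map \<sigma> ^^ n) z)"
  by (induction n) (simp_all add: f_plane_pt[OF assms])

text \<open>Folding carries every diagonal plane to one of the two diagonals of the square; the
  parity of the shift enters the sign.\<close>

lemma f_diag_planes:
  assumes "x \<in> diag_planes"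
  obtains \<sigma> z where "\<bar>\<sigma>\<bar> = 1" "f x = plane_pt \<sigma> z"
proof -
  have "\<exists>\<sigma>. \<bar>\<sigma>\<bar> = 1 \<and> T (x $ 2) = \<sigma> * T (x $ 1)"
  proof -
    consider i :: int where "(x $ 1 + x $ 2) / (2 * lam) = of_int i" | i :: int where "(x $ 1 - x $ 2) / (2 * lam) = of_int i"
      using assms by (auto simp: diag_planes_def Ints_def)
    then show ?thesis
    proof cases
      case 1
      then have "x $ 2 = - x $ 1 + 2 * real_of_int i * lam" using lam_pos by (simp add: field_simps)
      then have "T (x $ 2) = - parity i * T (x $ 1)" using T_shift[of "- x $ 1" i] T_minus[of "x $ 1"] by simp
      then show ?thesis by (intro exI[of _ "- parity i"]) simp
    next
      case 2
      then have "x $ 2 = x $ 1 + 2 * real_of_int (- i) * lam" using lam_pos by (simp add: field_simps)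
      then have "T (x $ 2) = parity (- i) * T (x $ 1)" using T_shift[of "x $ 1" "- i"] by simp
      then show ?thesis by (intro exI[of _ "parity (- i)"]) simp
    qed
  qed
  then obtain \<sigma> where \<sigma>: "\<bar>\<sigma>\<bar> = 1" "T (x $ 2) = \<sigma> * T (x $ 1)" by blast
  have "h (foot x) $ 2 = \<sigma> * h (foot x) $ 1"
    using \<sigma> by (intro h_diag foot_in) (simp_all add: foot_def)
  then have "f x = plane_pt \<sigma> (f x $ 1, f x $ 3)"
    by (simp add: f_eq_idx plane_pt_def vec_eq_iff forall_3)
  then show ?thesis by (rule that[OF \<sigma>(1)])
qed

text \<open>For vectors in the plane Lagrange's identity gives (norm z) ^ 2 * (norm d) ^ 2 - (z . d)
  ^ 2 = 2 * W ^ 2 in the coordinates x1 and x3. The 2 cancels against the one in (norm (a - b)) ^ 2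
  = 2 * (a1 - b1) ^ 2.\<close>

lemma cross_lower:
  assumes \<sigma>: "\<bar>\<sigma>\<bar> = 1" and a: "a \<in> sqQ" "a $ 2 = \<sigma> * a $ 1" and b: "b \<in> sqQ" "b $ 2 = \<sigma> * b $ 1"
    and near: "norm (h a - h b) \<le> \<epsilon>"
  shows "\<bar>h a $ 3 * h b $ 1 - h b $ 3 * h a $ 1\<bar> \<ge> m * sin \<theta> / L * \<bar>a $ 1 - b $ 1\<bar>"
proof -
  have s2: "\<sigma>\<^sup>2 = 1" using \<sigma> by (metis power2_abs power_one)
  define z d where "z = h b" and "d = h a - h b"
  define W where "W = h a $ 3 * h b $ 1 - h b $ 3 * h a $ 1"
  have z2: "z $ 2 = \<sigma> * z $ 1" "d $ 2 = \<sigma> * d $ 1"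
    using h_diag[OF \<sigma> a] h_diag[OF \<sigma> b] by (simp_all add: z_def d_def algebra_simps)
  have W: "W = d $ 3 * z $ 1 - z $ 3 * d $ 1" by (simp add: W_def d_def z_def algebra_simps)
  have "(norm z)\<^sup>2 * (norm d)\<^sup>2 - (z \<bullet> d)\<^sup>2 = 2 * W\<^sup>2"
  proof -
    have e: "(\<sigma> * u) * (\<sigma> * v) = u * v" for u v
    proof -
      have "(\<sigma> * u) * (\<sigma> * v) = \<sigma>\<^sup>2 * (u * v)" by (simp only: power2_eq_square mult_ac)
      then show ?thesis using s2 by simp
    qed
    have n: "(norm z)\<^sup>2 = 2 * (z $ 1)\<^sup>2 + (z $ 3)\<^sup>2" "(norm d)\<^sup>2 = 2 * (d $ 1)\<^sup>2 + (d $ 3)\<^sup>2"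
      "z \<bullet> d = 2 * (z $ 1 * d $ 1) + z $ 3 * d $ 3"
      unfolding norm_real3 inner_real3 z2 using s2 e by (simp_all add: power_mult_distrib)
    show ?thesis unfolding n W by (simp add: power2_eq_square algebra_simps)
  qed
  moreover have "(z \<bullet> d)\<^sup>2 \<le> (cos \<theta>)\<^sup>2 * ((norm z)\<^sup>2 * (norm d)\<^sup>2)"
  proof -
    have "\<bar>z \<bullet> d\<bar> \<le> cos \<theta> * (norm z * norm d)"
      using nontang_inner[OF a(1) b(1) near, of 1 1] by (simp add: z_def d_def)
    then have "\<bar>z \<bullet> d\<bar>\<^sup>2 \<le> (cos \<theta> * (norm z * norm d))\<^sup>2" by (intro power_mono) auto
    then show ?thesis by (simp add: power_mult_distrib)
  qed
  ultimately have "(sin \<theta>)\<^sup>2 * ((norm z)\<^sup>2 * (norm d)\<^sup>2) \<le> 2 * W\<^sup>2"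
    by (simp add: sin_squared_eq algebra_simps)
  moreover have "2 * (m * sin \<theta> / L * \<bar>a $ 1 - b $ 1\<bar>)\<^sup>2 \<le> (sin \<theta>)\<^sup>2 * ((norm z)\<^sup>2 * (norm d)\<^sup>2)"
  proof -
    have "(norm (a - b))\<^sup>2 = 2 * (a $ 1 - b $ 1)\<^sup>2"
      using s2 by (simp add: norm_real2 a(2) b(2) power_mult_distrib flip: right_diff_distrib)
    moreover have "(norm (a - b) / L)\<^sup>2 \<le> (norm d)\<^sup>2"
      using lip_lower[OF a(1) b(1)] L_pos unfolding d_def by (intro power_mono) auto
    ultimately have d2: "2 * (a $ 1 - b $ 1)\<^sup>2 / L\<^sup>2 \<le> (norm d)\<^sup>2" by (simp add: power_divide)
    have z2: "m\<^sup>2 \<le> (norm z)\<^sup>2" unfolding z_def using m_le[OF b(1)] m_pos by (intro power_mono) auto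
    have "m\<^sup>2 * (2 * (a $ 1 - b $ 1)\<^sup>2 / L\<^sup>2) \<le> (norm z)\<^sup>2 * (norm d)\<^sup>2"
      by (intro mult_mono z2 d2) auto
    then have "(sin \<theta>)\<^sup>2 * (m\<^sup>2 * (2 * (a $ 1 - b $ 1)\<^sup>2 / L\<^sup>2)) \<le> (sin \<theta>)\<^sup>2 * ((norm z)\<^sup>2 * (norm d)\<^sup>2)"
      by (intro mult_left_mono) auto
    then show ?thesis by (simp add: power_mult_distrib power_divide mult_ac)
  qed
  ultimately have "(m * sin \<theta> / L * \<bar>a $ 1 - b $ 1\<bar>)\<^sup>2 \<le> \<bar>W\<bar>\<^sup>2" by simp
  then show ?thesis unfolding W_def by (rule power2_le_imp_le) simp
qed

text \<open>Such an interval lies on one side of a single even multiple of \<open>lam\<close>,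
  adjacent to it, where only one branch of \<open>T\<close> is involved.\<close>

lemma T_half_strip:
  fixes j :: int
  assumes "s \<in> {j * lam<..<(j + 1) * lam}" "s' \<in> {j * lam<..<(j + 1) * lam}"
  shows "\<bar>T s - T s'\<bar> = \<bar>s - s'\<bar>" "T s \<noteq> 0"
proof -
  obtain k :: int where k: "j = 2 * k \<or> j = 2 * k - 1" by (metis oddE evenE add_diff_cancel_right' diff_add_cancel even_add odd_one)
  have b: "\<bar>s - 2 * real_of_int k * lam\<bar> < lam" "\<bar>s' - 2 * real_of_int k * lam\<bar> < lam" "s - 2 * real_of_int k * lam \<noteq> 0"
  proof -
    have "real_of_int j = 2 * real_of_int k \<or> real_of_int j = 2 * real_of_int k - 1" using k by auto
    then have "2 * real_of_int k * lam = j * lam \<or> 2 * real_of_int k * lam = (j + 1) * lam" by auto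
    moreover have "(real_of_int j + 1) * lam = j * lam + lam" by (simp add: algebra_simps)
    ultimately show "\<bar>s - 2 * real_of_int k * lam\<bar> < lam" "\<bar>s' - 2 * real_of_int k * lam\<bar> < lam" "s - 2 * real_of_int k * lam \<noteq> 0"
      using assms by (auto simp: abs_less_iff)
  qed
  have "T s = parity k * (s - 2 * real_of_int k * lam)" "T s' = parity k * (s' - 2 * real_of_int k * lam)"
    using b by (intro T_eq; simp)+
  then show "\<bar>T s - T s'\<bar> = \<bar>s - s'\<bar>" "T s \<noteq> 0"
    using b(3) by (auto simp: abs_mult simp flip: right_diff_distrib)
qed

text \<open>Half of the rate lam * m * sin \<open>\<theta>\<close> / L from
  \<open>cross_lower\<close>, because \<open>planar_preimage_le\<close> asks for 2 * K.\<close>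

definition K2 :: real where
  "K2 = lam * m * sin \<theta> / (2 * L)"

lemma K2_gt_2: "K2 > 2"
proof -
  have "4 * L \<le> L ^ 4 * L" using L4 L_pos by (intro mult_right_mono) auto
  also have "\<dots> = L ^ 5" by (simp add: power_numeral_reduce)
  also have "\<dots> < lam * m * sin \<theta>" by (rule lamC)
  finally show ?thesis using L_pos by (simp add: K2_def field_simps)
qed

lemma diag_foot_continuous: "continuous_on S (\<lambda>s. h (diag_foot \<sigma> s))" if "\<bar>\<sigma>\<bar> = 1"
proof (rule continuous_on_compose2[OF h_continuous])
  show "continuous_on S (diag_foot \<sigma>)"
    unfolding diag_foot_def using lam_pos by (intro continuous_on_vector2 continuous_intros T_continuous) auto
qed (use diag_foot_in[OF that] in auto)

lemma plane_map_continuous: "continuous_on S (plane_map \<sigma>)" if "\<bar>\<sigma>\<bar> = 1"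
proof -
  have "continuous_on S (\<lambda>z. h (diag_foot \<sigma> (fst z)))"
    by (rule continuous_on_compose2[OF diag_foot_continuous[OF that, of UNIV]]) (auto intro!: continuous_intros)
  then show ?thesis unfolding plane_map_def by (intro continuous_intros)
qed

text \<open>Only the centre of the square is mapped to the axis, so the first coordinate has
  constant sign on a half strip and slopes can be used as a coordinate there.\<close>

lemma half_strip_preimage_le:
  fixes j :: int
  assumes \<sigma>: "\<bar>\<sigma>\<bar> = 1" and B: "B \<in> sets borel"
  shows "ennreal K2 * emeasure lborel {z. fst z \<in> {j * lam<..<(j + 1) * lam} \<and> 0 < snd z \<and> plane_map \<sigma> z \<in> B} \<le> emeasure lborel B"
proof -
  let ?I = "{j * lam<..<(j + 1) * lam}"
  define r where "r s = lam * h (diag_foot \<sigma> s) $ 1" for s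
  define q where "q s = lam * h (diag_foot \<sigma> s) $ 3" for s
  have foot2: "diag_foot \<sigma> s $ 2 = \<sigma> * diag_foot \<sigma> s $ 1" "diag_foot \<sigma> s $ 1 = T s / lam" for s
    by (simp_all add: diag_foot_def)
  have rq: "continuous_on ?I r" "continuous_on ?I q"
    unfolding r_def q_def by (intro continuous_intros diag_foot_continuous[OF \<sigma>])+
  have same: "s = s'" if s: "s \<in> ?I" "s' \<in> ?I" and eq: "h (diag_foot \<sigma> s) = k *\<^sub>R h (diag_foot \<sigma> s')" "k \<ge> 0" for s s' k
  proof -
    have "diag_foot \<sigma> s = diag_foot \<sigma> s'"
      using ray_inj[OF diag_foot_in diag_foot_in eq] \<sigma> by simp
    then have "T s = T s'" using foot2(2)[of s] foot2(2)[of s'] lam_pos by simp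
    then show ?thesis using T_half_strip(1)[OF s] by simp
  qed
  have r0: "r s \<noteq> 0" if s: "s \<in> ?I" for s
  proof
    assume "r s = 0"
    then have z: "h (diag_foot \<sigma> s) $ 1 = 0" using lam_pos by (simp add: r_def)
    then have "h (diag_foot \<sigma> s) = h (diag_foot \<sigma> s) $ 3 *\<^sub>R h 0"
      using h_diag_foot[OF \<sigma>, of s] by (simp add: h_0 vec_eq_iff forall_3)
    moreover have "h (diag_foot \<sigma> s) $ 3 \<ge> 0" using upper diag_foot_in[OF \<sigma>] by blast
    ultimately have "diag_foot \<sigma> s = 0" using ray_inj[OF diag_foot_in[OF \<sigma>] center_in] by blast
    then have "T s = 0" using foot2(2)[of s] lam_pos by simp
    then show False using T_half_strip(2)[OF s s] by blast
  qed
  \<comment> \<open>The sign of the first coordinate. Reflecting the target set accordingly makes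
    the coordinate positive without changing areas.\<close>
  obtain \<tau> :: real where \<tau>: "\<bar>\<tau>\<bar> = 1" "\<And>s. s \<in> ?I \<Longrightarrow> \<tau> * r s > 0"
  proof -
    have con: "connected (r ` ?I)" using rq(1) by (intro connected_continuous_image) auto
    have nz: "0 \<notin> r ` ?I" using r0 by auto
    show ?thesis
    proof (cases "\<exists>s\<in>?I. r s > 0")
      case True
      then obtain s where s: "s \<in> ?I" "r s > 0" by blast
      have "r s' > 0" if "s' \<in> ?I" for s'
        using connected_contains_Icc[OF con, of "r s'" "r s"] nz s that by (force simp: not_less)
      then show ?thesis by (intro that[of 1]) auto
    next
      case False
      then have "r s < 0" if "s \<in> ?I" for s using r0[OF that] that by force
      then show ?thesis by (intro that[of "- 1"]) auto
    qed
  qed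
  define p where "p s = \<tau> * r s" for s
  have tt: "\<tau> * \<tau> = 1" "\<tau> = 1 \<or> \<tau> = - 1" using \<tau>(1) by (auto simp: abs_if split: if_splits)
  define B' where "B' = {(x, y). (\<tau> * x, y) \<in> B}"
  have B'1: "B' \<in> sets borel"
  proof -
    have "(\<lambda>z::real \<times> real. (\<tau> * fst z, snd z)) \<in> borel_measurable borel"
      by (intro borel_measurable_continuous_onI continuous_intros)
    from measurable_sets[OF this B] show ?thesis by (simp add: B'_def vimage_def case_prod_beta')
  qed
  have B'2: "emeasure lborel B' = emeasure lborel B"
    using tt(2) emeasure_lborel_reflect_fst[OF B] by (auto simp: B'_def)
  have "ennreal K2 * emeasure lborel {(s, t). s \<in> ?I \<and> 0 < t \<and> (exp t * p s, exp t * q s) \<in> B'} \<le> emeasure lborel B'"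
  \<comment> \<open>Within this distance the feet differ by at most 2 * d / lam, hence the surface
    points by at most \<open>\<epsilon>\<close>, as \<open>cross_lower\<close> demands.\<close>
  proof (rule planar_preimage_le[where d = "\<epsilon> * lam / (2 * L)"])
    show "continuous_on ?I p" unfolding p_def by (intro continuous_intros rq)
    show "p s > 0" if "s \<in> ?I" for s using \<tau>(2)[OF that] by (simp add: p_def)
    show "inj_on (\<lambda>s. q s / p s) ?I"
    proof (rule inj_onI)
      fix s s' assume s: "s \<in> ?I" "s' \<in> ?I" "q s / p s = q s' / p s'"
      have pp: "p s > 0" "p s' > 0" using s \<tau>(2) by (auto simp: p_def)
      define k where "k = p s / p s'"
      have k: "k > 0" using pp by (simp add: k_def)
      have "p s = k * p s'" using pp by (simp add: k_def)
      then have "\<tau> * (\<tau> * r s) = \<tau> * (k * (\<tau> * r s'))" by (simp add: p_def)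
      then have "r s = k * r s'" using tt(2) by auto
      moreover have "q s = k * q s'" using s(3) pp by (simp add: k_def field_simps)
      ultimately have c: "h (diag_foot \<sigma> s) $ 1 = k * h (diag_foot \<sigma> s') $ 1" "h (diag_foot \<sigma> s) $ 3 = k * h (diag_foot \<sigma> s') $ 3"
        using lam_pos by (simp_all add: r_def q_def)
      then have "h (diag_foot \<sigma> s) = k *\<^sub>R h (diag_foot \<sigma> s')"
        using h_diag_foot[OF \<sigma>, of s] h_diag_foot[OF \<sigma>, of s'] by (simp add: vec_eq_iff forall_3)
      then show "s = s'" by (rule same[OF s(1,2) _ less_imp_le[OF k]])
    qed
    show "\<epsilon> * lam / (2 * L) > 0" using theta(3) lam_pos L_pos by simp
    fix s s' assume s: "s \<in> ?I" "s' \<in> ?I" "\<bar>s - s'\<bar> < \<epsilon> * lam / (2 * L)"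
    have TT: "\<bar>diag_foot \<sigma> s $ 1 - diag_foot \<sigma> s' $ 1\<bar> = \<bar>s - s'\<bar> / lam"
      using T_half_strip(1)[OF s(1,2)] lam_pos by (simp add: foot2(2) abs_divide flip: diff_divide_distrib)
    have T2: "\<bar>diag_foot \<sigma> s $ 2 - diag_foot \<sigma> s' $ 2\<bar> = \<bar>s - s'\<bar> / lam"
      unfolding foot2(1) using TT \<sigma> by (simp add: abs_mult flip: right_diff_distrib)
    have "norm (h (diag_foot \<sigma> s) - h (diag_foot \<sigma> s')) \<le> L * norm (diag_foot \<sigma> s - diag_foot \<sigma> s')"
      by (rule lip) (simp_all add: diag_foot_in \<sigma>)
    also have "\<dots> \<le> L * (\<bar>s - s'\<bar> / lam + \<bar>s - s'\<bar> / lam)"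
      using norm_le_abs_sum_real2[of "diag_foot \<sigma> s - diag_foot \<sigma> s'"] L_pos
      by (intro mult_left_mono) (simp_all add: TT T2)
    also have "\<dots> \<le> \<epsilon>" using s(3) L_pos lam_pos by (simp add: field_simps)
    finally have near: "norm (h (diag_foot \<sigma> s) - h (diag_foot \<sigma> s')) \<le> \<epsilon>" .
    have "m * sin \<theta> / L * (\<bar>s - s'\<bar> / lam) \<le> \<bar>h (diag_foot \<sigma> s) $ 3 * h (diag_foot \<sigma> s') $ 1 - h (diag_foot \<sigma> s') $ 3 * h (diag_foot \<sigma> s) $ 1\<bar>"
      using cross_lower[OF \<sigma> diag_foot_in[OF \<sigma>] foot2(1) diag_foot_in[OF \<sigma>] foot2(1) near] unfolding TT .
    then have "lam * lam * (m * sin \<theta> / L * (\<bar>s - s'\<bar> / lam)) \<le>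
        lam * lam * \<bar>h (diag_foot \<sigma> s) $ 3 * h (diag_foot \<sigma> s') $ 1 - h (diag_foot \<sigma> s') $ 3 * h (diag_foot \<sigma> s) $ 1\<bar>"
      using lam_pos by (intro mult_left_mono) auto
    also have "\<dots> = \<bar>lam * lam * (h (diag_foot \<sigma> s) $ 3 * h (diag_foot \<sigma> s') $ 1 - h (diag_foot \<sigma> s') $ 3 * h (diag_foot \<sigma> s) $ 1)\<bar>"
      using lam_pos by (simp add: abs_mult)
    also have "lam * lam * (h (diag_foot \<sigma> s) $ 3 * h (diag_foot \<sigma> s') $ 1 - h (diag_foot \<sigma> s') $ 3 * h (diag_foot \<sigma> s) $ 1) = q s * r s' - q s' * r s"
      by (simp add: q_def r_def algebra_simps)
    also have "\<bar>q s * r s' - q s' * r s\<bar> = \<bar>q s * p s' - q s' * p s\<bar>"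
      using tt(2) by (auto simp: p_def abs_minus_commute)
    also have "lam * lam * (m * sin \<theta> / L * (\<bar>s - s'\<bar> / lam)) = 2 * K2 * \<bar>s - s'\<bar>"
      using lam_pos L_pos by (simp add: K2_def)
    finally show "2 * K2 * \<bar>s - s'\<bar> \<le> \<bar>q s * p s' - q s' * p s\<bar>" .
  qed (use rq K2_gt_2 B'1 in auto)
  also have "{(s, t). s \<in> ?I \<and> 0 < t \<and> (exp t * p s, exp t * q s) \<in> B'} =
      {z. fst z \<in> ?I \<and> 0 < snd z \<and> plane_map \<sigma> z \<in> B}"
  proof -
    have "(\<tau> * (exp t * p s), exp t * q s) = plane_map \<sigma> (s, t)" for s t
      using tt(2) by (auto simp: plane_map_def p_def q_def r_def)
    then show ?thesis unfolding B'_def mem_Collect_eq prod.case by auto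
  qed
  finally show ?thesis using B'2 by simp
qed

lemma null_line_fst: "{z :: real \<times> real. fst z = c} \<in> null_sets lborel"
proof -
  have "{c} \<times> (UNIV :: real set) \<in> null_sets (lborel \<Otimes>\<^sub>M lborel)"
    by (intro lborel.times_in_null_sets1) auto
  moreover have "{z :: real \<times> real. fst z = c} = {c} \<times> UNIV" by auto
  ultimately show ?thesis by (simp add: lborel_prod)
qed

lemma null_line_snd: "{z :: real \<times> real. snd z = c} \<in> null_sets lborel"
proof -
  have "(UNIV :: real set) \<times> {c} \<in> null_sets (lborel \<Otimes>\<^sub>M lborel)"
    by (intro lborel.times_in_null_sets2) auto
  moreover have "{z :: real \<times> real. snd z = c} = UNIV \<times> {c}" by auto
  ultimately show ?thesis by (simp add: lborel_prod)
qed

definition strip :: "int \<Rightarrow> (real \<times> real) set" where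
  "strip i = {z. 2 * real_of_int i * lam < fst z \<and> fst z < 2 * (real_of_int i + 1) * lam \<and> 0 \<le> snd z}"

lemma plane_map_measurable: "plane_map \<sigma> \<in> borel_measurable borel" if "\<bar>\<sigma>\<bar> = 1"
  by (rule borel_measurable_continuous_onI[OF plane_map_continuous[OF that]])

lemma strip_sets: "strip i \<in> sets borel"
proof -
  have "strip i = {z. 2 * real_of_int i * lam < fst z} \<inter> {z. fst z < 2 * (real_of_int i + 1) * lam} \<inter> {z. 0 \<le> snd z}"
    by (auto simp: strip_def)
  moreover have "{z :: real \<times> real. 2 * real_of_int i * lam < fst z} \<in> sets borel" "{z :: real \<times> real. fst z < 2 * (real_of_int i + 1) * lam} \<in> sets borel"
    by (intro borel_open open_Collect_less continuous_intros)+
  moreover have "{z :: real \<times> real. 0 \<le> snd z} \<in> sets borel"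
    by (intro borel_closed closed_Collect_le continuous_intros)
  ultimately show ?thesis by simp
qed

text \<open>Both half strips cover the same set, as the map folds the strip along its middle line.
  This costs a factor 2, which is why \<open>K2_gt_2\<close> is needed rather than a bound by
  1.\<close>

lemma strip_preimage_le:
  assumes \<sigma>: "\<bar>\<sigma>\<bar> = 1" and B: "B \<in> sets borel"
  shows "ennreal (K2 / 2) * emeasure lborel (strip i \<inter> plane_map \<sigma> -` B) \<le> emeasure lborel B"
proof -
  define P where "P j = {z. fst z \<in> {real_of_int j * lam<..<(real_of_int j + 1) * lam} \<and> 0 < snd z \<and> plane_map \<sigma> z \<in> B}" for j :: int
  have gB: "plane_map \<sigma> -` B \<in> sets borel" using measurable_sets[OF plane_map_measurable[OF \<sigma>] B] by simp
  have P: "P j \<in> sets borel" for j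
  proof -
    have "P j = {z. real_of_int j * lam < fst z} \<inter> {z. fst z < (real_of_int j + 1) * lam} \<inter> {z. 0 < snd z} \<inter> plane_map \<sigma> -` B"
      by (auto simp: P_def)
    moreover have "{z :: real \<times> real. real_of_int j * lam < fst z} \<in> sets borel" "{z :: real \<times> real. fst z < (real_of_int j + 1) * lam} \<in> sets borel"
      "{z :: real \<times> real. 0 < snd z} \<in> sets borel"
      by (intro borel_open open_Collect_less continuous_intros)+
    ultimately show ?thesis using gB by simp
  qed
  have Pj: "ennreal K2 * emeasure lborel (P j) \<le> emeasure lborel B" for j
    using half_strip_preimage_le[OF \<sigma> B, of j] by (simp add: P_def)
  define N where "N = {z :: real \<times> real. fst z = (2 * real_of_int i + 1) * lam} \<union> {z. snd z = 0}"
  have N: "N \<in> null_sets lborel"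
    unfolding N_def by (intro null_sets.Un null_line_fst null_line_snd)
  have "strip i \<inter> plane_map \<sigma> -` B \<subseteq> (P (2 * i) \<union> P (2 * i + 1)) \<union> N"
    by (auto simp: strip_def P_def N_def algebra_simps)
  then have "emeasure lborel (strip i \<inter> plane_map \<sigma> -` B) \<le> emeasure lborel ((P (2 * i) \<union> P (2 * i + 1)) \<union> N)"
    using P N by (intro emeasure_mono) auto
  also have "\<dots> = emeasure lborel (P (2 * i) \<union> P (2 * i + 1))"
    using P N by (intro emeasure_Un_null_set) auto
  also have "\<dots> \<le> emeasure lborel (P (2 * i)) + emeasure lborel (P (2 * i + 1))"
    using P by (intro emeasure_subadditive) auto
  finally have "ennreal K2 * emeasure lborel (strip i \<inter> plane_map \<sigma> -` B) \<le>
      ennreal K2 * (emeasure lborel (P (2 * i)) + emeasure lborel (P (2 * i + 1)))" by (rule mult_left_mono) simp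
  also have "\<dots> = ennreal K2 * emeasure lborel (P (2 * i)) + ennreal K2 * emeasure lborel (P (2 * i + 1))"
    by (rule distrib_left)
  also have "\<dots> \<le> emeasure lborel B + emeasure lborel B" by (intro add_mono Pj)
  finally have *: "ennreal K2 * emeasure lborel (strip i \<inter> plane_map \<sigma> -` B) \<le> 2 * emeasure lborel B"
    by (simp add: mult_2)
  have "ennreal (K2 / 2) = ennreal (1 / 2) * ennreal K2"
    using K2_gt_2 by (subst ennreal_mult[symmetric]) auto
  then have "ennreal (K2 / 2) * emeasure lborel (strip i \<inter> plane_map \<sigma> -` B) =
      ennreal (1 / 2) * (ennreal K2 * emeasure lborel (strip i \<inter> plane_map \<sigma> -` B))" by (simp only: mult.assoc)
  also have "\<dots> \<le> ennreal (1 / 2) * (2 * emeasure lborel B)" by (rule mult_left_mono[OF *]) simp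
  also have "\<dots> = emeasure lborel B"
  proof -
    have "ennreal (1 / 2) * 2 = ennreal (1 / 2 * 2)" by (subst ennreal_mult) auto
    then show ?thesis by (simp flip: mult.assoc)
  qed
  finally show ?thesis .
qed

lemma planar_itinerary_le:
  assumes \<sigma>: "\<bar>\<sigma>\<bar> = 1" and B: "B \<in> sets borel"
  shows "ennreal ((K2 / 2) ^ n) * emeasure lborel {z. (\<forall>j<n. (plane_map \<sigma> ^^ j) z \<in> strip (i j)) \<and> (plane_map \<sigma> ^^ n) z \<in> B} \<le> emeasure lborel B"
  using B
proof (induction n arbitrary: B)
  case 0
  then show ?case by simp
next
  case (Suc n)
  define B' where "B' = strip (i n) \<inter> plane_map \<sigma> -` B"
  have "plane_map \<sigma> -` B \<in> sets borel" using measurable_sets[OF plane_map_measurable[OF \<sigma>] Suc.prems] by simp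
  then have B': "B' \<in> sets borel" unfolding B'_def using strip_sets by (intro sets.Int)
  have eq: "{z. (\<forall>j<Suc n. (plane_map \<sigma> ^^ j) z \<in> strip (i j)) \<and> (plane_map \<sigma> ^^ Suc n) z \<in> B} =
     {z. (\<forall>j<n. (plane_map \<sigma> ^^ j) z \<in> strip (i j)) \<and> (plane_map \<sigma> ^^ n) z \<in> B'}"
    by (auto simp: B'_def less_Suc_eq)
  have "ennreal ((K2 / 2) ^ Suc n) = ennreal (K2 / 2) * ennreal ((K2 / 2) ^ n)" using K2_gt_2 by (subst ennreal_mult[symmetric]) auto
  then have "ennreal ((K2 / 2) ^ Suc n) * emeasure lborel {z. (\<forall>j<Suc n. (plane_map \<sigma> ^^ j) z \<in> strip (i j)) \<and> (plane_map \<sigma> ^^ Suc n) z \<in> B} =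
     ennreal (K2 / 2) * (ennreal ((K2 / 2) ^ n) * emeasure lborel {z. (\<forall>j<n. (plane_map \<sigma> ^^ j) z \<in> strip (i j)) \<and> (plane_map \<sigma> ^^ n) z \<in> B'})"
    unfolding eq by (simp only: mult.assoc)
  also have "\<dots> \<le> ennreal (K2 / 2) * emeasure lborel B'" by (intro mult_left_mono Suc.IH[OF B']) simp
  also have "\<dots> \<le> emeasure lborel B" unfolding B'_def by (rule strip_preimage_le[OF \<sigma> Suc.prems])
  finally show ?case .
qed

lemma strip_slab_measure:
  assumes "H \<ge> 0"
  shows "emeasure lborel (strip i \<inter> {z. snd z \<le> H}) \<le> ennreal (2 * lam * H)"
proof -
  have "strip i \<inter> {z. snd z \<le> H} \<subseteq> cbox (2 * real_of_int i * lam, 0) (2 * (real_of_int i + 1) * lam, H)"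
    by (auto simp: strip_def cbox_Pair_eq)
  then have "emeasure lborel (strip i \<inter> {z. snd z \<le> H}) \<le> emeasure lborel (cbox (2 * real_of_int i * lam, 0) (2 * (real_of_int i + 1) * lam, H))"
    by (intro emeasure_mono) auto
  also have "\<dots> = ennreal (2 * lam * H)"
    unfolding cbox_Pair_eq lborel_prod[symmetric] using assms lam_pos
    by (subst lborel.emeasure_pair_measure_Times) (auto simp: algebra_simps simp flip: ennreal_mult)
  finally show ?thesis .
qed

text \<open>In the plane a low point lies in a bounded part of its strip, of finite area.
  Borel-Cantelli thus yields an orbit that eventually stays above 1 + \<open>\<bar>c\<bar>\<close>,
  whose sums grow linearly, against \<open>expansion_bounded\<close>.\<close>

lemma axis_free_open_set_misses_plane_pt:
  assumes V: "open V" and ax: "\<And>n y. y \<in> V \<Longrightarrow> axdist ((f ^^ n) y) \<noteq> 0"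
    and \<sigma>: "\<bar>\<sigma>\<bar> = 1" and z0: "plane_pt \<sigma> z0 \<in> V" "snd z0 \<ge> 0"
  shows False
proof -
  let ?g = "plane_map \<sigma>"
  obtain c where c: "\<And>U x. open U \<Longrightarrow> x \<in> U \<Longrightarrow> (\<And>n y. y \<in> U \<Longrightarrow> axdist ((f ^^ n) y) \<noteq> 0) \<Longrightarrow>
    \<exists>B. \<forall>n. (\<Sum>j<n. ((f ^^ j) x) $ 3 + c) \<le> B"
    using expansion_bounded by metis
  define H where "H = 1 + \<bar>c\<bar>"
  have ptc: "continuous_on UNIV (plane_pt \<sigma>)"
  proof -
    have "plane_pt \<sigma> = (\<lambda>z. fst z *\<^sub>R axis 1 1 + (\<sigma> * fst z) *\<^sub>R axis 2 1 + snd z *\<^sub>R axis 3 1)"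
      by (auto simp: plane_pt_def vec_eq_iff forall_3 axis_def)
    moreover have "continuous_on UNIV (\<lambda>z::real \<times> real. fst z *\<^sub>R (axis 1 1 :: real^3) + (\<sigma> * fst z) *\<^sub>R axis 2 1 + snd z *\<^sub>R axis 3 1)"
      by (intro continuous_intros)
    ultimately show ?thesis by metis
  qed
  have "open (plane_pt \<sigma> -` V)"
    using continuous_open_preimage[OF ptc open_UNIV V] by simp
  then obtain r where r: "r > 0" "ball z0 r \<subseteq> plane_pt \<sigma> -` V" using z0(1) openE by (metis vimageI)
  \<comment> \<open>Raising the centre by r / 2 keeps the smaller disc at nonnegative
    heights.\<close>
  define z1 where "z1 = (fst z0, snd z0 + r / 2)"
  define D where "D = ball z1 (r / 2)"
  have D: "open D" "connected D" "D \<noteq> {}" "D \<in> sets borel" using r(1) by (auto simp: D_def)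
  have DV: "plane_pt \<sigma> z \<in> V" and D0: "snd z \<ge> 0" if z: "z \<in> D" for z
  proof -
    have "dist z0 z1 = r / 2" using r(1) by (simp add: z1_def dist_prod_def dist_real_def)
    then have "z \<in> ball z0 r" using dist_triangle[of z0 z z1] z by (simp add: D_def)
    then show "plane_pt \<sigma> z \<in> V" using r(2) by auto
    have "dist (snd z1) (snd z) < r / 2" using dist_snd_le[of z1 z] z by (simp add: D_def)
    then show "snd z \<ge> 0" using z0(2) unfolding z1_def dist_real_def snd_conv by linarith
  qed
  have orbit: "(f ^^ n) (plane_pt \<sigma> z) = plane_pt \<sigma> ((?g ^^ n) z)" for n z by (rule funpow_plane_pt[OF \<sigma>])
  have avoid: "fst ((?g ^^ n) z) / (2 * lam) \<notin> \<int>" if "z \<in> D" for n z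
  proof
    assume "fst ((?g ^^ n) z) / (2 * lam) \<in> \<int>"
    then obtain i :: int where "fst ((?g ^^ n) z) / (2 * lam) = of_int i" by (auto simp: Ints_def)
    then have "fst ((?g ^^ n) z) = 2 * real_of_int i * lam" using lam_pos by (simp add: field_simps)
    then have "T (fst ((?g ^^ n) z)) = 0" using T_lattice by simp
    then have "axdist (plane_pt \<sigma> ((?g ^^ n) z)) = 0"
      by (simp add: axdist_eq_0_iff plane_pt_def sign_mult_T[OF \<sigma>])
    then show False using ax[OF DV[OF that], of n] orbit by simp
  qed
  have gn: "continuous_on UNIV (?g ^^ n)" for n
    by (induction n) (auto intro: continuous_on_compose[OF _ continuous_on_subset[OF plane_map_continuous[OF \<sigma>]]] simp del: o_apply)
  have nonneg: "snd ((?g ^^ n) z) \<ge> 0" if "z \<in> D" for n z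
  proof (cases n)
    case (Suc k)
    have "h (diag_foot \<sigma> s) $ 3 \<ge> 0" for s using upper diag_foot_in[OF \<sigma>] by blast
    then show ?thesis using Suc lam_pos by (simp add: plane_map_def)
  qed (use D0[OF that] in simp)
  have "\<exists>i. (?g ^^ n) ` D \<subseteq> strip i" for n
  proof -
    obtain i :: int where i: "\<And>z. z \<in> (?g ^^ n) ` D \<Longrightarrow> of_int i < fst z / (2 * lam) \<and> fst z / (2 * lam) < of_int i + 1"
    proof (rule connected_avoids_Ints[of "(?g ^^ n) ` D" "\<lambda>z. fst z / (2 * lam)"])
      show "connected ((?g ^^ n) ` D)"
        using D(2) gn continuous_on_subset by (intro connected_continuous_image) blast+
    qed (use avoid lam_pos in \<open>auto intro!: continuous_intros\<close>)
    have "z \<in> strip i" if "z \<in> (?g ^^ n) ` D" for z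
      using i[OF that] nonneg that lam_pos by (auto simp: strip_def field_simps)
    then show ?thesis by blast
  qed
  then obtain i where i: "\<And>n. (?g ^^ n) ` D \<subseteq> strip (i n)" by metis
  define E where "E n = D \<inter> (?g ^^ n) -` {z. snd z \<le> H}" for n
  have Hc: "{z :: real \<times> real. snd z \<le> H} \<in> sets borel"
    by (intro borel_closed closed_Collect_le continuous_intros)
  have E: "E n \<in> sets borel" for n
  proof -
    have "?g ^^ n \<in> borel_measurable borel" by (rule borel_measurable_continuous_onI[OF gn])
    from measurable_sets[OF this Hc] show ?thesis unfolding E_def using D(4) by (intro sets.Int) auto
  qed
  have "emeasure lborel (E n) \<le> ennreal (2 * lam * H * (2 / K2) ^ n)" for n
  proof -
    define B where "B = strip (i n) \<inter> {z. snd z \<le> H}"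
    have B: "B \<in> sets borel" unfolding B_def using strip_sets Hc by (intro sets.Int)
    define P where "P = {z. (\<forall>j<n. (?g ^^ j) z \<in> strip (i j)) \<and> (?g ^^ n) z \<in> B}"
    have "P \<in> sets borel"
    proof -
      have m: "(?g ^^ j) -` C \<in> sets borel" if "C \<in> sets borel" for j C
        using measurable_sets[OF borel_measurable_continuous_onI[OF gn] that] by simp
      have "P = (\<Inter>j\<in>{..<n}. (?g ^^ j) -` strip (i j)) \<inter> (?g ^^ n) -` B" by (auto simp: P_def)
      moreover have "(\<Inter>j\<in>{..<n}. (?g ^^ j) -` strip (i j)) \<in> sets borel"
        by (cases "n = 0") (auto intro!: sets.finite_INT m strip_sets)
      ultimately show ?thesis using m[OF B] by simp
    qed
    moreover have "E n \<subseteq> P" using i by (auto simp: E_def P_def B_def)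
    ultimately have "emeasure lborel (E n) \<le> emeasure lborel P" by (intro emeasure_mono) auto
    then have "ennreal ((K2 / 2) ^ n) * emeasure lborel (E n) \<le> ennreal ((K2 / 2) ^ n) * emeasure lborel P"
      by (rule mult_left_mono) simp
    also have "\<dots> \<le> emeasure lborel B" unfolding P_def by (rule planar_itinerary_le[OF \<sigma> B])
    also have "\<dots> \<le> ennreal (2 * lam * H)" unfolding B_def by (rule strip_slab_measure) (simp add: H_def)
    finally have *: "ennreal ((K2 / 2) ^ n) * emeasure lborel (E n) \<le> ennreal (2 * lam * H)" .
    have "emeasure lborel (E n) = ennreal ((2 / K2) ^ n) * (ennreal ((K2 / 2) ^ n) * emeasure lborel (E n))"
      using K2_gt_2 by (simp add: mult.assoc[symmetric] ennreal_mult[symmetric] power_divide)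
    also have "\<dots> \<le> ennreal ((2 / K2) ^ n) * ennreal (2 * lam * H)" by (rule mult_left_mono[OF *]) simp
    also have "\<dots> = ennreal (2 * lam * H * (2 / K2) ^ n)"
      using K2_gt_2 lam_pos by (simp add: H_def ennreal_mult[symmetric] mult.commute)
    finally show ?thesis .
  qed
  then have ae: "AE z in lborel. \<exists>N. \<forall>n\<ge>N. z \<notin> E n"
    using E K2_gt_2 lam_pos
    by (intro AE_eventually_not_in[where C = "2 * lam * H" and q = "2 / K2"]) (auto simp: H_def)
  have "\<exists>z\<in>D. \<exists>N. \<forall>n\<ge>N. z \<notin> E n"
  proof (rule ccontr)
    assume neg: "\<not> ?thesis"
    have "AE z in lborel. z \<notin> D" using ae neg by (auto elim!: eventually_mono)
    then have "negligible D"
      using D(4) by (simp add: AE_iff_null_sets[symmetric] negligible_iff_null_sets null_sets_completionI)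
    then show False using D open_not_negligible by blast
  qed
  then obtain z N where z: "z \<in> D" "\<And>n. n \<ge> N \<Longrightarrow> z \<notin> E n" by blast
  have high: "((f ^^ n) (plane_pt \<sigma> z)) $ 3 > H" if "n \<ge> N" for n
  proof -
    have "((f ^^ n) (plane_pt \<sigma> z)) $ 3 = snd ((?g ^^ n) z)" unfolding orbit by (simp add: plane_pt_def)
    then show ?thesis using z(2)[OF that] z(1) by (simp add: E_def not_le)
  qed
  obtain B where B: "\<And>n. (\<Sum>j<n. ((f ^^ j) (plane_pt \<sigma> z)) $ 3 + c) \<le> B"
    using c[OF V DV[OF z(1)] ax] by blast
  define S where "S n = (\<Sum>j<n. ((f ^^ j) (plane_pt \<sigma> z)) $ 3 + c)" for n
  have grow: "S (N + k) \<ge> S N + real k" for k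
  proof (induction k)
    case (Suc k)
    have "S (N + Suc k) = S (N + k) + (((f ^^ (N + k)) (plane_pt \<sigma> z)) $ 3 + c)" by (simp add: S_def)
    moreover have "((f ^^ (N + k)) (plane_pt \<sigma> z)) $ 3 + c \<ge> 1" using high[of "N + k"] by (simp add: H_def)
    ultimately show ?case using Suc by simp
  qed simp
  obtain k :: nat where "real k > B - S N" using reals_Archimedean2 by blast
  then have "S (N + k) > B" using grow[of k] by linarith
  then show False using B[of "N + k"] by (simp add: S_def)
qed

lemma open_set_meets_axis_lines:
  assumes U: "open U" "U \<noteq> {}"
  shows "\<exists>n. \<exists>y\<in>U. axdist ((f ^^ n) y) = 0"
proof (rule ccontr)
  assume "\<not> ?thesis"
  then have ax: "\<And>n y. y \<in> U \<Longrightarrow> axdist ((f ^^ n) y) \<noteq> 0" by blast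
  obtain x r where xr: "r > 0" "ball x r \<subseteq> U" using U openE by (metis ex_in_conv)
  define W where "W = ball x r"
  have W: "open W" "connected W" "W \<noteq> {}" "\<And>n y. y \<in> W \<Longrightarrow> axdist ((f ^^ n) y) \<noteq> 0"
    using xr ax by (auto simp: W_def)
  obtain n y where y: "y \<in> W" "(f ^^ n) y \<in> diag_planes" using meets_diag_planes[OF W] by blast
  obtain \<sigma> z where \<sigma>: "\<bar>\<sigma>\<bar> = 1" "f ((f ^^ n) y) = plane_pt \<sigma> z" using f_diag_planes[OF y(2)] by metis
  \<comment> \<open>One step to reach the plane of \<open>\<sigma>\<close>, one more to make the
    height nonnegative.\<close>
  define V where "V = (f ^^ (n + 2)) ` W"
  have V: "open V" unfolding V_def by (rule open_iterate_image[OF W(1)])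
  have Vax: "axdist ((f ^^ k) v) \<noteq> 0" if v: "v \<in> V" for k v
  proof -
    obtain w where w: "w \<in> W" "v = (f ^^ (n + 2)) w" using v by (auto simp: V_def)
    then have "(f ^^ k) v = (f ^^ (k + (n + 2))) w" by (simp only: funpow_add o_apply)
    then show ?thesis using W(4)[OF w(1)] by metis
  qed
  have "(f ^^ (n + 2)) y = plane_pt \<sigma> (plane_map \<sigma> z)"
    using \<sigma>(2) f_plane_pt[OF \<sigma>(1), of z] by (simp add: numeral_2_eq_2)
  then have "plane_pt \<sigma> (plane_map \<sigma> z) \<in> V" using y(1) unfolding V_def by (metis imageI)
  moreover have "snd (plane_map \<sigma> z) \<ge> 0"
    using upper diag_foot_in[OF \<sigma>(1)] lam_pos by (simp add: plane_map_def)
  ultimately show False using axis_free_open_set_misses_plane_pt[OF V Vax \<sigma>(1)] by blast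
qed


theorem julia_set_eq_UNIV: "julia_set f = UNIV"
proof -
  have "zero_capacity (UNIV - (\<Union>k\<in>{1..}. (f ^^ k) ` U))" if U: "open U" "x \<in> U" for U x
  proof -
    obtain n y where y: "y \<in> U" "axdist ((f ^^ n) y) = 0"
      using open_set_meets_axis_lines[OF U(1)] U(2) by blast
    have "w \<in> (\<Union>k\<in>{1..}. (f ^^ k) ` U)" if w: "w \<noteq> 0" for w
    proof -
      have V: "open ((f ^^ n) ` U)" "(f ^^ n) y \<in> (f ^^ n) ` U"
        using open_iterate_image[OF U(1)] y(1) by auto
      obtain k where k: "k \<ge> 1" "w \<in> (f ^^ k) ` (f ^^ n) ` U"
        using axis_point_covers[OF V y(2) w] by blast
      then have "w \<in> (f ^^ (k + n)) ` U" by (simp add: funpow_add image_comp)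
      then show ?thesis using k(1) by (intro UN_I[of "k + n"]) auto
    qed
    then have "UNIV - (\<Union>k\<in>{1..}. (f ^^ k) ` U) \<subseteq> {0}" by blast
    then show ?thesis by (rule zero_capacity_subset_origin)
  qed
  then show ?thesis by (auto simp: julia_set_def)
qed

end

theorem theorem1p4:
  fixes h :: "real^2 \<Rightarrow> real^3"
    and L \<theta> \<epsilon> lam :: real
  assumes bilip: "L > 0" "bi_lipschitz_on L sqQ h"
    and sense: "sense_preserving_surf h"
    and upper: "\<forall>x\<in>sqQ. h x $ 3 \<ge> 0"
    and bdry: "\<forall>x\<in>frontier sqQ. h x $ 3 = 0"
    and ray: "\<forall>x\<in>sqQ. \<forall>t::real. t \<ge> 0 \<and> t *\<^sub>R h x \<in> h ` sqQ \<longrightarrow> t = 1"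
    and theta: "0 < \<theta>" "\<theta> < pi / 2" "\<epsilon> > 0"
    and nontang: "\<forall>w\<in>h ` sqQ. \<forall>z\<in>h ` sqQ. w \<noteq> z \<and> dist w z \<le> \<epsilon> \<longrightarrow>
                     line_angle z (w - z) > \<theta>"
    and minpos: "(INF x\<in>sqQ. norm (h x)) > 0"
    and diag1: "\<forall>t\<in>{-1..1}. h (vector [t, t]) $ 1 = h (vector [t, t]) $ 2"
    and diag2: "\<forall>t\<in>{-1..1}. h (vector [t, - t]) $ 1 = - (h (vector [t, - t]) $ 2)"
    and center: "h (vector [0, 0]) = vector [0, 0, 1]"
    and supnorm: "(SUP x\<in>sqQ. norm (h x)) = 1"
    and lam1: "lam \<ge> 1"
    and lamC: "lam > max (L ^ 5) (2 * L) / ((INF x\<in>sqQ. norm (h x)) * sin \<theta>)"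
  shows "julia_set (zorich_gen h lam) = UNIV"
proof -
  define m where "m = (INF x\<in>sqQ. norm (h x))"
  have m: "m > 0" using minpos by (simp add: m_def)
  have m_le: "m \<le> norm (h x)" if "x \<in> sqQ" for x
    unfolding m_def by (rule cINF_lower[OF _ that]) (auto intro: bdd_belowI[of _ 0])
  have norm_le: "norm (h x) \<le> 1" if "x \<in> sqQ" for x
  proof -
    have zero: "0 \<in> sqQ" by (simp add: in_sqQ)
    \<comment> \<open>The supremum bounds its members only for a bounded set, so boundedness is
      first derived from the Lipschitz condition.\<close>
    obtain R where R: "\<And>y. y \<in> sqQ \<Longrightarrow> norm y \<le> R"
      using compact_imp_bounded[OF compact_sqQ] by (auto simp: bounded_iff)
    have "norm (h y) \<le> norm (h 0) + L * R" if y: "y \<in> sqQ" for y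
    proof -
      have "dist (h y) (h 0) \<le> L * dist y 0" using bilip(2) y zero unfolding bi_lipschitz_on_def by blast
      also have "\<dots> \<le> L * R" using R[OF y] bilip(1) by (intro mult_left_mono) auto
      finally show ?thesis using norm_triangle_sub[of "h y" "h 0"] by (simp add: dist_norm)
    qed
    then have "bdd_above ((\<lambda>x. norm (h x)) ` sqQ)" by (auto intro!: bdd_aboveI)
    from cSUP_upper[OF that this] show ?thesis by (simp add: supnorm)
  qed
  have sn: "sin \<theta> > 0" using theta by (intro sin_gt_zero) auto
  have "max (L ^ 5) (2 * L) < lam * (m * sin \<theta>)"
    using lamC m sn unfolding m_def[symmetric] by (subst (asm) pos_divide_less_eq) auto
  then have "lam * m * sin \<theta> > L ^ 5" by (simp add: mult.assoc)
  then interpret zorich_surface h L \<theta> \<epsilon> lam m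
    using bilip sense upper bdry ray theta nontang m m_le diag1 diag2 center norm_le lam1
    by unfold_locales
  show ?thesis by (rule julia_set_eq_UNIV)
qed

end
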